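(* Let $a>0$ be given. Assume that $$e^{a}\, m^{1/r}(r)\le 1\qquad\text{for some } r\in(1,2),$$ and define $\vartheta$ to be the minimal $r>1$ such that $e^{ar}m(r)=1$. Assume further that $$\mathbb{E}\,W_1^{\vartheta}<\infty,$$ and, in the case when $a=-\log\inf_{r\ge 1} m^{1/r}(r)$ (which implies $\vartheta=\vartheta_0$), assume that $$-\frac{\log m(\vartheta_0)}{\vartheta_0}<-\frac{m'(\vartheta_0)}{m(\vartheta_0)}.$$ Then the series $$\sum_{n\ge 0}e^{an}(W-W_n)$$ converges almost surely.
   Context: Branching random walk. Let $\mathcal{M}=\sum_{i=1}^{J}\delta_{X_i}$ be a random point process on $\mathbb{R}$, where $J=\mathcal{M}(\mathbb{R})$ takes values in $\{0,1,2,\ldots\}\cup\{\infty\}$ ($J=\infty$ with positive probability is allowed, and nothing is assumed about the joint dependence of $J,X_1,X_2,\ldots$). Let $\mathbb{V}=\bigcup_{n\ge0}\mathbb{N}^n$ (with $\mathbb{N}^0=\{\varnothing\}$) and let $(\mathcal{M}(u))_{u\in\mathbb{V}}$ be i.i.d. copies of $\mathcal{M}$, $\mathcal{M}(u)=\sum_{i=1}^{J(u)}\delta_{X_i(u)}$, with $\mathcal{M}(\varnothing)=\mathcal{M}$. The ancestor $\varnothing$ is located at $S(\varnothing)=0$ at time $0$. An individual $u=u_1\ldots u_n$ of the $n$th generation with position $S(u)$ has the $J(u)$ children $u1,u2,\ldots,uJ(u)$, which belong to generation $n+1$ and have positions $S(ui)=S(u)+X_i(u)$. The notation $\sum_{|u|=n}$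 means summation over the (existing) individuals of the $n$th generation. Standing assumptions: $\mathbb{E}J>1$ (supercriticality), and, with $$m(\theta):=\mathbb{E}\int_{\mathbb{R}}e^{-\theta x}\,\mathcal{M}(dx)=\mathbb{E}\sum_{i=1}^{J}e^{-\theta X_i}\in[0,\infty],\qquad \theta\ge0,$$ it is assumed that $m(1)=1$. Here $m^{1/r}(r)$ means $(m(r))^{1/r}$ (equal to $+\infty$ when $m(r)=\infty$). Intrinsic martingale: $Y_u:=e^{-S(u)}$ and $W_n:=\sum_{|u|=n}Y_u$, $n\ge0$. This is a non-negative martingale with respect to the $\sigma$-fields $\mathcal{F}_n=\sigma(\mathcal{M}(u):|u|<n)$ and converges a.s. to a random variable denoted $W$. In particular $W_1=\sum_{i=1}^J e^{-X_i}$. If $0<\inf_{1\le\theta\le2}m^{1/\theta}(\theta)<1$, then $\vartheta_0\in(1,2]$ denotes the point with $m^{1/\vartheta_0}(\vartheta_0)=\inf_{1\le\theta\le2}m^{1/\theta}(\theta)$. $m'$ denotes the left derivative of $m$ (well-defined and negative on $(1,\vartheta_0]$). *)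

theory Defs
  imports "HOL-Probability.Probability"
begin

text \<open>
  Individuals are finite words over the natural numbers, the children of \<open>u\<close> being \<open>u @ [i]\<close>
  with \<open>i < J u\<close>: labels start at 0, so \<open>X u i\<close> is the displacement of the \<open>(i + 1)\<close>-st child,
  and the values of \<open>X u i\<close> for \<open>i \<ge> J u\<close> play no role.
\<close>

text \<open>The sum of the Dirac measures at \<open>x i\<close>, \<open>i < j\<close>, as the image of counting measure.\<close>

definition point_process :: "enat \<Rightarrow> (nat \<Rightarrow> real) \<Rightarrow> real measure" where
  "point_process j x = distr (count_space {i. enat i < j}) borel x"

text \<open>
  The processes \<open>\<M>(u)\<close> are i.i.d.\ copies of \<open>\<M>(\<emptyset>)\<close>. Independence is required of the
  families \<open>(J(u), X\<^sub>1(u), X\<^sub>2(u), \<dots>)\<close>, since independence of the random measures alone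
  would allow the labelling of the children of \<open>u\<close> to depend on the offspring of other individuals.
  Equality in law is only required of the random measures, with respect to the \<open>\<sigma>\<close>-field
  generated by the evaluations at Borel sets; it does not involve the labelling.
\<close>

locale branching_random_walk = prob_space M for M :: "'w measure" +
  fixes J :: "nat list \<Rightarrow> 'w \<Rightarrow> enat"
    and X :: "nat list \<Rightarrow> nat \<Rightarrow> 'w \<Rightarrow> real"
  assumes independent:
    "indep_vars (\<lambda>_. count_space UNIV \<Otimes>\<^sub>M (\<Pi>\<^sub>M i\<in>UNIV. borel))
       (\<lambda>u \<omega>. (J u \<omega>, \<lambda>i. X u i \<omega>)) UNIV"
    and identically_distributed:
    "\<And>u. distr M (\<Pi>\<^sub>M B\<in>sets borel. borel)
             (\<lambda>\<omega>. \<lambda>B\<in>sets borel. emeasure (point_process (J u \<omega>) (\<lambda>i. X u i \<omega>)) B) =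
          distr M (\<Pi>\<^sub>M B\<in>sets borel. borel)
             (\<lambda>\<omega>. \<lambda>B\<in>sets borel. emeasure (point_process (J [] \<omega>) (\<lambda>i. X [] i \<omega>)) B)"

definition position :: "(nat list \<Rightarrow> nat \<Rightarrow> 'w \<Rightarrow> real) \<Rightarrow> nat list \<Rightarrow> 'w \<Rightarrow> real" where
  "position X u \<omega> = (\<Sum>k<length u. X (take k u) (u ! k) \<omega>)"

definition generation :: "(nat list \<Rightarrow> 'w \<Rightarrow> enat) \<Rightarrow> nat \<Rightarrow> 'w \<Rightarrow> nat list set" where
  "generation J n \<omega> = {u. length u = n \<and> (\<forall>k<n. enat (u ! k) < J (take k u) \<omega>)}"

definition W_part ::
    "(nat list \<Rightarrow> 'w \<Rightarrow> enat) \<Rightarrow> (nat list \<Rightarrow> nat \<Rightarrow> 'w \<Rightarrow> real) \<Rightarrow> nat \<Rightarrow> 'w \<Rightarrow> ennreal" where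
  "W_part J X n \<omega> =
     (\<integral>\<^sup>+ u. ennreal (exp (- position X u \<omega>)) \<partial>count_space (generation J n \<omega>))"

text \<open>\<open>W_part J X n\<close> is almost surely finite, having expectation 1 when \<open>m 1 = 1\<close>.\<close>

definition W_lim ::
    "(nat list \<Rightarrow> 'w \<Rightarrow> enat) \<Rightarrow> (nat list \<Rightarrow> nat \<Rightarrow> 'w \<Rightarrow> real) \<Rightarrow> 'w \<Rightarrow> real" where
  "W_lim J X \<omega> = lim (\<lambda>n. enn2real (W_part J X n \<omega>))"

definition m ::
    "'w measure \<Rightarrow> (nat list \<Rightarrow> 'w \<Rightarrow> enat) \<Rightarrow> (nat list \<Rightarrow> nat \<Rightarrow> 'w \<Rightarrow> real) \<Rightarrow> real \<Rightarrow> ennreal"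
  where
  "m M J X \<theta> =
     (\<integral>\<^sup>+ \<omega>. (\<integral>\<^sup>+ x. ennreal (exp (- \<theta> * x)) \<partial>point_process (J [] \<omega>) (\<lambda>i. X [] i \<omega>)) \<partial>M)"

text \<open>Powers with positive exponent on \<open>[0,\<infinity>]\<close>; note that \<open>0 powr p = 0\<close>.\<close>

definition ennpowr :: "ennreal \<Rightarrow> real \<Rightarrow> ennreal" where
  "ennpowr x p = (if x = \<top> then \<top> else ennreal (enn2real x powr p))"

definition vartheta ::
    "'w measure \<Rightarrow> (nat list \<Rightarrow> 'w \<Rightarrow> enat) \<Rightarrow> (nat list \<Rightarrow> nat \<Rightarrow> 'w \<Rightarrow> real) \<Rightarrow> real \<Rightarrow> real" where
  "vartheta M J X a = (LEAST r. 1 < r \<and> ennreal (exp (a * r)) * m M J X r = 1)"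

text \<open>Well defined if the infimum lies strictly between 0 and 1.\<close>

definition vartheta0 ::
    "'w measure \<Rightarrow> (nat list \<Rightarrow> 'w \<Rightarrow> enat) \<Rightarrow> (nat list \<Rightarrow> nat \<Rightarrow> 'w \<Rightarrow> real) \<Rightarrow> real" where
  "vartheta0 M J X =
     (THE t. t \<in> {1<..2} \<and>
        ennpowr (m M J X t) (1 / t) = (INF \<theta>\<in>{1..2}. ennpowr (m M J X \<theta>) (1 / \<theta>)))"

definition m_left_deriv ::
    "'w measure \<Rightarrow> (nat list \<Rightarrow> 'w \<Rightarrow> enat) \<Rightarrow> (nat list \<Rightarrow> nat \<Rightarrow> 'w \<Rightarrow> real) \<Rightarrow> real \<Rightarrow> real" where
  "m_left_deriv M J X t = vector_derivative (\<lambda>\<theta>. enn2real (m M J X \<theta>)) (at_left t)"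

lemma position_Nil [simp]: "position X [] \<omega> = 0"
  by (simp add: position_def)

lemma position_snoc [simp]: "position X (u @ [i]) \<omega> = position X u \<omega> + X u i \<omega>"
  by (simp add: position_def nth_append)

lemma generation_0 [simp]: "generation J 0 \<omega> = {[]}"
  by (auto simp: generation_def)

lemma snoc_in_generation_iff [simp]:
  "u @ [i] \<in> generation J (Suc n) \<omega> \<longleftrightarrow> u \<in> generation J n \<omega> \<and> enat i < J u \<omega>"
  by (auto simp: generation_def nth_append less_Suc_eq)

lemma nn_integral_point_process:
  assumes "f \<in> borel_measurable borel"
  shows "(\<integral>\<^sup>+ y. f y \<partial>point_process j x) = (\<integral>\<^sup>+ i. f (x i) \<partial>count_space {i. enat i < j})"
  using assms by (simp add: point_process_def nn_integral_distr)

lemma W_part_0 [simp]: "W_part J X 0 \<omega> = 1"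
  by (simp add: W_part_def nn_integral_count_space_finite)

lemma W_part_1:
  "W_part J X 1 \<omega> = (\<integral>\<^sup>+ x. ennreal (exp (- x)) \<partial>point_process (J [] \<omega>) (\<lambda>i. X [] i \<omega>))"
proof -
  have gen: "generation J 1 \<omega> = (\<lambda>i. [i]) ` {i. enat i < J [] \<omega>}"
    by (auto simp: generation_def length_Suc_conv)
  have "bij_betw (\<lambda>i. [i]) {i. enat i < J [] \<omega>} (generation J 1 \<omega>)"
    unfolding gen by (intro inj_on_imp_bij_betw) (auto simp: inj_on_def)
  from nn_integral_bij_count_space[OF this, of "\<lambda>u. ennreal (exp (- position X u \<omega>))"]
  show ?thesis
    by (simp add: W_part_def nn_integral_point_process position_def)
qed

end

theory Submission
  imports Defs
begin

text \<open>
  Write \<open>V(u) = S(u) - a |u|\<close>, \<open>\<xi>(u) = W\<^sub>1(u) - 1\<close>, where \<open>W\<^sub>1(u)\<close> is the copy of \<open>W\<^sub>1\<close> belonging to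
  the children of \<open>u\<close>, and \<open>t = \<vartheta>\<close>. Then \<open>exp (a n) (W (n + 1) - W n)\<close> is the sum \<open>D n\<close> of
  \<open>exp (- V(u)) \<xi>(u)\<close> over \<open>|u| = n\<close>, and by partial summation it suffices that \<open>\<Sum>n. D n\<close>
  converges almost surely; this also yields the convergence of \<open>W n\<close>.

  Since \<open>exp (a t) m(t) = 1\<close>, weighting the individuals by \<open>exp (- t V(u))\<close> turns expectations over
  the \<open>n\<close>-th generation into expectations over a random walk at time \<open>n\<close> (many-to-one). Minimality
  of \<open>t\<close>, together with the derivative condition in the boundary case, says that its drift is
  positive. Hence its renewal measure of intervals of fixed length is bounded, uniformly in the
  location.

  Split \<open>\<xi>(u)\<close> at \<open>|\<xi>(u)| = exp (V(u))\<close>. By the renewal bound and \<open>E |\<xi>|\<^sup>t < \<infinity>\<close>, where \<open>1 < t < 2\<close>,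
  the large parts are summable in mean, and the centred small parts form an
  \<open>L\<^sup>2\<close>-bounded martingale, which converges by Kolmogorov's maximal inequality.
\<close>

text \<open>No filtration or conditional expectation is used. The work takes place on the product of
  the laws of the families, where conditioning on all but individual \<open>u\<close> means
  redrawing coordinate \<open>u\<close>. Only the point processes are equal in law, so the factors
  may differ, and laws are exchanged only for functions of a single \<open>child_sum\<close>. With
  F(\<theta>) = exp(a \<theta>) m(\<theta>), the Laplace transform of the step law at s is F(t + s).
  Since F(1) = exp a > 1, t is the first descent of F to 1. If F falls below 1 further on, convexity
  gives a positive mean; if not, F >= 1 on [1, oo), which is the boundary case. The renewal bound
  has to be uniform in the location: summed over the generations, a value x of \<xi> contributes
  |x|^t times the renewal integral of exp(- \<delta> |v - ln |x||), centred at ln |x|. The rates t -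
  1 for the large and 2 - t for the small part give \<delta> as their minimum; this is where 1 < t <
  2 enters. Generations may be infinite, whereas bounded orthogonal increments are at hand only for
  finite portions of them, so the maximal inequality is carried to a limit.\<close>

section \<open>Partial summation\<close>

text \<open>With q = exp (- a), the weighted tails \<open>x n\<close> and the weighted increments
  \<open>b n\<close> satisfy \<open>x n = b n + q * x (Suc n)\<close>. Hence (1 - q) times a partial
  sum of \<open>x\<close> is a partial sum of \<open>b\<close> plus \<open>q * (x N - x 0)\<close>.
  Conditional convergence of the series of \<open>b\<close> is enough, once \<open>x\<close> is
  known to tend to 0.\<close>

lemma summable_weighted_tail:
  fixes w :: "nat \<Rightarrow> real"
  assumes a: "a > 0" and s: "summable (\<lambda>n. exp (a * real n) * (w (Suc n) - w n))"
  shows "summable (\<lambda>n. exp (a * real n) * (lim w - w n))"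
proof -
  define q where "q = exp (- a)"
  define b where "b n = exp (a * real n) * (w (Suc n) - w n)" for n
  have q: "0 < q" "q < 1" using a by (auto simp: q_def)
  have e: "exp (a * real n) * q ^ n = 1" for n
    by (simp add: q_def exp_minus exp_of_nat_mult[symmetric] field_simps flip: exp_of_nat_mult)
  have d: "w (Suc n) - w n = q ^ n * b n" for n
    using e[of n] by (simp add: b_def mult.assoc[symmetric] mult.commute)
  have b0: "b \<longlonglongrightarrow> 0" using summable_LIMSEQ_zero[OF s] by (simp add: b_def[abs_def])
  \<comment> \<open>The increments of \<open>w\<close> beyond \<open>n\<close> are dominated by a
    geometric sequence. This is used with n = 0 to see that \<open>w\<close> converges, and with
    arbitrarily small \<open>c\<close> to see that the weighted tails vanish.\<close>
  have small: "summable (\<lambda>k. w (Suc (k + n)) - w (k + n)) \<and>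
      \<bar>exp (a * real n) * (\<Sum>k. w (Suc (k + n)) - w (k + n))\<bar> \<le> c / (1 - q)"
    if c: "\<And>k. k \<ge> n \<Longrightarrow> \<bar>b k\<bar> \<le> c" for c n
  proof -
    have le: "norm (w (Suc (k + n)) - w (k + n)) \<le> q ^ n * c * q ^ k" for k
      using c[of "k + n"] q by (simp add: d abs_mult power_add mult.assoc mult.left_commute mult_left_mono)
    have gs: "(\<lambda>k. q ^ n * c * q ^ k) sums (q ^ n * c * (1 / (1 - q)))"
      using q by (intro sums_mult geometric_sums) auto
    have sm: "summable (\<lambda>k. norm (w (Suc (k + n)) - w (k + n)))"
      by (rule summable_comparison_test'[OF sums_summable[OF gs], of 0]) (use le in auto)
    have "norm (\<Sum>k. w (Suc (k + n)) - w (k + n)) \<le> (\<Sum>k. norm (w (Suc (k + n)) - w (k + n)))"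
      by (rule summable_norm[OF sm])
    also have "\<dots> \<le> q ^ n * c * (1 / (1 - q))"
      using suminf_le[OF le sm sums_summable[OF gs]] sums_unique[OF gs] by simp
    finally have "exp (a * real n) * norm (\<Sum>k. w (Suc (k + n)) - w (k + n))
        \<le> exp (a * real n) * (q ^ n * c * (1 / (1 - q)))"
      by (rule mult_left_mono) simp
    then have "\<bar>exp (a * real n) * (\<Sum>k. w (Suc (k + n)) - w (k + n))\<bar>
        \<le> exp (a * real n) * (q ^ n * c * (1 / (1 - q)))"
      by (simp only: abs_mult abs_exp_cancel real_norm_def)
    also have "\<dots> = (exp (a * real n) * q ^ n) * c / (1 - q)" by simp
    finally show ?thesis using summable_norm_cancel[OF sm] by (simp add: e)
  qed
  obtain c where c: "\<And>k. \<bar>b k\<bar> \<le> c"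
    using convergent_imp_Bseq[OF convergentI[OF b0]] by (auto simp: Bseq_def)
  have "summable (\<lambda>k. w (Suc k) - w k)" using small[of 0 c] c by auto
  then have "convergent (\<lambda>n. \<Sum>k<n. w (Suc k) - w k)" by (simp add: summable_iff_convergent)
  then have "convergent (\<lambda>n. (w n - w 0) + w 0)"
    unfolding sum_lessThan_telescope by (intro convergent_add convergent_const)
  then have w: "w \<longlonglongrightarrow> lim w" by (simp add: convergent_LIMSEQ_iff)
  have tel: "(\<Sum>k. w (Suc (k + n)) - w (k + n)) = lim w - w n" for n
    using telescope_sums[OF LIMSEQ_ignore_initial_segment[OF w, of n]] by (simp add: sums_iff)
  define x where "x n = exp (a * real n) * (lim w - w n)" for n
  have x0: "x \<longlonglongrightarrow> 0"
  proof (rule LIMSEQ_I)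
    fix r :: real assume r: "r > 0"
    then have "r * (1 - q) / 2 > 0" using q by simp
    from LIMSEQ_D[OF b0 this] obtain N where N: "\<And>k. k \<ge> N \<Longrightarrow> \<bar>b k\<bar> < r * (1 - q) / 2" by auto
    have "\<bar>x n\<bar> \<le> (r * (1 - q) / 2) / (1 - q)" if "n \<ge> N" for n
      using small[of n "r * (1 - q) / 2"] N that unfolding x_def tel[symmetric]
      by (meson less_imp_le order_trans)
    moreover have "(r * (1 - q) / 2) / (1 - q) < r" using r q by (simp add: field_simps)
    ultimately show "\<exists>N. \<forall>n\<ge>N. norm (x n - 0) < r"
      by (intro exI[of _ N]) (metis diff_zero le_less_trans real_norm_def)
  qed
  have rec: "x n = b n + q * x (Suc n)" for n
  proof -
    have "q * exp (a * real (Suc n)) = exp (a * real n)"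
      by (simp add: q_def flip: exp_add) (simp add: algebra_simps)
    then have "q * x (Suc n) = exp (a * real n) * (lim w - w (Suc n))"
      by (simp only: x_def mult.assoc[symmetric])
    then show ?thesis by (simp add: x_def b_def algebra_simps)
  qed
  have "(\<Sum>n<N. x n) = ((\<Sum>n<N. b n) + q * (x N - x 0)) / (1 - q)" for N
  proof -
    have "(\<Sum>n<N. x n) = (\<Sum>n<N. b n) + q * (\<Sum>n<N. x (Suc n))"
      by (subst rec) (simp add: sum.distrib sum_distrib_left)
    also have "(\<Sum>n<N. x (Suc n)) = (\<Sum>n<N. x n) + (x N - x 0)"
      by (simp add: sum_lessThan_telescope[symmetric] sum.distrib[symmetric])
    finally show ?thesis using q by (simp add: field_simps)
  qed
  moreover have "convergent (\<lambda>N. ((\<Sum>n<N. b n) + q * (x N - x 0)) / (1 - q))"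
  proof -
    have "(\<lambda>N. ((\<Sum>n<N. b n) + q * (x N - x 0)) / (1 - q)) \<longlonglongrightarrow> (suminf b + q * (0 - x 0)) / (1 - q)"
      using q s x0 by (intro tendsto_intros summable_LIMSEQ) (auto simp: b_def[abs_def])
    then show ?thesis by (rule convergentI)
  qed
  ultimately have "convergent (\<lambda>N. \<Sum>n<N. x n)" by presburger
  then show ?thesis by (simp add: summable_iff_convergent x_def)
qed

section \<open>Renewal measures of random walks with positive drift\<close>

primrec conv_power :: "real measure \<Rightarrow> nat \<Rightarrow> real measure" where
  "conv_power Q 0 = return borel 0"
| "conv_power Q (Suc n) = convolution (conv_power Q n) Q"

lemma conv_power_prob_space:
  assumes "prob_space Q" "sets Q = sets borel"
  shows "prob_space (conv_power Q n)" "sets (conv_power Q n) = sets borel"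
proof -
  have "prob_space (conv_power Q n) \<and> sets (conv_power Q n) = sets borel"
  proof (induction n)
    case (Suc n)
    interpret A: prob_space Q by fact
    interpret B: prob_space "conv_power Q n" using Suc by blast
    interpret pair_prob_space "conv_power Q n" Q ..
    show ?case using Suc assms by (auto simp: convolution_def intro!: prob_space_distr)
  qed (auto intro: prob_space_return)
  then show "prob_space (conv_power Q n)" "sets (conv_power Q n) = sets borel" by auto
qed

lemma nn_integral_conv_power_Suc:
  assumes "prob_space Q" "sets Q = sets borel" and [measurable]: "f \<in> borel_measurable borel"
  shows "(\<integral>\<^sup>+x. f x \<partial>conv_power Q (Suc n)) = (\<integral>\<^sup>+x. \<integral>\<^sup>+y. f (x + y) \<partial>Q \<partial>conv_power Q n)"
  using conv_power_prob_space[OF assms(1,2), of n] assms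
  by (simp, subst nn_integral_convolution) (auto intro: prob_space.finite_measure)

text \<open>The law of min (0, S_1, ..., S_n) for a walk with step law \<open>R\<close>, built by
  prepending a step. Thus \<open>emeasure (running_min R n) {..- x}\<close> is the probability that
  the walk started at \<open>x\<close> enters the nonpositive half-line within \<open>n\<close>
  steps.\<close>

primrec running_min :: "real measure \<Rightarrow> nat \<Rightarrow> real measure" where
  "running_min R 0 = return borel 0"
| "running_min R (Suc n) = distr (R \<Otimes>\<^sub>M running_min R n) borel (\<lambda>x. min 0 (fst x + snd x))"

locale real_step = prob_space R for R :: "real measure" +
  assumes sets_R [measurable_cong]: "sets R = sets borel"
begin

lemma running_min_prob_space: "prob_space (running_min R n)"
  and sets_running_min [measurable_cong]: "sets (running_min R n) = sets borel"
proof -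
  have "prob_space (running_min R n) \<and> sets (running_min R n) = sets borel"
  proof (induction n)
    case (Suc n)
    interpret B: prob_space "running_min R n" using Suc by blast
    interpret pair_prob_space R "running_min R n" ..
    have [measurable_cong]: "sets (running_min R n) = sets borel" using Suc by blast
    show ?case by (auto intro!: prob_space_distr)
  qed (auto intro: prob_space_return)
  then show "prob_space (running_min R n)" "sets (running_min R n) = sets borel" by auto
qed

lemma pair_running_min: "pair_prob_space R (running_min R n)"
  using running_min_prob_space[of n] prob_space_axioms
  by (simp add: pair_prob_space_def pair_sigma_finite_def prob_space_imp_sigma_finite)

lemma measurable_pair_running_min [measurable]:
  "fst \<in> borel_measurable (R \<Otimes>\<^sub>M running_min R n)"
  "snd \<in> borel_measurable (R \<Otimes>\<^sub>M running_min R n)"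
  using measurable_fst[of R "running_min R n"] measurable_snd[of R "running_min R n"]
    measurable_cong_sets[OF refl sets_R] measurable_cong_sets[OF refl sets_running_min] by auto

lemma emeasure_pair_running_min:
  "emeasure (R \<Otimes>\<^sub>M running_min R n) {z \<in> space (R \<Otimes>\<^sub>M running_min R n). fst z + snd z \<le> c} =
    (\<integral>\<^sup>+y. emeasure (running_min R n) {..c - y} \<partial>R)"
proof -
  interpret pair_prob_space R "running_min R n" by (rule pair_running_min)
  have "emeasure (R \<Otimes>\<^sub>M running_min R n) {z \<in> space (R \<Otimes>\<^sub>M running_min R n). fst z + snd z \<le> c} =
    (\<integral>\<^sup>+y. emeasure (running_min R n)
      (Pair y -` {z \<in> space (R \<Otimes>\<^sub>M running_min R n). fst z + snd z \<le> c}) \<partial>R)"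
    by (intro M2.emeasure_pair_measure_alt borel_measurable_le borel_measurable_add
      measurable_pair_running_min borel_measurable_const)
  also have "\<dots> = (\<integral>\<^sup>+y. emeasure (running_min R n) {..c - y} \<partial>R)"
    using sets_eq_imp_space_eq[OF sets_R] sets_eq_imp_space_eq[OF sets_running_min[of n]]
    by (intro nn_integral_cong arg_cong2[where f=emeasure]) (auto simp: space_pair_measure)
  finally show ?thesis .
qed

lemma emeasure_running_min_Suc:
  "emeasure (running_min R (Suc n)) {..- x} =
    (if x \<le> 0 then 1 else (\<integral>\<^sup>+y. emeasure (running_min R n) {..- (x + y)} \<partial>R))"
proof -
  interpret pair_prob_space R "running_min R n" by (rule pair_running_min)
  let ?P = "R \<Otimes>\<^sub>M running_min R n"
  have "emeasure (running_min R (Suc n)) {..- x} = emeasure ?P ((\<lambda>x. min 0 (fst x + snd x)) -` {..- x} \<inter> space ?P)"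
    by (simp add: emeasure_distr)
  also have "\<dots> = (if x \<le> 0 then 1 else emeasure ?P {z \<in> space ?P. fst z + snd z \<le> - x})"
    by (auto simp: emeasure_space_1[symmetric] intro!: arg_cong2[where f=emeasure])
  finally show ?thesis
    by (simp add: emeasure_pair_running_min)
qed

lemma emeasure_running_min_mono:
  "emeasure (running_min R n) {..- x} \<le> emeasure (running_min R (Suc n)) {..- x}"
proof (induction n arbitrary: x)
  case 0
  have "emeasure (running_min R 1) {..- x} = 1" if "x \<le> 0"
    using that emeasure_running_min_Suc[of 0 x] by simp
  then show ?case by (auto simp del: running_min.simps(2) split: split_indicator)
next
  case (Suc n)
  show ?case unfolding emeasure_running_min_Suc[of n x] emeasure_running_min_Suc[of "Suc n" x]
    using Suc.IH by (simp del: running_min.simps minus_add_distrib add: nn_integral_mono)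
qed

lemma AE_running_min: "AE y in running_min R n. y \<le> 0"
proof (cases n)
  case 0
  then show ?thesis by (simp only: running_min.simps) (subst AE_return, auto)
next
  case (Suc k)
  then show ?thesis by (simp only: running_min.simps) (subst AE_distr_iff, auto)
qed

lemma integrable_running_min:
  assumes "integrable R (\<lambda>x. x)"
  shows "integrable (running_min R n) (\<lambda>x. x)"
    "integrable (R \<Otimes>\<^sub>M running_min R n) fst" "integrable (R \<Otimes>\<^sub>M running_min R n) snd"
proof -
  have pair: "integrable (R \<Otimes>\<^sub>M running_min R n) fst \<and> integrable (R \<Otimes>\<^sub>M running_min R n) snd"
    if n: "integrable (running_min R n) (\<lambda>x. x)" for n
  proof -
    interpret pair_prob_space R "running_min R n" by (rule pair_running_min)
    have "integrable (R \<Otimes>\<^sub>M running_min R n) (\<lambda>z. fst z)"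
      using assms by (intro Fubini_integrable) (auto simp: M2.prob_space)
    moreover have "integrable (R \<Otimes>\<^sub>M running_min R n) (\<lambda>z. snd z)"
      using n by (intro Fubini_integrable) (auto)
    ultimately show ?thesis by auto
  qed
  have *: "integrable (running_min R n) (\<lambda>x. x)" for n
  proof (induction n)
    case 0
    show ?case
      by (simp add: integrable_iff_bounded nn_integral_return)
  next
    case (Suc n)
    from pair[OF Suc] have "integrable (R \<Otimes>\<^sub>M running_min R n) (\<lambda>z. min 0 (fst z + snd z))"
      by (auto intro!: integrable_min)
    then show ?case by (simp add: integrable_distr_eq)
  qed
  show "integrable (running_min R n) (\<lambda>x. x)"
    "integrable (R \<Otimes>\<^sub>M running_min R n) fst" "integrable (R \<Otimes>\<^sub>M running_min R n) snd"
    using *[of n] pair[OF *[of n]] by auto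
qed

text \<open>Let M_n be the running minimum, X an independent step and r_n the probability of X + M_n
  > 0, that is, of n + 1 positive partial sums. As X + M_n <= K, replacing it by its minimum with 0
  costs at most K on that event, so E M_(n+1) >= \<mu> + E M_n - K r_n. Since E M_n <= 0 for all n,
  the r_n cannot fall below \<mu> / K, which is the constant \<open>p\<close>.\<close>

lemma nonreturn_probability:
  assumes int: "integrable R (\<lambda>x. x)" and mean: "(\<integral>x. x \<partial>R) > 0" and K: "AE x in R. x \<le> K"
  shows "\<exists>p>0. p \<le> 1 \<and> (\<forall>n. (\<integral>\<^sup>+y. emeasure (running_min R n) {..- y} \<partial>R) \<le> ennreal (1 - p))"
proof -
  note prob_R = prob_space
  define \<mu> where "\<mu> = (\<integral>x. x \<partial>R)"
  have "\<mu> \<le> (\<integral>x. K \<partial>R)" unfolding \<mu>_def using K int by (intro integral_mono_AE) auto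
  then have Kpos: "K > 0" "\<mu> \<le> K" using mean by (simp_all add: prob_space \<mu>_def)
  define E where "E n = (\<integral>y. y \<partial>running_min R n)" for n
  define P where "P n = R \<Otimes>\<^sub>M running_min R n" for n
  define r where "r n = measure (P n) {z \<in> space (P n). fst z + snd z > 0}" for n
  note [measurable] = measurable_pair_running_min[folded P_def]
  have r_eq: "(\<integral>\<^sup>+y. emeasure (running_min R n) {..- y} \<partial>R) = ennreal (1 - r n)" for n
  proof -
    interpret pair_prob_space R "running_min R n" by (rule pair_running_min)
    interpret PP: prob_space "P n" unfolding P_def by (rule P.prob_space_axioms)
    have "measure (P n) {z \<in> space (P n). \<not> fst z + snd z > 0} = 1 - r n"
      unfolding r_def by (subst PP.prob_neg) auto
    then show ?thesis
      using emeasure_pair_running_min[of n 0]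
      by (simp add: PP.emeasure_eq_measure P_def[symmetric] not_less)
  qed
  have r_dec: "decseq r"
  proof (rule decseq_SucI)
    fix n
    have "ennreal (1 - r n) \<le> ennreal (1 - r (Suc n))"
      unfolding r_eq[symmetric] by (intro nn_integral_mono emeasure_running_min_mono)
    moreover have "r (Suc n) \<le> 1"
    proof -
      interpret pair_prob_space R "running_min R (Suc n)" by (rule pair_running_min)
      show ?thesis unfolding r_def P_def by (rule P.prob_le_1)
    qed
    ultimately show "r (Suc n) \<le> r n" by (auto simp: ennreal_le_iff2)
  qed
  have step: "E (Suc n) \<ge> \<mu> + E n - K * r n" for n
  proof -
    interpret pair_prob_space R "running_min R n" by (rule pair_running_min)
    interpret PP: prob_space "P n" unfolding P_def by (rule P.prob_space_axioms)
    note i = integrable_running_min[OF int, of n, folded P_def]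
    define S where "S = {z \<in> space (P n). fst z + snd z > 0}"
    have "S \<in> sets (P n)" unfolding S_def by measurable
    then have iS: "integrable (P n) (indicator S :: _ \<Rightarrow> real)"
      by (intro integrable_real_indicator) (auto simp: PP.emeasure_eq_measure)
    have "E (Suc n) = (\<integral>z. min 0 (fst z + snd z) \<partial>P n)"
      unfolding E_def by (simp add: integral_distr P_def)
    also have "\<dots> \<ge> (\<integral>z. fst z + snd z - K * indicator S z \<partial>P n)"
    proof (rule integral_mono_AE)
      show "integrable (P n) (\<lambda>z. fst z + snd z - K * indicator S z)"
        using i iS by (intro Bochner_Integration.integrable_diff Bochner_Integration.integrable_add
          integrable_mult_right)
      show "integrable (P n) (\<lambda>z. min 0 (fst z + snd z))" using i by (auto intro!: integrable_min)
      have "AE z in P n. fst z \<le> K" 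
        unfolding P_def using K by (intro AE_pair_measure) auto
      moreover have "AE z in P n. snd z \<le> 0"
        unfolding P_def using AE_running_min[of n] by (intro AE_pair_measure) auto
      ultimately show "AE z in P n. fst z + snd z - K * indicator S z \<le> min 0 (fst z + snd z)"
        using AE_space by eventually_elim (auto simp: S_def split: split_indicator)
    qed
    also have "(\<integral>z. fst z + snd z - K * indicator S z \<partial>P n)
      = (\<integral>z. fst z + snd z \<partial>P n) - (\<integral>z. K * indicator S z \<partial>P n)"
      using i iS by (intro Bochner_Integration.integral_diff Bochner_Integration.integrable_add
          integrable_mult_right)
    also have "(\<integral>z. fst z + snd z \<partial>P n) = (\<integral>z. fst z \<partial>P n) + (\<integral>z. snd z \<partial>P n)"
      using i by (intro Bochner_Integration.integral_add)
    also have "(\<integral>z. K * indicator S z \<partial>P n) = K * r n"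
      by (simp add: r_def S_def[symmetric]) (simp add: S_def Int_def conj_commute)
    also have "(\<integral>z. fst z \<partial>P n) = \<mu>"
      using i(2) unfolding P_def \<mu>_def by (subst integral_fst'[symmetric]) (auto simp: M2.prob_space)
    also have "(\<integral>z. snd z \<partial>P n) = E n"
      using i(3) unfolding P_def E_def by (subst integral_fst'[symmetric]) (auto simp: prob_R)
    finally show ?thesis .
  qed
  have E_le: "E n \<le> 0" for n
  proof -
    have "E n \<le> (\<integral>y. 0 \<partial>running_min R n)" unfolding E_def
      using AE_running_min[of n] integrable_running_min[OF int, of n] by (intro integral_mono_AE) auto
    then show ?thesis by simp
  qed
  have E_0: "E 0 = 0" by (simp add: E_def integral_return)
  have lower: "E n \<ge> real n * \<mu> - K * (\<Sum>k<n. r k)" for n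
  proof (induction n)
    case (Suc n)
    then show ?case using step[of n] by (simp add: algebra_simps)
  qed (simp add: E_0)
  have "r n \<ge> \<mu> / K" for n
  proof (rule ccontr)
    assume "\<not> r n \<ge> \<mu> / K"
    then have pos: "\<mu> - K * r n > 0" using Kpos by (simp add: field_simps)
    have r1: "r k \<le> 1" "0 \<le> r k" for k
    proof -
      interpret pair_prob_space R "running_min R k" by (rule pair_running_min)
      show "r k \<le> 1" "0 \<le> r k" unfolding r_def P_def by simp_all
    qed
    \<comment> \<open>The first \<open>n\<close> terms are at most 1 and, \<open>r\<close> being
      decreasing, the later ones at most \<open>r n\<close>. With \<open>r n\<close> below \<mu> / K
      the lower bound for \<open>E N\<close> would become positive for large
      \<open>N\<close>.\<close>
    have "(\<Sum>k<N. r k) \<le> real n + real N * r n" for N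
    proof (induction N)
      case (Suc N)
      show ?case
      proof (cases "N < n")
        case True
        have "(\<Sum>k<Suc N. r k) \<le> (\<Sum>k<Suc N. 1)" using r1 by (intro sum_mono) auto
        also have "\<dots> \<le> real n" using True by simp
        also have "\<dots> \<le> real n + real (Suc N) * r n" using r1[of n] by simp
        finally show ?thesis .
      next
        case False
        then have "r N \<le> r n" using r_dec by (auto simp: decseq_def)
        with Suc show ?thesis by (simp add: algebra_simps)
      qed
    qed simp
    then have "real N * \<mu> \<le> K * (real n + real N * r n)" for N
      using lower[of N] E_le[of N] Kpos
      by (smt (verit) mult_left_mono)
    then have "real N * (\<mu> - K * r n) \<le> K * real n" for N
      by (simp add: algebra_simps)
    moreover obtain N where "K * real n < real N * (\<mu> - K * r n)"
      using reals_Archimedean3[OF pos] by blast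
    ultimately show False by (simp add: not_le[symmetric])
  qed
  then have "(\<integral>\<^sup>+y. emeasure (running_min R n) {..- y} \<partial>R) \<le> ennreal (1 - \<mu> / K)" for n
    unfolding r_eq by (intro ennreal_leI) auto
  then show ?thesis using mean Kpos by (intro exI[of _ "\<mu> / K"]) (auto simp: \<mu>_def)
qed

end

text \<open>
  The step law is truncated from above and shifted down by \<open>\<epsilon>\<close>. For the truncated walk, the
  probability \<open>\<phi> k x\<close> of reaching the negative half-line from \<open>x\<close> within \<open>k\<close> steps is superharmonic
  for the original walk, with a uniform gain on \<open>[-\<epsilon>, 0]\<close>.
\<close>

lemma renewal_bound:
  assumes "prob_space Q" and sets_Q [measurable_cong]: "sets Q = sets borel"
    and int: "integrable Q (\<lambda>x. x)" and mean: "(\<integral>x. x \<partial>Q) > 0"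
  shows "\<exists>\<epsilon>>0. \<exists>C\<ge>0. \<forall>c. (\<Sum>n. emeasure (conv_power Q n) {c - \<epsilon>..c}) \<le> ennreal C"
proof -
  interpret prob_space Q by fact
  \<comment> \<open>Truncation from above at a large integer keeps the mean positive and supplies
    the upper bound on the steps that \<open>nonreturn_probability\<close> requires.\<close>
  have "(\<lambda>n. \<integral>x. min x (real n) \<partial>Q) \<longlonglongrightarrow> (\<integral>x. x \<partial>Q)"
  proof (rule integral_dominated_convergence[where w="\<lambda>x. \<bar>x\<bar>"])
    show "AE x in Q. (\<lambda>n. min x (real n)) \<longlonglongrightarrow> x"
    proof (rule AE_I2)
      fix x :: real
      have "eventually (\<lambda>n. min x (real n) = x) sequentially"
        using eventually_ge_at_top[of "nat \<lceil>x\<rceil>"] by eventually_elim (auto simp: min_def nat_ceiling_le_eq)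
      then show "(\<lambda>n. min x (real n)) \<longlonglongrightarrow> x" by (rule tendsto_eventually)
    qed
    show "AE x in Q. norm (min x (real n)) \<le> \<bar>x\<bar>" for n by (auto simp: min_def)
    show "integrable Q (\<lambda>x. \<bar>x\<bar>)" by (rule integrable_abs[OF int])
  qed measurable
  from order_tendstoD(1)[OF this mean] obtain K where
    K: "(\<integral>x. min x (real K) \<partial>Q) > 0" by (auto simp: eventually_sequentially)
  \<comment> \<open>Half of the truncated mean: the walk with steps \<open>g\<close> keeps drift
    \<epsilon>, and the gap \<epsilon> between \<open>g x\<close> and \<open>x\<close> becomes the
    length of the interval.\<close>
  define \<epsilon> where "\<epsilon> = (\<integral>x. min x (real K) \<partial>Q) / 2"
  have \<epsilon>: "\<epsilon> > 0" using K by (simp add: \<epsilon>_def)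
  define g where "g x = min x (real K) - \<epsilon>" for x
  have g [measurable]: "g \<in> borel_measurable borel" unfolding g_def by measurable
  have g_le: "g x \<le> x - \<epsilon>" for x by (simp add: g_def)
  define R where "R = distr Q borel g"
  have imin: "integrable Q (\<lambda>x. min x (real K))" using int by (intro integrable_min) auto
  interpret R: real_step R
    by (auto simp: real_step_def real_step_axioms_def R_def intro!: prob_space_distr)
  have "\<exists>p>0. p \<le> 1 \<and> (\<forall>n. (\<integral>\<^sup>+y. emeasure (running_min R n) {..- y} \<partial>R) \<le> ennreal (1 - p))"
  proof (rule R.nonreturn_probability)
    show "integrable R (\<lambda>x. x)" using imin unfolding R_def
      by (subst integrable_distr_eq) (simp_all add: g_def[abs_def])
    have "(\<integral>x. x \<partial>R) = (\<integral>x. min x (real K) \<partial>Q) - \<epsilon>"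
      using imin by (simp add: R_def integral_distr g_def prob_space)
    then show "(\<integral>x. x \<partial>R) > 0" using K by (simp add: \<epsilon>_def)
    show "AE x in R. x \<le> real K" unfolding R_def by (subst AE_distr_iff) (use \<epsilon> in \<open>auto simp: g_def\<close>)
  qed
  then obtain p where p: "p > 0" "p \<le> 1"
    "\<And>n. (\<integral>\<^sup>+y. emeasure (running_min R n) {..- y} \<partial>R) \<le> ennreal (1 - p)" by blast
  define \<phi> where "\<phi> n x = emeasure (running_min R n) {..- x}" for n x
  have \<phi>_anti: "\<phi> n x \<le> \<phi> n y" if "y \<le> x" for n x y
    unfolding \<phi>_def using that R.sets_running_min by (intro emeasure_mono) auto
  have \<phi>_le1: "\<phi> n x \<le> 1" for n x
    unfolding \<phi>_def using R.running_min_prob_space by (simp add: prob_space.emeasure_le_1)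
  have \<phi>_meas [measurable]: "\<phi> n \<in> borel_measurable borel" for n
  proof -
    interpret L: prob_space "running_min R n" by (rule R.running_min_prob_space)
    have "mono (\<lambda>x. L.prob {..x})"
      using R.sets_running_min by (intro monoI L.finite_measure_mono) auto
    then have "(\<lambda>x. L.prob {..x}) \<in> borel_measurable borel" by (rule borel_measurable_mono)
    then have "(\<lambda>x. ennreal (L.prob {..- x})) \<in> borel_measurable borel" by measurable
    then show ?thesis by (simp add: \<phi>_def[abs_def] L.emeasure_eq_measure)
  qed
  have p': "(\<integral>\<^sup>+y. \<phi> n (g y) \<partial>Q) + ennreal p \<le> 1" for n
  proof -
    have eq: "(\<integral>\<^sup>+y. \<phi> n (g y) \<partial>Q) = (\<integral>\<^sup>+y. emeasure (running_min R n) {..- y} \<partial>R)"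
      unfolding R_def by (subst nn_integral_distr) (auto simp: \<phi>_def[symmetric] R_def[symmetric])
    have "(\<integral>\<^sup>+y. \<phi> n (g y) \<partial>Q) + ennreal p \<le> ennreal (1 - p) + ennreal p"
      unfolding eq by (intro add_right_mono p)
    also have "\<dots> = 1" using p(1,2) by (simp flip: ennreal_plus)
    finally show ?thesis .
  qed
  \<comment> \<open>Right of \<open>c\<close> the comparison holds because \<open>g y\<close> is
    below \<open>y\<close> and \<open>\<phi> n\<close> is antitone. On the interval the right side
    is 1, while x - c >= - \<epsilon> puts x - c + y above \<open>g y\<close>, so that the integral
    is at most 1 - p by non-return. Left of the interval the right side is 1.\<close>
  have step: "(\<integral>\<^sup>+y. \<phi> n (x - c + y) \<partial>Q) + ennreal p * indicator {c - \<epsilon>..c} x \<le> \<phi> (Suc n) (x - c)" for n x c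
  proof -
    have Suc: "\<phi> (Suc n) (x - c) = (if x - c \<le> 0 then 1 else (\<integral>\<^sup>+y. \<phi> n (x - c + g y) \<partial>Q))"
      unfolding \<phi>_def R.emeasure_running_min_Suc
      unfolding R_def by (subst nn_integral_distr) (auto simp: \<phi>_def[symmetric] R_def[symmetric] simp del: minus_add_distrib)
    consider "x > c" | "c - \<epsilon> \<le> x" "x \<le> c" | "x < c - \<epsilon>" by linarith
    then show ?thesis
    proof cases
      case 1
      then show ?thesis unfolding Suc using g_le \<epsilon>
        by (auto intro!: nn_integral_mono \<phi>_anti) (smt (verit))
    next
      case 2
      have "(\<integral>\<^sup>+y. \<phi> n (x - c + y) \<partial>Q) \<le> (\<integral>\<^sup>+y. \<phi> n (g y) \<partial>Q)"
      proof (intro nn_integral_mono \<phi>_anti)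
        show "g y \<le> x - c + y" for y using g_le[of y] 2 by linarith
      qed
      then show ?thesis unfolding Suc using 2 p'[of n]
        by (auto intro: order_trans[OF add_right_mono])
    next
      case 3
      have "(\<integral>\<^sup>+y. \<phi> n (x - c + y) \<partial>Q) \<le> (\<integral>\<^sup>+y. 1 \<partial>Q)" by (intro nn_integral_mono \<phi>_le1)
      then show ?thesis unfolding Suc using 3 \<epsilon> by (auto simp: emeasure_space_1)
    qed
  qed
  note cp = conv_power_prob_space[OF assms(1,2)]
  \<comment> \<open>Iteration of \<open>step\<close> along the walk: each step spends one unit of
    the horizon of \<phi> and gains p times the probability of being in the interval. As \<phi> is
    at most 1, the expected number of visits is at most 1 / p.\<close>
  have main: "(\<Sum>n<N. ennreal p * emeasure (conv_power Q n) {c - \<epsilon>..c})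
      + (\<integral>\<^sup>+x. \<phi> k (x - c) \<partial>conv_power Q N) \<le> (\<integral>\<^sup>+x. \<phi> (k + N) (x - c) \<partial>conv_power Q 0)" for N k c
  proof (induction N arbitrary: k)
    case (Suc N)
    have [measurable_cong]: "sets (conv_power Q N) = sets borel" by (rule cp)
    have "(\<integral>\<^sup>+x. \<phi> k (x - c) \<partial>conv_power Q (Suc N)) + ennreal p * emeasure (conv_power Q N) {c - \<epsilon>..c}
      = (\<integral>\<^sup>+x. \<integral>\<^sup>+y. \<phi> k (x - c + y) \<partial>Q \<partial>conv_power Q N)
         + (\<integral>\<^sup>+x. ennreal p * indicator {c - \<epsilon>..c} x \<partial>conv_power Q N)"
      by (subst nn_integral_conv_power_Suc) (auto simp: assms nn_integral_cmult algebra_simps)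
    also have "\<dots> = (\<integral>\<^sup>+x. (\<integral>\<^sup>+y. \<phi> k (x - c + y) \<partial>Q) + ennreal p * indicator {c - \<epsilon>..c} x \<partial>conv_power Q N)"
      by (subst nn_integral_add) auto
    also have "\<dots> \<le> (\<integral>\<^sup>+x. \<phi> (Suc k) (x - c) \<partial>conv_power Q N)"
      by (intro nn_integral_mono step)
    finally have "(\<Sum>n<Suc N. ennreal p * emeasure (conv_power Q n) {c - \<epsilon>..c})
      + (\<integral>\<^sup>+x. \<phi> k (x - c) \<partial>conv_power Q (Suc N)) \<le> 
       (\<Sum>n<N. ennreal p * emeasure (conv_power Q n) {c - \<epsilon>..c}) + (\<integral>\<^sup>+x. \<phi> (Suc k) (x - c) \<partial>conv_power Q N)"
      by (simp only: sum.lessThan_Suc add.assoc) (metis add.commute add_left_mono)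
    also have "\<dots> \<le> (\<integral>\<^sup>+x. \<phi> (Suc k + N) (x - c) \<partial>conv_power Q 0)" by (rule Suc.IH)
    finally show ?case by simp
  qed simp
  have "(\<Sum>n. emeasure (conv_power Q n) {c - \<epsilon>..c}) \<le> ennreal (1 / p)" for c
  proof -
    have "ennreal p * (\<Sum>n<N. emeasure (conv_power Q n) {c - \<epsilon>..c}) \<le> 1" for N
    proof -
      have "ennreal p * (\<Sum>n<N. emeasure (conv_power Q n) {c - \<epsilon>..c}) \<le> (\<integral>\<^sup>+x. \<phi> (0 + N) (x - c) \<partial>conv_power Q 0)"
        using main[of c N 0] unfolding sum_distrib_left
        by (rule order_trans[rotated]) simp
      also have "\<dots> \<le> (\<integral>\<^sup>+x. 1 \<partial>conv_power Q 0)" by (intro nn_integral_mono \<phi>_le1)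
      also have "\<dots> = 1" by simp
      finally show ?thesis .
    qed
    then have "ennreal (1 / p) * (ennreal p * (\<Sum>n<N. emeasure (conv_power Q n) {c - \<epsilon>..c})) \<le> ennreal (1 / p) * 1" for N
      by (intro mult_left_mono) auto
    then have "(\<Sum>n<N. emeasure (conv_power Q n) {c - \<epsilon>..c}) \<le> ennreal (1 / p)" for N
      using p(1) by (simp add: mult.assoc[symmetric] ennreal_mult[symmetric])
    then show ?thesis by (rule suminf_le_const[rotated]) simp
  qed
  then show ?thesis using \<epsilon> p(1) by (intro exI[of _ \<epsilon>] conjI exI[of _ "1 / p"]) auto
qed

lemma ennreal_suminf_swap:
  fixes f :: "nat \<Rightarrow> nat \<Rightarrow> ennreal"
  shows "(\<Sum>n. \<Sum>k. f n k) = (\<Sum>k. \<Sum>n. f n k)"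
  unfolding nn_integral_count_space_nat[symmetric]
  by (rule pair_sigma_finite.Fubini')
    (auto simp: pair_sigma_finite_def sigma_finite_measure_count_space)

text \<open>The kernel is dominated by geometric weights on the intervals of length \<epsilon> to
  the left and to the right of \<open>c\<close>. Each of them has renewal mass at most
  \<open>C\<close>, whence the constant 2 C / (1 - q).\<close>

lemma renewal_exp_bound:
  assumes "prob_space Q" and sets_Q: "sets Q = sets borel"
    and "integrable Q (\<lambda>x. x)" and "(\<integral>x. x \<partial>Q) > 0" and \<delta>: "\<delta> > 0"
  shows "\<exists>C\<ge>0. \<forall>c. (\<Sum>n. \<integral>\<^sup>+x. ennreal (exp (- \<delta> * \<bar>x - c\<bar>)) \<partial>conv_power Q n) \<le> ennreal C"
proof -
  obtain \<epsilon> C where \<epsilon>: "\<epsilon> > 0" and C: "C \<ge> 0"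
    "\<And>c. (\<Sum>n. emeasure (conv_power Q n) {c - \<epsilon>..c}) \<le> ennreal C"
    using renewal_bound[OF assms(1-4)] by blast
  define q where "q = exp (- \<delta> * \<epsilon>)"
  have q: "0 < q" "q < 1" using \<delta> \<epsilon> by (auto simp: q_def)
  define I where "I c k = {(c - real k * \<epsilon>) - \<epsilon>..(c - real k * \<epsilon>)}" for c k
  define I' where "I' c k = {(c + real (Suc k) * \<epsilon>) - \<epsilon>..(c + real (Suc k) * \<epsilon>)}" for c k
  have pointwise: "ennreal (exp (- \<delta> * \<bar>x - c\<bar>)) \<le>
      (\<Sum>k. ennreal (q ^ k) * (indicator (I c k) x + indicator (I' c k) x))" for x c
  proof -
    \<comment> \<open>The number of whole interval lengths between \<open>x\<close> and
      \<open>c\<close>; \<open>x\<close> then lies in the interval with index \<open>k\<close> on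
      its side of \<open>c\<close>.\<close>
    define k where "k = nat \<lfloor>\<bar>x - c\<bar> / \<epsilon>\<rfloor>"
    have "real k \<le> \<bar>x - c\<bar> / \<epsilon>" "\<bar>x - c\<bar> / \<epsilon> < real k + 1"
      unfolding k_def using \<epsilon> by (simp_all)
    then have k: "real k * \<epsilon> \<le> \<bar>x - c\<bar>" "\<bar>x - c\<bar> \<le> real k * \<epsilon> + \<epsilon>"
      using \<epsilon> by (simp_all add: field_simps)
    have "exp (- \<delta> * \<bar>x - c\<bar>) \<le> exp (- \<delta> * (real k * \<epsilon>))"
      using k(1) \<delta> by simp
    also have "\<dots> = q ^ k" unfolding q_def by (simp add: exp_of_nat_mult[symmetric] algebra_simps)
    finally have "ennreal (exp (- \<delta> * \<bar>x - c\<bar>)) \<le> ennreal (q ^ k)" by (rule ennreal_leI)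
    also have "ennreal (q ^ k) \<le> ennreal (q ^ k) * (indicator (I c k) x + indicator (I' c k) x)"
    proof -
      have "x \<in> I c k \<or> x \<in> I' c k" using k by (auto simp: I_def I'_def algebra_simps)
      then have "(1 :: ennreal) \<le> indicator (I c k) x + indicator (I' c k) x"
        by (auto simp: add_increasing add_increasing2)
      then have "ennreal (q ^ k) * 1 \<le> ennreal (q ^ k) * (indicator (I c k) x + indicator (I' c k) x)"
        by (rule mult_left_mono) simp
      then show ?thesis by simp
    qed
    also have "\<dots> \<le> (\<Sum>k. ennreal (q ^ k) * (indicator (I c k) x + indicator (I' c k) x))"
      using sum_le_suminf[of "\<lambda>k. ennreal (q ^ k) * (indicator (I c k) x + indicator (I' c k) x)" "{k}"]
      by simp
    finally show ?thesis .
  qed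
  have "(\<Sum>n. \<integral>\<^sup>+x. ennreal (exp (- \<delta> * \<bar>x - c\<bar>)) \<partial>conv_power Q n) \<le> ennreal (2 * C / (1 - q))" for c
  proof -
    have [measurable_cong]: "sets (conv_power Q n) = sets borel" for n
      by (rule conv_power_prob_space[OF assms(1,2)])
    have [measurable]: "I c k \<in> sets borel" "I' c k \<in> sets borel" for k by (auto simp: I_def I'_def)
    have "(\<Sum>n. \<integral>\<^sup>+x. ennreal (exp (- \<delta> * \<bar>x - c\<bar>)) \<partial>conv_power Q n) \<le>
      (\<Sum>n. \<integral>\<^sup>+x. (\<Sum>k. ennreal (q ^ k) * (indicator (I c k) x + indicator (I' c k) x)) \<partial>conv_power Q n)"
      by (intro suminf_le nn_integral_mono pointwise) auto
    also have "\<dots> = (\<Sum>n. \<Sum>k. ennreal (q ^ k) *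
        (emeasure (conv_power Q n) (I c k) + emeasure (conv_power Q n) (I' c k)))"
      by (subst nn_integral_suminf) (auto simp: nn_integral_cmult nn_integral_add)
    also have "\<dots> = (\<Sum>k. \<Sum>n. ennreal (q ^ k) *
        (emeasure (conv_power Q n) (I c k) + emeasure (conv_power Q n) (I' c k)))"
      by (rule ennreal_suminf_swap)
    also have "\<dots> = (\<Sum>k. ennreal (q ^ k) *
        ((\<Sum>n. emeasure (conv_power Q n) (I c k)) + (\<Sum>n. emeasure (conv_power Q n) (I' c k))))"
      by (simp add: ennreal_suminf_cmult suminf_add[symmetric])
    also have "\<dots> \<le> (\<Sum>k. ennreal (q ^ k) * (ennreal C + ennreal C))"
      unfolding I_def I'_def by (intro suminf_le mult_left_mono add_mono C) auto
    also have "\<dots> = (\<Sum>k. ennreal (q ^ k * (2 * C)))"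
      using C(1) q by (simp add: ennreal_mult flip: ennreal_plus)
    also have "\<dots> = ennreal (\<Sum>k. q ^ k * (2 * C))"
      using C(1) q by (intro suminf_ennreal2 summable_mult2 summable_geometric) auto
    also have "(\<Sum>k. q ^ k * (2 * C)) = 2 * C / (1 - q)"
      using q by (subst suminf_mult2[symmetric]) (auto simp: suminf_geometric summable_geometric)
    finally show ?thesis .
  qed
  then show ?thesis using C(1) q by (intro exI[of _ "2 * C / (1 - q)"]) auto
qed

section \<open>Kolmogorov's maximal inequality\<close>

text \<open>A martingale difference property without a filtration: each increment is orthogonal to
  all bounded measurable functions of its predecessors, where being such a function is expressed
  pointwise. Boundedness makes all products integrable.\<close>

definition orthogonal_increments :: "'a measure \<Rightarrow> (nat \<Rightarrow> 'a \<Rightarrow> real) \<Rightarrow> bool" where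
  "orthogonal_increments M d \<longleftrightarrow>
    (\<forall>i. d i \<in> borel_measurable M \<and> (\<exists>B. \<forall>\<omega>. \<bar>d i \<omega>\<bar> \<le> B)) \<and>
    (\<forall>j Z. Z \<in> borel_measurable M \<longrightarrow> (\<exists>B. \<forall>\<omega>. \<bar>Z \<omega>\<bar> \<le> B) \<longrightarrow>
      (\<forall>\<omega> \<omega>'. (\<forall>i<j. d i \<omega> = d i \<omega>') \<longrightarrow> Z \<omega> = Z \<omega>') \<longrightarrow> (\<integral>\<omega>. d j \<omega> * Z \<omega> \<partial>M) = 0)"

lemma orthogonal_increments_shift:
  assumes "orthogonal_increments M d"
  shows "orthogonal_increments M (\<lambda>i. d (j + i))"
proof -
  have "(\<integral>\<omega>. d (j + i) \<omega> * Z \<omega> \<partial>M) = 0"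
    if "Z \<in> borel_measurable M" "\<exists>B. \<forall>\<omega>. \<bar>Z \<omega>\<bar> \<le> B"
      "\<forall>\<omega> \<omega>'. (\<forall>k<i. d (j + k) \<omega> = d (j + k) \<omega>') \<longrightarrow> Z \<omega> = Z \<omega>'" for i Z
  proof -
    have "Z \<omega> = Z \<omega>'" if "\<forall>k<j+i. d k \<omega> = d k \<omega>'" for \<omega> \<omega>'
      using that \<open>\<forall>\<omega> \<omega>'. _ \<omega> \<omega>'\<close> by auto
    with that(1,2) assms show ?thesis unfolding orthogonal_increments_def by blast
  qed
  then show ?thesis using assms unfolding orthogonal_increments_def by blast
qed

text \<open>Chebyshev's inequality for the sum stopped when it first reaches \<open>\<lambda>\<close>.\<close>

lemma (in prob_space) kolmogorov_maximal_inequality: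
  assumes d: "orthogonal_increments M d" and l: "l > 0"
  shows "measure M {\<omega> \<in> space M. \<exists>k\<le>N. l \<le> \<bar>\<Sum>i<k. d i \<omega>\<bar>} \<le> (\<Sum>i<N. \<integral>\<omega>. (d i \<omega>)\<^sup>2 \<partial>M) / l\<^sup>2"
proof -
  have dm [measurable]: "d i \<in> borel_measurable M" for i
    using d by (auto simp: orthogonal_increments_def)
  have "\<forall>i. \<exists>B. \<forall>\<omega>. \<bar>d i \<omega>\<bar> \<le> B" using d by (auto simp: orthogonal_increments_def)
  then obtain B where B: "\<And>i \<omega>. \<bar>d i \<omega>\<bar> \<le> B i" by metis
  have orth: "(\<integral>\<omega>. d j \<omega> * Z \<omega> \<partial>M) = 0" if "Z \<in> borel_measurable M" "\<And>\<omega>. \<bar>Z \<omega>\<bar> \<le> b"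
    "\<And>\<omega> \<omega>'. (\<And>i. i < j \<Longrightarrow> d i \<omega> = d i \<omega>') \<Longrightarrow> Z \<omega> = Z \<omega>'" for j Z b
    using d that unfolding orthogonal_increments_def by blast
  have bint: "integrable M f" if "f \<in> borel_measurable M" "\<And>\<omega>. \<bar>f \<omega>\<bar> \<le> b" for f :: "'a \<Rightarrow> real" and b
    using that by (intro integrable_const_bound[where B=b]) auto
  \<comment> \<open>\<open>T i\<close> indicates that no sum of the first k <= i increments has
    reached \<open>l\<close>. It depends on \<open>d 0\<close>, ..., \<open>d (i - 1)\<close> only,
    so the stopped sum \<open>U\<close> has predictable factors.\<close>
  define T where "T i \<omega> = (if \<forall>k\<le>i. \<bar>\<Sum>j<k. d j \<omega>\<bar> < l then 1 else 0 :: real)" for i \<omega>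
  have T [measurable]: "T i \<in> borel_measurable M" for i unfolding T_def by measurable
  have T01: "0 \<le> T i \<omega>" "T i \<omega> \<le> 1" "T i \<omega> * T i \<omega> = T i \<omega>" for i \<omega> by (auto simp: T_def)
  define U where "U n \<omega> = (\<Sum>i<n. d i \<omega> * T i \<omega>)" for n \<omega>
  have U [measurable]: "U n \<in> borel_measurable M" for n unfolding U_def by measurable
  have Ub: "\<bar>U n \<omega>\<bar> \<le> (\<Sum>i<n. B i)" for n \<omega>
  proof -
    have *: "\<bar>d i \<omega> * T i \<omega>\<bar> \<le> B i" for i
      using mult_mono[OF B[of i \<omega>] T01(2)[of i \<omega>]] T01[of i \<omega>] B[of i \<omega>] by (simp add: abs_mult)
    show ?thesis unfolding U_def by (intro order_trans[OF sum_abs] sum_mono *)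
  qed
  have Usq: "integrable M (\<lambda>\<omega>. (U n \<omega>)\<^sup>2)" for n
    by (intro bint[of _ "(\<Sum>i<n. B i)\<^sup>2"])
      (auto simp: abs_le_square_iff[symmetric] intro: order_trans[OF Ub abs_ge_self])
  have dsq: "integrable M (\<lambda>\<omega>. (d n \<omega>)\<^sup>2)" for n
    by (intro bint[of _ "(B n)\<^sup>2"])
      (auto simp: abs_le_square_iff[symmetric] intro: order_trans[OF B abs_ge_self])
  have dTsq: "integrable M (\<lambda>\<omega>. (d n \<omega>)\<^sup>2 * T n \<omega>)" for n
    by (rule Bochner_Integration.integrable_bound[OF dsq[of n]]) (use T01 in \<open>auto simp: abs_mult mult_left_le\<close>)
  have Tdep: "T n \<omega> = T n \<omega>'" if "\<And>i. i < n \<Longrightarrow> d i \<omega> = d i \<omega>'" for n \<omega> \<omega>'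
  proof -
    have "(\<Sum>j<k. d j \<omega>) = (\<Sum>j<k. d j \<omega>')" if "k \<le> n" for k
      using \<open>\<And>i. i < n \<Longrightarrow> _ i\<close> that by (intro sum.cong) auto
    then show ?thesis by (simp add: T_def)
  qed
  have Udep: "U n \<omega> = U n \<omega>'" if "\<And>i. i < n \<Longrightarrow> d i \<omega> = d i \<omega>'" for n \<omega> \<omega>'
    unfolding U_def by (intro sum.cong refl arg_cong2[where f="(*)"] that Tdep) auto
  have EU: "(\<integral>\<omega>. (U n \<omega>)\<^sup>2 \<partial>M) \<le> (\<Sum>i<n. \<integral>\<omega>. (d i \<omega>)\<^sup>2 \<partial>M)" for n
  proof (induction n)
    case (Suc n)
    have prodb: "\<bar>T n \<omega> * U n \<omega>\<bar> \<le> (\<Sum>i<n. B i)" for \<omega>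
      using Ub[of n \<omega>] T01[of n \<omega>] by (auto simp: T_def)
    \<comment> \<open>The cross term in the square of \<open>U (Suc n)\<close>: the factor next to
      \<open>d n\<close> is a function of the first \<open>n\<close> increments.\<close>
    have "(\<integral>\<omega>. d n \<omega> * (T n \<omega> * U n \<omega>) \<partial>M) = 0"
    proof (rule orth)
      show "(\<lambda>\<omega>. T n \<omega> * U n \<omega>) \<in> borel_measurable M" by measurable
      fix \<omega> \<omega>' assume *: "\<And>i. i < n \<Longrightarrow> d i \<omega> = d i \<omega>'"
      show "T n \<omega> * U n \<omega> = T n \<omega>' * U n \<omega>'"
        by (intro arg_cong2[where f="(*)"] Tdep Udep *)
    qed (rule prodb)
    moreover have "integrable M (\<lambda>\<omega>. d n \<omega> * (T n \<omega> * U n \<omega>))"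
    proof (rule bint)
      fix \<omega>
      show "\<bar>d n \<omega> * (T n \<omega> * U n \<omega>)\<bar> \<le> B n * (\<Sum>i<n. B i)"
        unfolding abs_mult[of "d n \<omega>"]
        by (intro mult_mono B prodb order_trans[OF abs_ge_zero B] abs_ge_zero)
    qed measurable
    moreover have "(U (Suc n) \<omega>)\<^sup>2 = (U n \<omega>)\<^sup>2 + 2 * (d n \<omega> * (T n \<omega> * U n \<omega>)) + (d n \<omega>)\<^sup>2 * T n \<omega>" for \<omega>
    proof -
      have "(U (Suc n) \<omega>)\<^sup>2 = (U n \<omega>)\<^sup>2 + 2 * (d n \<omega> * (T n \<omega> * U n \<omega>)) + (d n \<omega>)\<^sup>2 * (T n \<omega> * T n \<omega>)"
        unfolding U_def by (simp add: power2_eq_square algebra_simps)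
      then show ?thesis by (simp only: T01)
    qed
    ultimately have "(\<integral>\<omega>. (U (Suc n) \<omega>)\<^sup>2 \<partial>M) = (\<integral>\<omega>. (U n \<omega>)\<^sup>2 \<partial>M) + (\<integral>\<omega>. (d n \<omega>)\<^sup>2 * T n \<omega> \<partial>M)"
      using Usq dTsq by simp
    also have "(\<integral>\<omega>. (d n \<omega>)\<^sup>2 * T n \<omega> \<partial>M) \<le> (\<integral>\<omega>. (d n \<omega>)\<^sup>2 \<partial>M)"
      using dTsq dsq T01 by (intro integral_mono) (auto simp: mult_left_le)
    finally show ?case using Suc by simp
  qed (simp add: U_def)
  \<comment> \<open>At the first crossing index \<open>k0\<close> the sum freezes:
    \<open>T i\<close> is 1 for i < k0 and 0 from k0 on, so \<open>U N\<close> equals the sum that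
    crossed.\<close>
  have cross: "l \<le> \<bar>U N \<omega>\<bar>" if "k \<le> N" "l \<le> \<bar>\<Sum>i<k. d i \<omega>\<bar>" for k \<omega>
  proof -
    define k0 where "k0 = (LEAST k. l \<le> \<bar>\<Sum>i<k. d i \<omega>\<bar>)"
    have k0: "l \<le> \<bar>\<Sum>i<k0. d i \<omega>\<bar>" "k0 \<le> k" "\<And>i. i < k0 \<Longrightarrow> \<bar>\<Sum>j<i. d j \<omega>\<bar> < l"
      unfolding k0_def using that(2) by (auto intro: LeastI Least_le dest: not_less_Least)
    have "U N \<omega> = (\<Sum>i<N. if i < k0 then d i \<omega> else 0)"
      unfolding U_def
    proof (intro sum.cong refl)
      fix i
      show "d i \<omega> * T i \<omega> = (if i < k0 then d i \<omega> else 0)"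
        using k0(1) k0(3) by (auto simp: T_def not_less)
    qed
    also have "\<dots> = (\<Sum>i<k0. d i \<omega>)"
      using k0(2) that(1) by (intro sum.mono_neutral_cong_right) auto
    finally show ?thesis using k0 by simp
  qed
  have "measure M {\<omega> \<in> space M. \<exists>k\<le>N. l \<le> \<bar>\<Sum>i<k. d i \<omega>\<bar>} \<le> measure M {\<omega> \<in> space M. l\<^sup>2 \<le> (U N \<omega>)\<^sup>2}"
    using cross l by (intro finite_measure_mono) (auto simp: abs_le_square_iff[symmetric])
  also have "\<dots> \<le> (\<integral>\<omega>. (U N \<omega>)\<^sup>2 \<partial>M) / l\<^sup>2"
    using Usq l by (intro integral_Markov_inequality_measure[where A="{}"]) auto
  also have "\<dots> \<le> (\<Sum>i<N. \<integral>\<omega>. (d i \<omega>)\<^sup>2 \<partial>M) / l\<^sup>2"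
    using EU by (intro divide_right_mono) auto
  finally show ?thesis .
qed

text \<open>The maximal inequality has the same right side for every approximation, so it passes to
  the limits by Fatou on a finite horizon and by monotonicity to the infinite one. The vanishing
  tails of \<open>v\<close> then make the partial sums Cauchy. The detour is made because the
  intended \<open>a i\<close> are sums over infinite generations and may be unbounded.\<close>

lemma (in prob_space) summable_of_orthogonal_approximations:
  assumes d: "\<And>L. orthogonal_increments M (d L)"
    and a [measurable]: "\<And>i. a i \<in> borel_measurable M"
    and conv: "AE \<omega> in M. \<forall>i. (\<lambda>L. d L i \<omega>) \<longlonglongrightarrow> a i \<omega>"
    and v: "\<And>L i. (\<integral>\<omega>. (d L i \<omega>)\<^sup>2 \<partial>M) \<le> v i" "summable v"
  shows "AE \<omega> in M. summable (\<lambda>i. a i \<omega>)"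
proof -
  have [measurable]: "d L i \<in> borel_measurable M" for L i
    using d by (auto simp: orthogonal_increments_def)
  have v0: "0 \<le> v i" for i using v(1)[of 0 i] by (rule order_trans[rotated]) simp
  define R where "R j = (\<Sum>i. v (i + j))" for j
  have R0: "R \<longlonglongrightarrow> 0" unfolding R_def by (rule suminf_exist_split2[OF v(2)])
  have sumR: "(\<Sum>i<N. v (j + i)) \<le> R j" for j N
    unfolding R_def add.commute[of j] using v0 v(2) by (intro sum_le_suminf) (auto simp: summable_iff_shift)
  have bound1: "emeasure M {\<omega> \<in> space M. \<exists>k\<le>N. l \<le> \<bar>\<Sum>i<k. d L (j + i) \<omega>\<bar>} \<le> ennreal (R j / l\<^sup>2)"
    if "l > 0" for l N j L
  proof -
    have "prob {\<omega> \<in> space M. \<exists>k\<le>N. l \<le> \<bar>\<Sum>i<k. d L (j + i) \<omega>\<bar>} \<le> (\<Sum>i<N. \<integral>\<omega>. (d L (j + i) \<omega>)\<^sup>2 \<partial>M) / l\<^sup>2"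
      by (rule kolmogorov_maximal_inequality[OF orthogonal_increments_shift[OF d] that])
    also have "\<dots> \<le> R j / l\<^sup>2"
      by (intro divide_right_mono order_trans[OF sum_mono sumR] v) auto
    finally show ?thesis unfolding emeasure_eq_measure by (rule ennreal_leI)
  qed
  have bound2: "emeasure M {\<omega> \<in> space M. \<exists>k\<le>N. l < \<bar>\<Sum>i<k. a (j + i) \<omega>\<bar>} \<le> ennreal (R j / l\<^sup>2)"
    if l: "l > 0" for l N j
  proof -
    define E where "E = {\<omega> \<in> space M. \<exists>k\<le>N. l < \<bar>\<Sum>i<k. a (j + i) \<omega>\<bar>}"
    define F where "F L = {\<omega> \<in> space M. \<exists>k\<le>N. l \<le> \<bar>\<Sum>i<k. d L (j + i) \<omega>\<bar>}" for L
    have [measurable]: "E \<in> sets M" "F L \<in> sets M" for L unfolding E_def F_def by measurable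
    \<comment> \<open>The strict inequality in \<open>E\<close> against the weak one in
      \<open>F\<close> is what passes to the limit: if the limiting sum exceeds \<open>l\<close>,
      the approximating sums eventually do.\<close>
    have "AE \<omega> in M. (indicator E \<omega> :: ennreal) \<le> liminf (\<lambda>L. indicator (F L) \<omega>)"
      using conv AE_space
    proof eventually_elim
      case (elim \<omega>)
      show ?case
      proof (cases "\<omega> \<in> E")
        case True
        then obtain k where k: "k \<le> N" "l < \<bar>\<Sum>i<k. a (j + i) \<omega>\<bar>" by (auto simp: E_def)
        have "(\<lambda>L. \<bar>\<Sum>i<k. d L (j + i) \<omega>\<bar>) \<longlonglongrightarrow> \<bar>\<Sum>i<k. a (j + i) \<omega>\<bar>"
          using elim by (intro tendsto_intros) auto
        from order_tendstoD(1)[OF this k(2)]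
        have "eventually (\<lambda>L. 1 \<le> (indicator (F L) \<omega> :: ennreal)) sequentially"
        proof eventually_elim
          case (elim L)
          then have "\<omega> \<in> F L" using k \<open>\<omega> \<in> space M\<close> by (auto simp: F_def intro!: exI[of _ k])
          then show ?case by simp
        qed
        then have "1 \<le> liminf (\<lambda>L. indicator (F L) \<omega> :: ennreal)" by (rule Liminf_bounded)
        then show ?thesis using True by simp
      qed simp
    qed
    then have "emeasure M E \<le> (\<integral>\<^sup>+\<omega>. liminf (\<lambda>L. indicator (F L) \<omega>) \<partial>M)"
      unfolding nn_integral_indicator[OF \<open>E \<in> sets M\<close>, symmetric] by (rule nn_integral_mono_AE)
    also have "\<dots> \<le> liminf (\<lambda>L. \<integral>\<^sup>+\<omega>. indicator (F L) \<omega> \<partial>M)"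
      by (intro nn_integral_liminf borel_measurable_indicator) simp
    also have "\<dots> = liminf (\<lambda>L. emeasure M (F L))" by simp
    also have "\<dots> \<le> ennreal (R j / l\<^sup>2)"
      using bound1[OF l] unfolding F_def by (intro Liminf_le) auto
    finally show ?thesis by (simp add: E_def)
  qed
  have bound3: "emeasure M {\<omega> \<in> space M. \<exists>k. l < \<bar>\<Sum>i<k. a (j + i) \<omega>\<bar>} \<le> ennreal (R j / l\<^sup>2)"
    if l: "l > 0" for l j
  proof -
    have "{\<omega> \<in> space M. \<exists>k. l < \<bar>\<Sum>i<k. a (j + i) \<omega>\<bar>}
      = (\<Union>N. {\<omega> \<in> space M. \<exists>k\<le>N. l < \<bar>\<Sum>i<k. a (j + i) \<omega>\<bar>})" by auto
    also have "emeasure M \<dots> = (SUP N. emeasure M {\<omega> \<in> space M. \<exists>k\<le>N. l < \<bar>\<Sum>i<k. a (j + i) \<omega>\<bar>})"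
      by (rule SUP_emeasure_incseq[symmetric]) (auto simp: incseq_def intro: order_trans)
    also have "\<dots> \<le> ennreal (R j / l\<^sup>2)" by (intro SUP_least bound2 l)
    finally show ?thesis .
  qed
  have AE_small: "AE \<omega> in M. \<exists>j. \<forall>k. \<bar>\<Sum>i<k. a (j + i) \<omega>\<bar> \<le> l" if l: "l > 0" for l
  proof -
    define E where "E = {\<omega> \<in> space M. \<forall>j. \<exists>k. l < \<bar>\<Sum>i<k. a (j + i) \<omega>\<bar>}"
    have [measurable]: "E \<in> sets M" unfolding E_def by measurable
    have "emeasure M E \<le> ennreal (R j / l\<^sup>2)" for j
      by (rule order_trans[OF emeasure_mono bound3[OF l]]) (auto simp: E_def)
    moreover have "(\<lambda>j. ennreal (R j / l\<^sup>2)) \<longlonglongrightarrow> ennreal (0 / l\<^sup>2)"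
      using l by (intro tendsto_ennrealI tendsto_divide R0 tendsto_const) auto
    ultimately have "emeasure M E \<le> ennreal (0 / l\<^sup>2)"
      by (intro LIMSEQ_le_const[of "\<lambda>j. ennreal (R j / l\<^sup>2)"]) auto
    then have "emeasure M E = 0" by simp
    then have "AE \<omega> in M. \<omega> \<notin> E" by (intro AE_not_in) (auto simp: null_sets_def)
    then show ?thesis using AE_space by eventually_elim (auto simp: E_def not_less[symmetric])
  qed
  have "AE \<omega> in M. \<forall>m. \<exists>j. \<forall>k. \<bar>\<Sum>i<k. a (j + i) \<omega>\<bar> \<le> 1 / real (Suc m)"
    unfolding AE_all_countable by (intro allI AE_small) simp
  then show ?thesis
  proof eventually_elim
    case (elim \<omega>)
    show ?case unfolding summable_Cauchy
    proof (intro allI impI)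
      fix e :: real assume "e > 0"
      then have "e / 2 > 0" by simp
      then obtain m where m: "1 / real (Suc m) < e / 2" using nat_approx_posE by blast
      obtain j where j: "\<And>k. \<bar>\<Sum>i<k. a (j + i) \<omega>\<bar> \<le> 1 / real (Suc m)" using elim by blast
      have S: "(\<Sum>i<k. a (j + i) \<omega>) = (\<Sum>i<j + k. a i \<omega>) - (\<Sum>i<j. a i \<omega>)" for k
        by (induction k) auto
      have "norm (\<Sum>i\<in>{p..<q}. a i \<omega>) < e" if "p \<ge> j" for p q
      proof (cases "p \<le> q")
        case True
        have "(\<Sum>i\<in>{p..<q}. a i \<omega>) = (\<Sum>i<q. a i \<omega>) - (\<Sum>i<p. a i \<omega>)"
          using True by (simp add: sum_diff_nat_ivl lessThan_atLeast0)
        also have "\<dots> = (\<Sum>i<q - j. a (j + i) \<omega>) - (\<Sum>i<p - j. a (j + i) \<omega>)"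
          using True that by (simp add: S)
        finally show ?thesis using j[of "q - j"] j[of "p - j"] m unfolding real_norm_def by linarith
      qed (use \<open>e > 0\<close> in simp)
      then show "\<exists>N. \<forall>m\<ge>N. \<forall>n. norm (\<Sum>i\<in>{m..<n}. a i \<omega>) < e" by blast
    qed
  qed
qed

section \<open>The many-to-one formula\<close>

definition offspring_space :: "(enat \<times> (nat \<Rightarrow> real)) measure" where
  "offspring_space = count_space UNIV \<Otimes>\<^sub>M (\<Pi>\<^sub>M i\<in>UNIV. borel)"

text \<open>Absent children contribute 0 to a series over all labels. This keeps the index set
  deterministic and the sum measurable in the family; \<open>child_sum_point_process\<close>
  identifies it with integration against the point process.\<close>

definition child_sum :: "(real \<Rightarrow> ennreal) \<Rightarrow> enat \<times> (nat \<Rightarrow> real) \<Rightarrow> ennreal" where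
  "child_sum f e = (\<Sum>i. if enat i < fst e then f (snd e i) else 0)"

lemma child_sum_eq_nn_integral:
  "child_sum f e = (\<integral>\<^sup>+ i. f (snd e i) \<partial>count_space {i. enat i < fst e})"
proof -
  have "(\<integral>\<^sup>+ i. f (snd e i) \<partial>count_space {i. enat i < fst e}) =
    (\<integral>\<^sup>+ i. f (snd e i) * indicator {i. enat i < fst e} i \<partial>count_space UNIV)"
    by (simp add: nn_integral_count_space_indicator)
  also have "\<dots> = child_sum f e"
    unfolding child_sum_def nn_integral_count_space_nat
    by (intro suminf_cong) (auto split: split_indicator)
  finally show ?thesis by simp
qed

lemma child_sum_point_process:
  "f \<in> borel_measurable borel \<Longrightarrow> child_sum f e = (\<integral>\<^sup>+ x. f x \<partial>point_process (fst e) (snd e))"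
  by (simp add: child_sum_eq_nn_integral nn_integral_point_process)

lemma measurable_child [measurable]:
  "(\<lambda>e. snd e i) \<in> borel_measurable offspring_space"
  "Measurable.pred offspring_space (\<lambda>e. enat i < fst e)"
  unfolding offspring_space_def by measurable

lemma measurable_child_sum [measurable (raw)]:
  assumes [measurable]: "(\<lambda>(x, y). f x y) \<in> borel_measurable (N \<Otimes>\<^sub>M borel)" "e \<in> measurable N offspring_space"
  shows "(\<lambda>x. child_sum (f x) (e x)) \<in> borel_measurable N"
  unfolding child_sum_def
proof (rule borel_measurable_suminf_order)
  fix i
  have [measurable]: "(\<lambda>x. snd (e x) i) \<in> borel_measurable N"
    "Measurable.pred N (\<lambda>x. enat i < fst (e x))"
    using measurable_compose[OF assms(2) measurable_child(1)]
      measurable_compose[OF assms(2) measurable_child(2)] by auto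
  show "(\<lambda>x. if enat i < fst (e x) then f x (snd (e x) i) else 0) \<in> borel_measurable N"
    by measurable
qed

lemma measurable_child_sum_const [measurable]:
  assumes [measurable]: "f \<in> borel_measurable borel"
  shows "child_sum f \<in> borel_measurable offspring_space"
  by (rule measurable_child_sum) (auto simp: case_prod_unfold)

section \<open>Words and positions in a configuration of families\<close>

definition live :: "(nat list \<Rightarrow> enat \<times> (nat \<Rightarrow> real)) \<Rightarrow> nat list \<Rightarrow> bool" where
  "live p u \<longleftrightarrow> (\<forall>k<length u. enat (u ! k) < fst (p (take k u)))"

definition shifted_position :: "real \<Rightarrow> (nat list \<Rightarrow> enat \<times> (nat \<Rightarrow> real)) \<Rightarrow> nat list \<Rightarrow> real" where
  "shifted_position a p u = (\<Sum>k<length u. snd (p (take k u)) (u ! k) - a)"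

lemma live_Nil [simp]: "live p []" by (simp add: live_def)

lemma live_snoc [simp]: "live p (u @ [i]) \<longleftrightarrow> live p u \<and> enat i < fst (p u)"
  by (auto simp: live_def nth_append less_Suc_eq)

lemma shifted_position_Nil [simp]: "shifted_position a p [] = 0" by (simp add: shifted_position_def)

lemma shifted_position_snoc [simp]:
  "shifted_position a p (u @ [i]) = shifted_position a p u + (snd (p u) i - a)"
  by (simp add: shifted_position_def nth_append)

lemma take_ne_of_length_le: "length u \<le> length v \<Longrightarrow> k < length u \<Longrightarrow> take k u \<noteq> v"
  by auto

text \<open>Existence of \<open>u\<close> depends only on the families at proper prefixes of
  \<open>u\<close>, and none of these is a word \<open>v\<close> at least as long as
  \<open>u\<close>. For v = u this expresses that the family of \<open>u\<close> is independent of
  the past of \<open>u\<close>.\<close>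

lemma live_upd [simp]: "length u \<le> length v \<Longrightarrow> live (p(v := e)) u = live p u"
  by (auto simp: live_def take_ne_of_length_le)

lemma shifted_position_upd [simp]:
  "length u \<le> length v \<Longrightarrow> shifted_position a (p(v := e)) u = shifted_position a p u"
  by (auto simp: shifted_position_def take_ne_of_length_le intro!: sum.cong)

text \<open>The laws \<open>\<nu> u\<close> may vary with \<open>u\<close>, since equality in law of
  the point processes says nothing about the labelling. What survives is \<open>same_law\<close>,
  for functions of a single \<open>child_sum\<close>.\<close>

locale offspring_laws =
  fixes \<nu> :: "nat list \<Rightarrow> (enat \<times> (nat \<Rightarrow> real)) measure"
  assumes prob_\<nu>: "prob_space (\<nu> u)"
    and sets_\<nu> [measurable_cong]: "sets (\<nu> u) = sets offspring_space"
    and same_law: "\<lbrakk>f \<in> borel_measurable borel; g \<in> borel_measurable borel\<rbrakk> \<Longrightarrow>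
      (\<integral>\<^sup>+e. g (child_sum f e) \<partial>\<nu> u) = (\<integral>\<^sup>+e. g (child_sum f e) \<partial>\<nu> [])"
begin

sublocale \<nu>: prob_space "\<nu> u" for u by (rule prob_\<nu>)

abbreviation "\<P> \<equiv> PiM UNIV \<nu>"

sublocale \<P>: prob_space \<P> by (rule prob_space_PiM) (rule prob_\<nu>)

lemma measurable_coord [measurable]: "(\<lambda>p. p u) \<in> measurable \<P> offspring_space"
proof -
  have "(\<lambda>p. p u) \<in> measurable \<P> (\<nu> u)" by measurable
  then show ?thesis by (simp add: measurable_cong_sets[OF refl sets_\<nu>])
qed

lemma measurable_child_sum_\<nu> [measurable]:
  "f \<in> borel_measurable borel \<Longrightarrow> child_sum f \<in> borel_measurable (\<nu> u)"
  using measurable_child_sum_const by (simp add: measurable_cong_sets[OF sets_\<nu> refl])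

lemma measurable_live [measurable]: "Measurable.pred \<P> (\<lambda>p. live p u)"
  unfolding live_def
  using measurable_compose[OF measurable_coord measurable_child(2)] by measurable

lemma measurable_shifted_position [measurable]: "(\<lambda>p. shifted_position a p u) \<in> borel_measurable \<P>"
  unfolding shifted_position_def
  using measurable_compose[OF measurable_coord measurable_child(1)] by measurable

lemma distr_resample: "distr (\<nu> u \<Otimes>\<^sub>M \<P>) \<P> (\<lambda>(e, p). p(u := e)) = \<P>"
  using distr_pair_PiM_eq_PiM[of UNIV \<nu> u] prob_\<nu> by simp

lemma measurable_upd [measurable]: "(\<lambda>(e, p). p(u := e)) \<in> measurable (\<nu> u \<Otimes>\<^sub>M \<P>) \<P>"
proof -
  have "(\<lambda>(e, p). p(u := e)) \<in> measurable (\<nu> u \<Otimes>\<^sub>M \<P>) (PiM (insert u UNIV) \<nu>)"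
    unfolding case_prod_beta by (rule measurable_fun_upd[where J=UNIV]) auto
  then show ?thesis by simp
qed

text \<open>The product measure is invariant under replacing coordinate \<open>u\<close> by an
  independent draw. Integrating over that draw first takes the place of a conditional expectation
  given all other coordinates.\<close>

lemma nn_integral_resample:
  assumes [measurable]: "F \<in> borel_measurable \<P>"
  shows "(\<integral>\<^sup>+p. F p \<partial>\<P>) = (\<integral>\<^sup>+p. \<integral>\<^sup>+e. F (p(u := e)) \<partial>\<nu> u \<partial>\<P>)"
proof -
  interpret pair_sigma_finite "\<nu> u" \<P> ..
  have "(\<integral>\<^sup>+p. F p \<partial>\<P>) = (\<integral>\<^sup>+z. F ((\<lambda>(e, p). p(u := e)) z) \<partial>(\<nu> u \<Otimes>\<^sub>M \<P>))"
    by (subst distr_resample[of u, symmetric], subst nn_integral_distr) auto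
  also have "\<dots> = (\<integral>\<^sup>+z. (\<lambda>(e, p). F (p(u := e))) z \<partial>(\<nu> u \<Otimes>\<^sub>M \<P>))"
    by (simp add: case_prod_beta)
  also have "\<dots> = (\<integral>\<^sup>+p. \<integral>\<^sup>+e. F (p(u := e)) \<partial>\<nu> u \<partial>\<P>)"
    by (subst nn_integral_snd[symmetric]) (use measurable_compose[OF measurable_upd assms] in \<open>auto simp: case_prod_beta\<close>)
  finally show ?thesis .
qed

lemma integral_resample_zero:
  fixes F :: "_ \<Rightarrow> real"
  assumes F: "integrable \<P> F" and z: "\<And>p. (\<integral>e. F (p(u := e)) \<partial>\<nu> u) = 0"
  shows "(\<integral>p. F p \<partial>\<P>) = 0"
proof -
  interpret pair_sigma_finite "\<nu> u" \<P> ..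
  have [measurable]: "F \<in> borel_measurable \<P>" using F by auto
  have "integrable (distr (\<nu> u \<Otimes>\<^sub>M \<P>) \<P> (\<lambda>(e, p). p(u := e))) F"
    using F by (simp add: distr_resample)
  then have int: "integrable (\<nu> u \<Otimes>\<^sub>M \<P>) (\<lambda>(e, p). F (p(u := e)))"
    by (subst (asm) integrable_distr_eq) (auto simp: case_prod_unfold)
  have "(\<integral>p. F p \<partial>\<P>) = (\<integral>z. F ((\<lambda>(e, p). p(u := e)) z) \<partial>(\<nu> u \<Otimes>\<^sub>M \<P>))"
    by (subst distr_resample[of u, symmetric], subst integral_distr) auto
  also have "\<dots> = (\<integral>z. (\<lambda>(e, p). F (p(u := e))) z \<partial>(\<nu> u \<Otimes>\<^sub>M \<P>))"
    by (simp add: case_prod_beta)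
  also have "\<dots> = (\<integral>p. \<integral>e. F (p(u := e)) \<partial>\<nu> u \<partial>\<P>)"
    by (rule integral_snd[OF int, symmetric])
  finally show ?thesis by (simp add: z)
qed

abbreviation words :: "nat \<Rightarrow> nat list set" where "words n \<equiv> {u. length u = n}"

lemma nn_integral_words_swap:
  fixes A :: "nat list set"
  assumes "\<And>u. (\<lambda>p. F p u) \<in> borel_measurable \<P>"
  shows "(\<integral>\<^sup>+p. \<integral>\<^sup>+u. F p u \<partial>count_space A \<partial>\<P>) = (\<integral>\<^sup>+u. \<integral>\<^sup>+p. F p u \<partial>\<P> \<partial>count_space A)"
  by (rule nn_integral_count_space_nn_integral) (use assms in auto)

text \<open>Neither existence nor position of \<open>u\<close> involves the family of
  \<open>u\<close>, so this family can be redrawn; by \<open>same\<close> the draw may then be made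
  from the law of the ancestor's family.\<close>

lemma resample_words:
  assumes [measurable]: "(\<lambda>(v, e). F v e) \<in> borel_measurable (borel \<Otimes>\<^sub>M offspring_space)"
    and same: "\<And>v u. (\<integral>\<^sup>+e. F v e \<partial>\<nu> u) = (\<integral>\<^sup>+e. F v e \<partial>\<nu> [])"
  shows "(\<integral>\<^sup>+p. \<integral>\<^sup>+u. (if live p u then F (shifted_position a p u) (p u) else 0) \<partial>count_space (words n) \<partial>\<P>) =
    (\<integral>\<^sup>+p. \<integral>\<^sup>+u. (if live p u then (\<integral>\<^sup>+e. F (shifted_position a p u) e \<partial>\<nu> []) else 0) \<partial>count_space (words n) \<partial>\<P>)"
proof -
  have [measurable]: "(\<lambda>v. \<integral>\<^sup>+e. F v e \<partial>\<nu> []) \<in> borel_measurable borel" by measurable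
  have [measurable]: "(\<lambda>p. F (shifted_position a p u) (p u)) \<in> borel_measurable \<P>" for u
    using measurable_compose[OF measurable_Pair[OF measurable_shifted_position measurable_coord] assms(1)]
    by simp
  have "(\<integral>\<^sup>+p. (if live p u then F (shifted_position a p u) (p u) else 0) \<partial>\<P>) =
    (\<integral>\<^sup>+p. (if live p u then (\<integral>\<^sup>+e. F (shifted_position a p u) e \<partial>\<nu> []) else 0) \<partial>\<P>)" for u
  proof -
    have "(\<integral>\<^sup>+p. (if live p u then F (shifted_position a p u) (p u) else 0) \<partial>\<P>) =
      (\<integral>\<^sup>+p. \<integral>\<^sup>+e. (if live p u then F (shifted_position a p u) e else 0) \<partial>\<nu> u \<partial>\<P>)"
      by (subst nn_integral_resample[where u=u]) (auto intro!: nn_integral_cong)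
    also have "\<dots> = (\<integral>\<^sup>+p. (if live p u then (\<integral>\<^sup>+e. F (shifted_position a p u) e \<partial>\<nu> []) else 0) \<partial>\<P>)"
      by (intro nn_integral_cong) (auto simp: same[of u])
    finally show ?thesis .
  qed
  then show ?thesis
    by (subst (1 2) nn_integral_words_swap) (auto intro!: nn_integral_cong)
qed

lemma nn_integral_words_Suc:
  "(\<integral>\<^sup>+u. f u \<partial>count_space (words (Suc n))) =
    (\<integral>\<^sup>+u. \<integral>\<^sup>+i. f (u @ [i]) \<partial>count_space UNIV \<partial>count_space (words n))"
proof -
  have "bij_betw (\<lambda>z. fst z @ [snd z]) (words n \<times> UNIV) (words (Suc n))"
    by (auto simp: bij_betw_def inj_on_def image_iff length_Suc_conv_rev)
  from nn_integral_bij_count_space[OF this, of f]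
  have "(\<integral>\<^sup>+u. f u \<partial>count_space (words (Suc n))) =
    (\<integral>\<^sup>+z. f (fst z @ [snd z]) \<partial>count_space (words n \<times> UNIV))" ..
  also have "\<dots> = (\<integral>\<^sup>+z. f (fst z @ [snd z]) \<partial>(count_space (words n) \<Otimes>\<^sub>M count_space UNIV))"
    by (subst pair_measure_countable) auto
  also have "\<dots> = (\<integral>\<^sup>+u. \<integral>\<^sup>+i. f (u @ [i]) \<partial>count_space UNIV \<partial>count_space (words n))"
    by (subst sigma_finite_measure.nn_integral_fst[symmetric])
      (auto simp: sigma_finite_measure_count_space pair_measure_countable)
  finally show ?thesis .
qed

text \<open>The exponentially tilted intensity measure of the points x - a of the first generation.
  Its total mass is exp(a t) m(t). For \<open>t\<close> = 0 it is the untilted intensity, whose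
  Laplace transform at \<theta> is exp(a \<theta>) m(\<theta>).\<close>

definition step_law :: "real \<Rightarrow> real \<Rightarrow> real measure" where
  "step_law t a = distr
    (density (\<nu> [] \<Otimes>\<^sub>M count_space UNIV)
      (\<lambda>(e, i). if enat i < fst e then ennreal (exp (- t * (snd e i - a))) else 0))
    borel (\<lambda>(e, i). snd e i - a)"

lemma sets_step_law [measurable_cong, simp]: "sets (step_law t a) = sets borel"
  by (simp add: step_law_def)

lemma nn_integral_step_law:
  assumes [measurable]: "h \<in> borel_measurable borel"
  shows "(\<integral>\<^sup>+x. h x \<partial>step_law t a) =
    (\<integral>\<^sup>+e. child_sum (\<lambda>x. ennreal (exp (- t * (x - a))) * h (x - a)) e \<partial>\<nu> [])"
proof -
  interpret c: sigma_finite_measure "count_space (UNIV :: nat set)"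
    by (rule sigma_finite_measure_count_space)
  have [measurable]: "(\<lambda>(e, i). snd e i) \<in> borel_measurable (\<nu> [] \<Otimes>\<^sub>M count_space UNIV)"
    unfolding case_prod_beta
    by (rule measurable_compose_countable'[where I=UNIV]) auto
  have [measurable]: "Measurable.pred (\<nu> [] \<Otimes>\<^sub>M count_space UNIV) (\<lambda>(e, i). enat i < fst e)"
    unfolding case_prod_beta
    by (rule measurable_compose_countable'[where I=UNIV]) auto
  show ?thesis
    unfolding step_law_def
    by (subst nn_integral_distr, measurable, subst nn_integral_density, measurable,
       subst c.nn_integral_fst[symmetric], measurable)
      (auto simp: child_sum_def nn_integral_count_space_nat intro!: nn_integral_cong suminf_cong)
qed

text \<open>Induction on the last step. The weight factorises along a path, so after redrawing the
  family of \<open>u\<close> the sum over its children is one integration against the step law,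
  started at the position of \<open>u\<close>. The test function changes from \<open>h\<close> to
  this integral, hence the generalisation over \<open>h\<close>.\<close>

lemma many_to_one:
  assumes Q: "prob_space (step_law t a)" and "h \<in> borel_measurable borel"
  shows "(\<integral>\<^sup>+p. \<integral>\<^sup>+u. (if live p u then ennreal (exp (- t * shifted_position a p u)) * h (shifted_position a p u)
      else 0) \<partial>count_space (words n) \<partial>\<P>) = (\<integral>\<^sup>+x. h x \<partial>conv_power (step_law t a) n)"
  using assms(2)
proof (induction n arbitrary: h)
  case 0
  have "words 0 = {[]}" by auto
  then show ?case using 0 \<P>.emeasure_space_1
    by (simp add: nn_integral_count_space_finite nn_integral_return)
next
  case (Suc n)
  note [measurable] = Suc.prems
  \<comment> \<open>The weighted contribution of the children of an individual at \<open>v\<close>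
    with family \<open>e\<close>.\<close>
  define F where "F v e = child_sum (\<lambda>x. ennreal (exp (- t * (v + (x - a)))) * h (v + (x - a))) e" for v e
  have F_meas [measurable]: "(\<lambda>(v, e). F v e) \<in> borel_measurable (borel \<Otimes>\<^sub>M offspring_space)"
    unfolding F_def case_prod_beta by measurable
  have same: "(\<integral>\<^sup>+e. F v e \<partial>\<nu> u) = (\<integral>\<^sup>+e. F v e \<partial>\<nu> [])" for u v
    unfolding F_def by (rule same_law[where g="\<lambda>x. x"]) simp_all
  have F_int: "(\<integral>\<^sup>+e. F v e \<partial>\<nu> []) = ennreal (exp (- t * v)) * (\<integral>\<^sup>+y. h (v + y) \<partial>step_law t a)" for v
  proof -
    let ?f = "\<lambda>x. ennreal (exp (- t * (x - a))) * h (v + (x - a))"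
    have "F v e = ennreal (exp (- t * v)) * child_sum (\<lambda>x. ennreal (exp (- t * (x - a))) * h (v + (x - a))) e" for e
      unfolding F_def child_sum_def ennreal_suminf_cmult[symmetric]
      by (intro suminf_cong)
        (auto simp: mult.assoc[symmetric] ennreal_mult[symmetric] exp_add[symmetric] algebra_simps)
    then have "(\<integral>\<^sup>+e. F v e \<partial>\<nu> []) = (\<integral>\<^sup>+e. ennreal (exp (- t * v)) * child_sum ?f e \<partial>\<nu> [])"
      by (simp only:)
    also have "\<dots> = ennreal (exp (- t * v)) * (\<integral>\<^sup>+e. child_sum ?f e \<partial>\<nu> [])"
      by (intro nn_integral_cmult measurable_child_sum_\<nu>) simp_all
    finally show ?thesis by (subst nn_integral_step_law) simp_all
  qed
  have split: "(\<integral>\<^sup>+u. (if live p u then ennreal (exp (- t * shifted_position a p u)) * h (shifted_position a p u)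
      else 0) \<partial>count_space (words (Suc n))) =
      (\<integral>\<^sup>+u. (if live p u then F (shifted_position a p u) (p u) else 0) \<partial>count_space (words n))" for p
    unfolding nn_integral_words_Suc unfolding F_def child_sum_def nn_integral_count_space_nat
    by (intro nn_integral_cong) (auto intro!: suminf_cong)
  have "(\<integral>\<^sup>+p. \<integral>\<^sup>+u. (if live p u then ennreal (exp (- t * shifted_position a p u)) * h (shifted_position a p u)
      else 0) \<partial>count_space (words (Suc n)) \<partial>\<P>) =
     (\<integral>\<^sup>+p. \<integral>\<^sup>+u. (if live p u then ennreal (exp (- t * shifted_position a p u)) *
        (\<integral>\<^sup>+y. h (shifted_position a p u + y) \<partial>step_law t a) else 0) \<partial>count_space (words n) \<partial>\<P>)"
    unfolding split resample_words[OF F_meas same] F_int ..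
  also have "\<dots> = (\<integral>\<^sup>+x. \<integral>\<^sup>+y. h (x + y) \<partial>step_law t a \<partial>conv_power (step_law t a) n)"
  proof (rule Suc.IH)
    interpret prob_space "step_law t a" by fact
    show "(\<lambda>x. \<integral>\<^sup>+y. h (x + y) \<partial>step_law t a) \<in> borel_measurable borel" by measurable
  qed
  also have "\<dots> = (\<integral>\<^sup>+x. h x \<partial>conv_power (step_law t a) (Suc n))"
    by (rule nn_integral_conv_power_Suc[symmetric]) (use Q Suc.prems in auto)
  finally show ?case .
qed

end

section \<open>Truncation\<close>

text \<open>By Tonelli the integral over \<open>x\<close> is moved outside. For fixed
  \<open>x\<close> the rest is a renewal integral centred at ln |x|, and its bound \<open>C\<close>
  does not depend on the centre.\<close>

lemma renewal_kernel_finite: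
  assumes Q: "prob_space Q" "sets Q = sets borel" "integrable Q (\<lambda>x. x)" "(\<integral>x. x \<partial>Q) > 0"
    and "prob_space \<Lambda>" and [measurable_cong]: "sets \<Lambda> = sets borel"
    and K: "(\<integral>\<^sup>+x. ennreal (\<bar>x\<bar> powr t) \<partial>\<Lambda>) < \<infinity>" and \<delta>: "\<delta> > 0"
  shows "(\<Sum>n. \<integral>\<^sup>+v. \<integral>\<^sup>+x. ennreal (\<bar>x\<bar> powr t * exp (- \<delta> * \<bar>v - ln \<bar>x\<bar>\<bar>)) \<partial>\<Lambda> \<partial>conv_power Q n) < \<infinity>"
proof -
  obtain C where C: "\<And>c. (\<Sum>n. \<integral>\<^sup>+x. ennreal (exp (- \<delta> * \<bar>x - c\<bar>)) \<partial>conv_power Q n) \<le> ennreal C"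
    using renewal_exp_bound[OF Q \<delta>] by blast
  interpret L: prob_space \<Lambda> by fact
  note cp = conv_power_prob_space[OF Q(1,2)]
  have [measurable_cong]: "sets (conv_power Q n) = sets borel" for n by (rule cp)
  have "(\<integral>\<^sup>+v. \<integral>\<^sup>+x. ennreal (\<bar>x\<bar> powr t * exp (- \<delta> * \<bar>v - ln \<bar>x\<bar>\<bar>)) \<partial>\<Lambda> \<partial>conv_power Q n) =
    (\<integral>\<^sup>+x. ennreal (\<bar>x\<bar> powr t) * (\<integral>\<^sup>+v. ennreal (exp (- \<delta> * \<bar>v - ln \<bar>x\<bar>\<bar>)) \<partial>conv_power Q n) \<partial>\<Lambda>)" for n
  proof -
    interpret q: prob_space "conv_power Q n" by (rule cp)
    interpret pair_sigma_finite "conv_power Q n" \<Lambda> ..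
    have "(\<integral>\<^sup>+v. \<integral>\<^sup>+x. ennreal (\<bar>x\<bar> powr t * exp (- \<delta> * \<bar>v - ln \<bar>x\<bar>\<bar>)) \<partial>\<Lambda> \<partial>conv_power Q n) =
      (\<integral>\<^sup>+x. \<integral>\<^sup>+v. ennreal (\<bar>x\<bar> powr t * exp (- \<delta> * \<bar>v - ln \<bar>x\<bar>\<bar>)) \<partial>conv_power Q n \<partial>\<Lambda>)"
      by (rule Fubini'[symmetric]) measurable
    then show ?thesis by (simp add: ennreal_mult nn_integral_cmult)
  qed
  then have "(\<Sum>n. \<integral>\<^sup>+v. \<integral>\<^sup>+x. ennreal (\<bar>x\<bar> powr t * exp (- \<delta> * \<bar>v - ln \<bar>x\<bar>\<bar>)) \<partial>\<Lambda> \<partial>conv_power Q n) =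
    (\<Sum>n. \<integral>\<^sup>+x. ennreal (\<bar>x\<bar> powr t) * (\<integral>\<^sup>+v. ennreal (exp (- \<delta> * \<bar>v - ln \<bar>x\<bar>\<bar>)) \<partial>conv_power Q n) \<partial>\<Lambda>)"
    by (simp only:)
  also have "\<dots> = (\<integral>\<^sup>+x. (\<Sum>n. ennreal (\<bar>x\<bar> powr t) * (\<integral>\<^sup>+v. ennreal (exp (- \<delta> * \<bar>v - ln \<bar>x\<bar>\<bar>)) \<partial>conv_power Q n)) \<partial>\<Lambda>)"
  proof (rule nn_integral_suminf[symmetric])
    fix n
    interpret q: prob_space "conv_power Q n" by (rule cp)
    show "(\<lambda>x. ennreal (\<bar>x\<bar> powr t) * (\<integral>\<^sup>+v. ennreal (exp (- \<delta> * \<bar>v - ln \<bar>x\<bar>\<bar>)) \<partial>conv_power Q n)) \<in> borel_measurable \<Lambda>"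
      by measurable
  qed
  also have "\<dots> \<le> (\<integral>\<^sup>+x. ennreal (\<bar>x\<bar> powr t) * ennreal C \<partial>\<Lambda>)"
    unfolding ennreal_suminf_cmult by (intro nn_integral_mono mult_left_mono C) simp
  also have "\<dots> < \<infinity>" using K by (simp add: nn_integral_multc ennreal_mult_less_top)
  finally show ?thesis .
qed

locale truncation = prob_space \<Lambda> for \<Lambda> :: "real measure" +
  assumes sets_\<Lambda> [measurable_cong]: "sets \<Lambda> = sets borel"
    and int_\<Lambda>: "integrable \<Lambda> (\<lambda>x. x)" and mean_\<Lambda>: "(\<integral>x. x \<partial>\<Lambda>) = 0"
begin

text \<open>The level \<open>exp v\<close> is the inverse of the weight of an individual at
  \<open>v\<close>. Subtracting \<open>cmean\<close> gives \<eta> mean 0 under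
  \<open>\<Lambda>\<close>; \<zeta> collects what is left.\<close>

definition small :: "real \<Rightarrow> real \<Rightarrow> real" where "small v x = (if \<bar>x\<bar> \<le> exp v then x else 0)"
definition big :: "real \<Rightarrow> real \<Rightarrow> real" where "big v x = (if \<bar>x\<bar> \<le> exp v then 0 else x)"
definition cmean :: "real \<Rightarrow> real" where "cmean v = (\<integral>x. small v x \<partial>\<Lambda>)"
definition \<eta> :: "real \<Rightarrow> real \<Rightarrow> real" where "\<eta> v x = small v x - cmean v"
definition \<zeta> :: "real \<Rightarrow> real \<Rightarrow> real" where "\<zeta> v x = big v x + cmean v"

lemma \<eta>_add_\<zeta>: "\<eta> v x + \<zeta> v x = x" by (simp add: \<eta>_def \<zeta>_def small_def big_def)

lemma measurable_small [measurable]: "(\<lambda>(v, x). small v x) \<in> borel_measurable (borel \<Otimes>\<^sub>M borel)"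
  "(\<lambda>(v, x). big v x) \<in> borel_measurable (borel \<Otimes>\<^sub>M borel)"
  unfolding small_def big_def by measurable

lemma measurable_cmean [measurable]: "cmean \<in> borel_measurable borel"
proof -
  have "(\<lambda>(v, x). small v x) \<in> borel_measurable (borel \<Otimes>\<^sub>M \<Lambda>)" by measurable
  from borel_measurable_lebesgue_integral[OF this] show ?thesis by (simp add: cmean_def[abs_def])
qed

lemma measurable_\<eta> [measurable]: "(\<lambda>(v, x). \<eta> v x) \<in> borel_measurable (borel \<Otimes>\<^sub>M borel)"
  "(\<lambda>(v, x). \<zeta> v x) \<in> borel_measurable (borel \<Otimes>\<^sub>M borel)"
  unfolding \<eta>_def \<zeta>_def case_prod_unfold
  using measurable_small[unfolded case_prod_unfold] by measurable

lemma abs_small_le: "\<bar>small v x\<bar> \<le> exp v" by (auto simp: small_def)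

lemma integrable_small: "integrable \<Lambda> (small v)" "integrable \<Lambda> (big v)"
  unfolding small_def big_def
  by (auto intro!: Bochner_Integration.integrable_bound[OF int_\<Lambda>])

lemma abs_cmean_le_exp: "\<bar>cmean v\<bar> \<le> exp v"
proof -
  have "\<bar>cmean v\<bar> \<le> (\<integral>x. \<bar>small v x\<bar> \<partial>\<Lambda>)" unfolding cmean_def by (rule integral_abs_bound)
  also have "\<dots> \<le> (\<integral>x. exp v \<partial>\<Lambda>)"
    using integrable_small(1)[of v] by (intro integral_mono) (auto simp: abs_small_le)
  finally show ?thesis by (simp add: prob_space)
qed

lemma abs_\<eta>_le: "\<bar>\<eta> v x\<bar> \<le> 2 * exp v"
  using abs_small_le[of v x] abs_cmean_le_exp[of v] unfolding \<eta>_def by linarith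

lemma integral_\<eta>: "(\<integral>x. \<eta> v x \<partial>\<Lambda>) = 0"
  using integrable_small(1)[of v] by (simp add: \<eta>_def cmean_def prob_space)

text \<open>As \<open>\<Lambda>\<close> has mean 0, the means of the small and the big part cancel.
  The centring is thereby paid for by the big part, so that \<zeta> is controlled by big values
  alone.\<close>

lemma abs_cmean_le_big: "ennreal \<bar>cmean v\<bar> \<le> (\<integral>\<^sup>+x. ennreal \<bar>big v x\<bar> \<partial>\<Lambda>)"
proof -
  have "(\<integral>x. small v x + big v x \<partial>\<Lambda>) = (\<integral>x. x \<partial>\<Lambda>)"
    by (intro Bochner_Integration.integral_cong) (auto simp: small_def big_def)
  then have "cmean v = - (\<integral>x. big v x \<partial>\<Lambda>)"
    using integrable_small[of v] by (simp add: mean_\<Lambda> cmean_def)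
  then have "\<bar>cmean v\<bar> \<le> (\<integral>x. \<bar>big v x\<bar> \<partial>\<Lambda>)"
    using integral_abs_bound[of \<Lambda> "big v"] by simp
  then have "ennreal \<bar>cmean v\<bar> \<le> ennreal (\<integral>x. \<bar>big v x\<bar> \<partial>\<Lambda>)" by (rule ennreal_leI)
  also have "\<dots> = (\<integral>\<^sup>+x. ennreal \<bar>big v x\<bar> \<partial>\<Lambda>)"
    using integrable_small[of v] by (intro nn_integral_eq_integral[symmetric]) auto
  finally show ?thesis .
qed

lemma nn_integral_\<zeta>_le: "(\<integral>\<^sup>+x. ennreal \<bar>\<zeta> v x\<bar> \<partial>\<Lambda>) \<le> 2 * (\<integral>\<^sup>+x. ennreal \<bar>big v x\<bar> \<partial>\<Lambda>)"
proof -
  have "(\<integral>\<^sup>+x. ennreal \<bar>\<zeta> v x\<bar> \<partial>\<Lambda>) \<le> (\<integral>\<^sup>+x. ennreal \<bar>big v x\<bar> + ennreal \<bar>cmean v\<bar> \<partial>\<Lambda>)"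
    by (intro nn_integral_mono) (auto simp: \<zeta>_def simp flip: ennreal_plus)
  also have "\<dots> = (\<integral>\<^sup>+x. ennreal \<bar>big v x\<bar> \<partial>\<Lambda>) + ennreal \<bar>cmean v\<bar>"
    by (subst nn_integral_add) (auto simp: emeasure_space_1)
  also have "\<dots> \<le> (\<integral>\<^sup>+x. ennreal \<bar>big v x\<bar> \<partial>\<Lambda>) + (\<integral>\<^sup>+x. ennreal \<bar>big v x\<bar> \<partial>\<Lambda>)"
    by (intro add_left_mono abs_cmean_le_big)
  finally show ?thesis by (simp add: mult_2)
qed

text \<open>A bound independent of \<open>v\<close>, for the absolute convergence of the sum over a
  single generation.\<close>

lemma nn_integral_\<eta>_le: "(\<integral>\<^sup>+x. ennreal \<bar>\<eta> v x\<bar> \<partial>\<Lambda>) \<le> 2 * ennreal (\<integral>x. \<bar>x\<bar> \<partial>\<Lambda>)"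
proof -
  have s: "(\<integral>\<^sup>+x. ennreal \<bar>small v x\<bar> \<partial>\<Lambda>) \<le> ennreal (\<integral>x. \<bar>x\<bar> \<partial>\<Lambda>)"
    using int_\<Lambda> by (subst nn_integral_eq_integral[symmetric])
      (auto intro!: nn_integral_mono ennreal_leI simp: small_def)
  have "\<bar>cmean v\<bar> \<le> (\<integral>x. \<bar>small v x\<bar> \<partial>\<Lambda>)" unfolding cmean_def by (rule integral_abs_bound)
  also have "\<dots> \<le> (\<integral>x. \<bar>x\<bar> \<partial>\<Lambda>)"
    by (intro integral_mono integrable_abs integrable_small int_\<Lambda>) (simp add: small_def)
  finally have c: "ennreal \<bar>cmean v\<bar> \<le> ennreal (\<integral>x. \<bar>x\<bar> \<partial>\<Lambda>)" by (rule ennreal_leI)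
  have "(\<integral>\<^sup>+x. ennreal \<bar>\<eta> v x\<bar> \<partial>\<Lambda>) \<le> (\<integral>\<^sup>+x. ennreal \<bar>small v x\<bar> + ennreal \<bar>cmean v\<bar> \<partial>\<Lambda>)"
    by (intro nn_integral_mono) (auto simp: \<eta>_def simp flip: ennreal_plus)
  also have "\<dots> = (\<integral>\<^sup>+x. ennreal \<bar>small v x\<bar> \<partial>\<Lambda>) + ennreal \<bar>cmean v\<bar>"
    by (subst nn_integral_add) (auto simp: emeasure_space_1)
  also have "\<dots> \<le> ennreal (\<integral>x. \<bar>x\<bar> \<partial>\<Lambda>) + ennreal (\<integral>x. \<bar>x\<bar> \<partial>\<Lambda>)" by (intro add_mono s c)
  finally show ?thesis by (simp add: mult_2)
qed

text \<open>A variance is at most the second moment.\<close>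

lemma nn_integral_\<eta>_sq_le: "(\<integral>\<^sup>+x. ennreal ((\<eta> v x)\<^sup>2) \<partial>\<Lambda>) \<le> (\<integral>\<^sup>+x. ennreal ((small v x)\<^sup>2) \<partial>\<Lambda>)"
proof -
  have sq: "integrable \<Lambda> (\<lambda>x. (small v x)\<^sup>2)"
  proof (rule integrable_const_bound[where B="(exp v)\<^sup>2"])
    show "AE x in \<Lambda>. norm ((small v x)\<^sup>2) \<le> (exp v)\<^sup>2"
      using abs_small_le by (intro AE_I2) (simp add: abs_le_square_iff[symmetric])
  qed measurable
  have "integrable \<Lambda> (\<lambda>x. (\<eta> v x)\<^sup>2)"
    unfolding \<eta>_def power2_diff using sq integrable_small[of v] by auto
  moreover have "(\<integral>x. (\<eta> v x)\<^sup>2 \<partial>\<Lambda>) \<le> (\<integral>x. (small v x)\<^sup>2 \<partial>\<Lambda>)"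
    using variance_eq[OF integrable_small(1) sq] by (simp add: \<eta>_def cmean_def)
  ultimately show ?thesis using sq
    by (simp add: nn_integral_eq_integral ennreal_leI)
qed

text \<open>Both integrands are dominated by the kernel of \<open>renewal_kernel_finite\<close>.
  Above the level, exp((t - 1) v) |x| equals |x|^t exp(- (t - 1) (ln |x| - v)); below it, exp((t -
  2) v) x^2 equals |x|^t exp(- (2 - t) (v - ln |x|)). The factor exp(t v) undoes the tilting of the
  walk.\<close>

lemma renewal_truncated_moments:
  assumes Q: "prob_space Q" "sets Q = sets borel" "integrable Q (\<lambda>x. x)" "(\<integral>x. x \<partial>Q) > 0"
    and K: "(\<integral>\<^sup>+x. ennreal (\<bar>x\<bar> powr t) \<partial>\<Lambda>) < \<infinity>" and t: "1 < t" "t < 2"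
  shows "(\<Sum>n. \<integral>\<^sup>+v. ennreal (exp (t * v)) * (\<integral>\<^sup>+x. ennreal (exp (- v) * \<bar>\<zeta> v x\<bar>) \<partial>\<Lambda>) \<partial>conv_power Q n) < \<infinity>" (is "?A < _")
    and "(\<Sum>n. \<integral>\<^sup>+v. ennreal (exp (t * v)) * (\<integral>\<^sup>+x. ennreal ((exp (- v) * \<eta> v x)\<^sup>2) \<partial>\<Lambda>) \<partial>conv_power Q n) < \<infinity>" (is "?B < _")
proof -
  define \<delta> where "\<delta> = min (t - 1) (2 - t)"
  have \<delta>: "\<delta> > 0" "\<delta> \<le> t - 1" "\<delta> \<le> 2 - t" using t by (auto simp: \<delta>_def)
  let ?k = "\<lambda>v x. \<bar>x\<bar> powr t * exp (- \<delta> * \<bar>v - ln \<bar>x\<bar>\<bar>)"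
  let ?K = "\<Sum>n. \<integral>\<^sup>+v. \<integral>\<^sup>+x. ennreal (?k v x) \<partial>\<Lambda> \<partial>conv_power Q n"
  have fin: "?K < \<infinity>"
    by (rule renewal_kernel_finite[OF Q prob_space_axioms sets_\<Lambda> K \<delta>(1)])
  have k_eq: "?k v x = exp (t * ln \<bar>x\<bar> - \<delta> * \<bar>v - ln \<bar>x\<bar>\<bar>)" if "x \<noteq> 0" for v x
    using that by (simp add: powr_def exp_diff exp_minus divide_inverse)
  have kbig: "exp (t * v) * (exp (- v) * \<bar>big v x\<bar>) \<le> ?k v x" for v x
  proof (cases "\<bar>x\<bar> \<le> exp v")
    case False
    then have pos: "0 < \<bar>x\<bar>" using exp_gt_zero[of v] by linarith
    then have x: "x \<noteq> 0" "v < ln \<bar>x\<bar>"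
      using False ln_less_cancel_iff[OF exp_gt_zero pos, of v] by auto
    have "exp (t * v) * (exp (- v) * \<bar>big v x\<bar>) = exp (t * v) * (exp (- v) * exp (ln \<bar>x\<bar>))"
      using False x by (simp add: big_def)
    also have "\<dots> = exp (t * ln \<bar>x\<bar> - (t - 1) * (ln \<bar>x\<bar> - v))"
      by (simp flip: exp_add) (simp add: algebra_simps)
    also have "\<dots> \<le> exp (t * ln \<bar>x\<bar> - \<delta> * \<bar>v - ln \<bar>x\<bar>\<bar>)"
      using x \<delta> by (simp add: mult_right_mono)
    finally show ?thesis by (simp only: k_eq[OF x(1)])
  qed (simp add: big_def)
  have ksmall: "exp (t * v) * (exp (- (2 * v)) * (small v x)\<^sup>2) \<le> ?k v x" for v x
  proof (cases "x \<noteq> 0 \<and> \<bar>x\<bar> \<le> exp v")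
    case True
    then have x: "x \<noteq> 0" "ln \<bar>x\<bar> \<le> v"
      using ln_le_cancel_iff[of "\<bar>x\<bar>" "exp v"] by auto
    have "(small v x)\<^sup>2 = exp (ln \<bar>x\<bar>) ^ 2" using True by (simp add: small_def)
    then have "exp (t * v) * (exp (- (2 * v)) * (small v x)\<^sup>2) = exp (t * v) * (exp (- (2 * v)) * (exp (ln \<bar>x\<bar>) * exp (ln \<bar>x\<bar>)))"
      by (simp only: power2_eq_square)
    also have "\<dots> = exp (t * ln \<bar>x\<bar> - (2 - t) * (v - ln \<bar>x\<bar>))"
      by (simp only: exp_add[symmetric]) (simp add: algebra_simps)
    also have "\<dots> \<le> exp (t * ln \<bar>x\<bar> - \<delta> * \<bar>v - ln \<bar>x\<bar>\<bar>)"
      using x \<delta> by (simp add: mult_right_mono)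
    finally show ?thesis by (simp only: k_eq[OF x(1)])
  qed (auto simp: small_def)
  have "ennreal (exp (t * v)) * (\<integral>\<^sup>+x. ennreal (exp (- v) * \<bar>\<zeta> v x\<bar>) \<partial>\<Lambda>) \<le> 2 * (\<integral>\<^sup>+x. ennreal (?k v x) \<partial>\<Lambda>)" for v
  proof -
    have "ennreal (exp (t * v)) * (\<integral>\<^sup>+x. ennreal (exp (- v) * \<bar>\<zeta> v x\<bar>) \<partial>\<Lambda>) =
      ennreal (exp (t * v)) * (ennreal (exp (- v)) * (\<integral>\<^sup>+x. ennreal \<bar>\<zeta> v x\<bar> \<partial>\<Lambda>))"
      by (subst nn_integral_cmult[symmetric]) (auto simp: ennreal_mult)
    also have "\<dots> \<le> ennreal (exp (t * v)) * (ennreal (exp (- v)) * (2 * (\<integral>\<^sup>+x. ennreal \<bar>big v x\<bar> \<partial>\<Lambda>)))"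
      by (intro mult_left_mono nn_integral_\<zeta>_le) auto
    also have "\<dots> = 2 * (\<integral>\<^sup>+x. ennreal (exp (t * v) * (exp (- v) * \<bar>big v x\<bar>)) \<partial>\<Lambda>)"
      by (simp add: ennreal_mult nn_integral_cmult, simp only: mult_ac)
    also have "\<dots> \<le> 2 * (\<integral>\<^sup>+x. ennreal (?k v x) \<partial>\<Lambda>)"
      by (intro mult_left_mono nn_integral_mono ennreal_leI kbig) auto
    finally show ?thesis .
  qed
  then have "?A \<le> (\<Sum>n. \<integral>\<^sup>+v. 2 * (\<integral>\<^sup>+x. ennreal (?k v x) \<partial>\<Lambda>) \<partial>conv_power Q n)"
    by (intro suminf_le nn_integral_mono) auto
  also have "\<dots> = 2 * ?K"
  proof -
    have [measurable_cong]: "sets (conv_power Q n) = sets borel" for n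
      by (rule conv_power_prob_space[OF Q(1,2)])
    show ?thesis by (simp add: nn_integral_cmult)
  qed
  also have "\<dots> < \<infinity>" using fin by (simp add: ennreal_mult_less_top)
  finally show "?A < \<infinity>" .
  have "ennreal (exp (t * v)) * (\<integral>\<^sup>+x. ennreal ((exp (- v) * \<eta> v x)\<^sup>2) \<partial>\<Lambda>) \<le> (\<integral>\<^sup>+x. ennreal (?k v x) \<partial>\<Lambda>)" for v
  proof -
    have e: "(exp (- v))\<^sup>2 = exp (- (2 * v))" by (simp add: power2_eq_square flip: exp_add)
    have "ennreal (exp (t * v)) * (\<integral>\<^sup>+x. ennreal ((exp (- v) * \<eta> v x)\<^sup>2) \<partial>\<Lambda>) =
      ennreal (exp (t * v)) * (ennreal (exp (- (2 * v))) * (\<integral>\<^sup>+x. ennreal ((\<eta> v x)\<^sup>2) \<partial>\<Lambda>))"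
      by (subst nn_integral_cmult[symmetric]) (auto simp: ennreal_mult power_mult_distrib e)
    also have "\<dots> \<le> ennreal (exp (t * v)) * (ennreal (exp (- (2 * v))) * (\<integral>\<^sup>+x. ennreal ((small v x)\<^sup>2) \<partial>\<Lambda>))"
      by (intro mult_left_mono nn_integral_\<eta>_sq_le) auto
    also have "\<dots> = (\<integral>\<^sup>+x. ennreal (exp (t * v) * (exp (- (2 * v)) * (small v x)\<^sup>2)) \<partial>\<Lambda>)"
      by (simp add: ennreal_mult nn_integral_cmult)
    also have "\<dots> \<le> (\<integral>\<^sup>+x. ennreal (?k v x) \<partial>\<Lambda>)"
      by (intro nn_integral_mono ennreal_leI ksmall)
    finally show ?thesis .
  qed
  then have "?B \<le> ?K"
    by (intro suminf_le nn_integral_mono) auto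
  with fin show "?B < \<infinity>" by simp
qed

end

section \<open>Convergence of the weighted increments\<close>

context offspring_laws
begin

lemma measurable_nn_integral_words:
  assumes "\<And>u. (\<lambda>p. F p u) \<in> borel_measurable \<P>"
  shows "(\<lambda>p. \<integral>\<^sup>+u. F p u \<partial>count_space (words n)) \<in> borel_measurable \<P>"
proof (rule sigma_finite_measure.borel_measurable_nn_integral)
  show "sigma_finite_measure (count_space (words n))"
    by (rule sigma_finite_measure_count_space_countable) simp
  show "(\<lambda>(p, u). F p u) \<in> borel_measurable (\<P> \<Otimes>\<^sub>M count_space (words n))"
    unfolding case_prod_unfold
    by (rule measurable_compose_countable'[where I="words n" and f="\<lambda>u z. F (fst z) u"])
      (use assms in \<open>auto intro: measurable_compose[OF measurable_fst]\<close>)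
qed

definition mass :: "enat \<times> (nat \<Rightarrow> real) \<Rightarrow> ennreal" where
  "mass = child_sum (\<lambda>x. ennreal (exp (- x)))"

text \<open>An infinite mass is turned into 0 by \<open>enn2real\<close>;
  \<open>AE_mass_finite\<close> shows that this affects a null set only.\<close>

definition \<xi> :: "enat \<times> (nat \<Rightarrow> real) \<Rightarrow> real" where
  "\<xi> e = enn2real (mass e) - 1"

definition \<Lambda> :: "real measure" where "\<Lambda> = distr (\<nu> []) borel \<xi>"

lemma measurable_mass [measurable]: "mass \<in> borel_measurable offspring_space"
  unfolding mass_def by measurable

lemma measurable_\<xi> [measurable]: "\<xi> \<in> borel_measurable offspring_space"
  unfolding \<xi>_def[abs_def] by measurable

lemma measurable_\<xi>_\<nu> [measurable]: "\<xi> \<in> borel_measurable (\<nu> u)"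
  using measurable_\<xi> by (simp add: measurable_cong_sets[OF sets_\<nu> refl])

lemma nn_integral_mass_cong:
  "g \<in> borel_measurable borel \<Longrightarrow> (\<integral>\<^sup>+e. g (mass e) \<partial>\<nu> u) = (\<integral>\<^sup>+e. g (mass e) \<partial>\<nu> [])"
  unfolding mass_def by (rule same_law) simp_all

text \<open>The laws \<open>\<nu> u\<close> need not agree, but \<xi> is a function of a single
  child sum.\<close>

lemma distr_\<xi>: "distr (\<nu> u) borel \<xi> = \<Lambda>"
proof (rule measure_eqI)
  fix A assume "A \<in> sets (distr (\<nu> u) borel \<xi>)"
  then have A [measurable]: "A \<in> sets borel" by simp
  have e: "emeasure (distr (\<nu> u) borel \<xi>) A = (\<integral>\<^sup>+e. indicator A (\<xi> e) \<partial>\<nu> u)" for u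
    by (subst nn_integral_distr[symmetric, where M="\<nu> u" and M'=borel and T=\<xi>]) auto
  show "emeasure (distr (\<nu> u) borel \<xi>) A = emeasure \<Lambda> A"
    unfolding \<Lambda>_def e \<xi>_def
    by (rule nn_integral_mass_cong[where g="\<lambda>y. indicator A (enn2real y - 1)"]) measurable
qed (simp add: \<Lambda>_def)

lemma sets_\<Lambda> [measurable_cong]: "sets \<Lambda> = sets borel" by (simp add: \<Lambda>_def)

end

text \<open>The hypotheses of the theorem as the convergence proof uses them: minimality of
  \<vartheta> and the derivative condition survive only as the positive drift, which
  \<open>step_law_mean_pos\<close> provides.\<close>

locale tilted_offspring = offspring_laws \<nu> for \<nu> +
  fixes t a :: real
  assumes t: "1 < t" "t < 2" and a: "a > 0"
    and mean_one: "(\<integral>\<^sup>+e. mass e \<partial>\<nu> []) = 1"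
    and moment: "(\<integral>\<^sup>+e. ennpowr (mass e) t \<partial>\<nu> []) < \<infinity>"
    and step_prob: "prob_space (step_law t a)"
    and step_int: "integrable (step_law t a) (\<lambda>x. x)"
    and step_mean: "(\<integral>x. x \<partial>step_law t a) > 0"
begin

abbreviation "V p u \<equiv> shifted_position a p u"

lemma AE_mass_finite: "AE e in \<nu> u. mass e \<noteq> \<infinity>"
proof -
  have "(\<integral>\<^sup>+e. mass e \<partial>\<nu> u) = 1"
    using nn_integral_mass_cong[of "\<lambda>x. x" u] mean_one by simp
  moreover have "mass \<in> borel_measurable (\<nu> u)" unfolding mass_def by (rule measurable_child_sum_\<nu>) simp
  ultimately show ?thesis by (intro nn_integral_noteq_infinite) auto
qed

sublocale trunc: truncation \<Lambda>
proof -
  have [measurable]: "mass \<in> borel_measurable (\<nu> [])" unfolding mass_def by (rule measurable_child_sum_\<nu>) simp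
  have n: "(\<integral>\<^sup>+e. ennreal (enn2real (mass e)) \<partial>\<nu> []) = ennreal 1"
    unfolding ennreal_1 mean_one[symmetric]
    by (rule nn_integral_cong_AE) (use AE_mass_finite[of "[]"] in \<open>eventually_elim, simp add: less_top\<close>)
  have int: "has_bochner_integral (\<nu> []) (\<lambda>e. enn2real (mass e)) 1"
    by (rule has_bochner_integral_nn_integral) (use n in auto)
  then have i: "integrable (\<nu> []) \<xi>" "(\<integral>e. \<xi> e \<partial>\<nu> []) = 0"
    unfolding \<xi>_def[abs_def] by (auto simp: has_bochner_integral_iff \<nu>.prob_space)
  show "truncation \<Lambda>"
  proof (intro truncation.intro truncation_axioms.intro)
    show "prob_space \<Lambda>" unfolding \<Lambda>_def by (rule \<nu>.prob_space_distr) simp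
    show "sets \<Lambda> = sets borel" by (rule sets_\<Lambda>)
    show "integrable \<Lambda> (\<lambda>x. x)" "(\<integral>x. x \<partial>\<Lambda>) = 0"
      using i by (simp_all add: \<Lambda>_def integrable_distr_eq integral_distr)
  qed
qed

lemma moment_\<Lambda>: "(\<integral>\<^sup>+x. ennreal (\<bar>x\<bar> powr t) \<partial>\<Lambda>) < \<infinity>"
proof -
  have [measurable]: "(\<lambda>e. ennpowr (mass e) t) \<in> borel_measurable (\<nu> [])"
  proof -
    have "(\<lambda>x. ennpowr x t) \<in> borel_measurable borel" unfolding ennpowr_def by measurable
    moreover have "mass \<in> borel_measurable (\<nu> [])" unfolding mass_def by (rule measurable_child_sum_\<nu>) simp
    ultimately show ?thesis by (rule measurable_compose[rotated])
  qed
  have "(\<integral>\<^sup>+x. ennreal (\<bar>x\<bar> powr t) \<partial>\<Lambda>) = (\<integral>\<^sup>+e. ennreal (\<bar>\<xi> e\<bar> powr t) \<partial>\<nu> [])"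
    unfolding \<Lambda>_def by (rule nn_integral_distr) auto
  also have "\<dots> \<le> (\<integral>\<^sup>+e. ennpowr (mass e) t + 1 \<partial>\<nu> [])"
  proof (rule nn_integral_mono_AE, use AE_mass_finite[of "[]"] in eventually_elim)
    fix e assume fin: "mass e \<noteq> \<infinity>"
    define y where "y = enn2real (mass e)"
    have y: "y \<ge> 0" by (simp add: y_def)
    \<comment> \<open>As y >= 0, the distance from y to 1 is at most the larger of the two.\<close>
    have "\<bar>y - 1\<bar> powr t \<le> (max y 1) powr t" using y t by (intro powr_mono2) auto
    also have "\<dots> \<le> y powr t + 1" by (auto simp: max_def)
    finally have "ennreal (\<bar>y - 1\<bar> powr t) \<le> ennreal (y powr t + 1)" by (rule ennreal_leI)
    also have "\<dots> = ennreal (y powr t) + 1" by (subst ennreal_plus) simp_all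
    finally show "ennreal (\<bar>\<xi> e\<bar> powr t) \<le> ennpowr (mass e) t + 1"
      using fin by (simp add: ennpowr_def \<xi>_def y_def)
  qed
  also have "\<dots> = (\<integral>\<^sup>+e. ennpowr (mass e) t \<partial>\<nu> []) + 1"
    by (subst nn_integral_add) (auto simp: \<nu>.emeasure_space_1)
  also have "\<dots> < \<infinity>" using moment by (simp add: less_top[symmetric])
  finally show ?thesis .
qed

lemma measurable_kernel [measurable]:
  assumes "(\<lambda>(v, x). G v x) \<in> borel_measurable (borel \<Otimes>\<^sub>M borel)"
  shows "(\<lambda>p. G (V p u) (\<xi> (p u))) \<in> borel_measurable \<P>"
  using measurable_compose[OF measurable_Pair[OF measurable_shifted_position
    measurable_compose[OF measurable_coord measurable_\<xi>]] assms, of a u] by simp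

text \<open>The mark \<xi> of \<open>u\<close> is independent of the path to \<open>u\<close> and
  has law \<open>\<Lambda>\<close>, so it integrates out; the factor exp(t v) compensates the weight
  in \<open>many_to_one\<close>.\<close>

lemma many_to_one_marked:
  fixes G :: "real \<Rightarrow> real \<Rightarrow> ennreal"
  assumes [measurable]: "(\<lambda>(v, x). G v x) \<in> borel_measurable (borel \<Otimes>\<^sub>M borel)"
  shows "(\<integral>\<^sup>+p. \<integral>\<^sup>+u. (if live p u then G (V p u) (\<xi> (p u)) else 0) \<partial>count_space (words n) \<partial>\<P>) =
    (\<integral>\<^sup>+v. ennreal (exp (t * v)) * (\<integral>\<^sup>+x. G v x \<partial>\<Lambda>) \<partial>conv_power (step_law t a) n)"
proof -
  have Gm: "(\<lambda>x. G v x) \<in> borel_measurable borel" for v using assms by measurable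
  have int: "(\<integral>\<^sup>+e. G v (\<xi> e) \<partial>\<nu> u) = (\<integral>\<^sup>+x. G v x \<partial>\<Lambda>)" for v u
    unfolding distr_\<xi>[of u, symmetric] using Gm by (subst nn_integral_distr) auto
  have Fm: "(\<lambda>(v, e). G v (\<xi> e)) \<in> borel_measurable (borel \<Otimes>\<^sub>M offspring_space)"
    using measurable_compose[OF measurable_Pair[OF measurable_fst measurable_compose[OF measurable_snd measurable_\<xi>]] assms]
    by (simp add: case_prod_unfold)
  have same: "(\<integral>\<^sup>+e. G v (\<xi> e) \<partial>\<nu> u) = (\<integral>\<^sup>+e. G v (\<xi> e) \<partial>\<nu> [])" for v u
    by (simp only: int)
  have hm: "(\<lambda>v. ennreal (exp (t * v)) * (\<integral>\<^sup>+x. G v x \<partial>\<Lambda>)) \<in> borel_measurable borel"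
    by measurable
  have "(\<integral>\<^sup>+p. \<integral>\<^sup>+u. (if live p u then G (V p u) (\<xi> (p u)) else 0) \<partial>count_space (words n) \<partial>\<P>) =
    (\<integral>\<^sup>+p. \<integral>\<^sup>+u. (if live p u then (\<integral>\<^sup>+x. G (V p u) x \<partial>\<Lambda>) else 0) \<partial>count_space (words n) \<partial>\<P>)"
    using resample_words[OF Fm same, of n a] unfolding int .
  also have "(\<lambda>p u. if live p u then (\<integral>\<^sup>+x. G (V p u) x \<partial>\<Lambda>) else 0) =
    (\<lambda>p u. if live p u then ennreal (exp (- t * V p u)) * (ennreal (exp (t * V p u)) * (\<integral>\<^sup>+x. G (V p u) x \<partial>\<Lambda>)) else 0)"
    by (simp add: fun_eq_iff mult.assoc[symmetric] ennreal_mult[symmetric] exp_minus)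
  finally show ?thesis unfolding many_to_one[OF step_prob hm] .
qed

definition centred :: "(nat list \<Rightarrow> enat \<times> (nat \<Rightarrow> real)) \<Rightarrow> nat list \<Rightarrow> real" where
  "centred p u = (if live p u then exp (- V p u) * trunc.\<eta> (V p u) (\<xi> (p u)) else 0)"

definition remainder :: "(nat list \<Rightarrow> enat \<times> (nat \<Rightarrow> real)) \<Rightarrow> nat list \<Rightarrow> real" where
  "remainder p u = (if live p u then exp (- V p u) * trunc.\<zeta> (V p u) (\<xi> (p u)) else 0)"

lemma measurable_centred [measurable]: "(\<lambda>p. centred p u) \<in> borel_measurable \<P>"
  "(\<lambda>p. remainder p u) \<in> borel_measurable \<P>"
proof -
  have [measurable]: "(\<lambda>p. trunc.\<eta> (V p u) (\<xi> (p u))) \<in> borel_measurable \<P>"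
    "(\<lambda>p. trunc.\<zeta> (V p u) (\<xi> (p u))) \<in> borel_measurable \<P>"
    using measurable_kernel[OF trunc.measurable_\<eta>(1)] measurable_kernel[OF trunc.measurable_\<eta>(2)] by auto
  show "(\<lambda>p. centred p u) \<in> borel_measurable \<P>" "(\<lambda>p. remainder p u) \<in> borel_measurable \<P>"
    unfolding centred_def remainder_def by measurable
qed

text \<open>The truncation level cancels the weight: the weighted small part is at most 1 in
  modulus, and so is its weighted mean.\<close>

lemma abs_centred_le: "\<bar>centred p u\<bar> \<le> 2"
proof -
  have "exp (- V p u) * \<bar>trunc.\<eta> (V p u) (\<xi> (p u))\<bar> \<le> exp (- V p u) * (2 * exp (V p u))"
    by (intro mult_left_mono trunc.abs_\<eta>_le) simp
  also have "\<dots> = 2" by (simp add: exp_minus)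
  finally show ?thesis by (simp add: centred_def abs_mult)
qed

lemma centred_upd: "length v \<le> length u \<Longrightarrow> v \<noteq> u \<Longrightarrow> centred (p(u := e)) v = centred p v"
  by (simp add: centred_def)

text \<open>For one step the moment of order t - 1 undoes the tilt from t down to 1 and equals
  exp(a) m(1) = exp a; independent steps multiply. By many-to-one the moment is the mean of the sum
  of exp(- V(u)) over generation \<open>n\<close>.\<close>

lemma exp_moment_finite: "(\<integral>\<^sup>+v. ennreal (exp ((t - 1) * v)) \<partial>conv_power (step_law t a) n) < \<infinity>"
proof -
  have step: "(\<integral>\<^sup>+y. ennreal (exp ((t - 1) * y)) \<partial>step_law t a) = ennreal (exp a)"
  proof -
    have "(\<integral>\<^sup>+y. ennreal (exp ((t - 1) * y)) \<partial>step_law t a) =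
      (\<integral>\<^sup>+e. child_sum (\<lambda>x. ennreal (exp (- t * (x - a))) * ennreal (exp ((t - 1) * (x - a)))) e \<partial>\<nu> [])"
      by (rule nn_integral_step_law) simp
    also have "(\<lambda>x. ennreal (exp (- t * (x - a))) * ennreal (exp ((t - 1) * (x - a)))) =
        (\<lambda>x. ennreal (exp a) * ennreal (exp (- x)))"
      by (simp add: fun_eq_iff ennreal_mult[symmetric] exp_add[symmetric] algebra_simps)
    also have "child_sum (\<lambda>x. ennreal (exp a) * ennreal (exp (- x))) = (\<lambda>e. ennreal (exp a) * mass e)"
      unfolding mass_def child_sum_def ennreal_suminf_cmult[symmetric]
      by (intro ext suminf_cong) auto
    also have "(\<integral>\<^sup>+e. ennreal (exp a) * mass e \<partial>\<nu> []) = ennreal (exp a) * (\<integral>\<^sup>+e. mass e \<partial>\<nu> [])"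
      unfolding mass_def by (intro nn_integral_cmult measurable_child_sum_\<nu>) simp
    finally show ?thesis by (simp add: mean_one)
  qed
  show ?thesis
  proof (induction n)
    case (Suc n)
    have [measurable_cong]: "sets (conv_power (step_law t a) n) = sets borel"
      by (rule conv_power_prob_space(2)[OF step_prob sets_step_law])
    have "(\<integral>\<^sup>+v. ennreal (exp ((t - 1) * v)) \<partial>conv_power (step_law t a) (Suc n)) =
      (\<integral>\<^sup>+x. \<integral>\<^sup>+y. ennreal (exp ((t - 1) * (x + y))) \<partial>step_law t a \<partial>conv_power (step_law t a) n)"
      by (rule nn_integral_conv_power_Suc[OF step_prob sets_step_law]) simp
    also have "\<dots> = (\<integral>\<^sup>+x. ennreal (exp ((t - 1) * x)) * ennreal (exp a) \<partial>conv_power (step_law t a) n)"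
      unfolding step[symmetric]
      by (subst nn_integral_cmult[symmetric])
         (auto simp: ennreal_mult[symmetric] exp_add[symmetric] ring_distribs)
    also have "\<dots> = (\<integral>\<^sup>+x. ennreal (exp ((t - 1) * x)) \<partial>conv_power (step_law t a) n) * ennreal (exp a)"
      by (rule nn_integral_multc) measurable
    also have "\<dots> < \<infinity>" using Suc by (simp add: ennreal_mult_less_top)
    finally show ?case .
  qed (simp add: nn_integral_return)
qed

lemma AE_weights_finite:
  "AE p in \<P>. \<forall>n. (\<integral>\<^sup>+u. (if live p u then ennreal (exp (- V p u)) else 0) \<partial>count_space (words n)) \<noteq> \<infinity>"
  unfolding AE_all_countable
proof
  fix n
  have "(\<integral>\<^sup>+p. \<integral>\<^sup>+u. (if live p u then ennreal (exp (- V p u)) else 0) \<partial>count_space (words n) \<partial>\<P>) =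
    (\<integral>\<^sup>+v. ennreal (exp (t * v)) * (\<integral>\<^sup>+x. ennreal (exp (- v)) \<partial>\<Lambda>) \<partial>conv_power (step_law t a) n)"
    by (rule many_to_one_marked[where G="\<lambda>v x. ennreal (exp (- v))"]) measurable
  also have "\<dots> = (\<integral>\<^sup>+v. ennreal (exp ((t - 1) * v)) \<partial>conv_power (step_law t a) n)"
    by (intro nn_integral_cong)
      (simp add: trunc.emeasure_space_1 ennreal_mult[symmetric] exp_add[symmetric] algebra_simps)
  also have "\<dots> < \<infinity>" by (rule exp_moment_finite)
  finally show "AE p in \<P>. (\<integral>\<^sup>+u. (if live p u then ennreal (exp (- V p u)) else 0) \<partial>count_space (words n)) \<noteq> \<infinity>"
    by (intro nn_integral_noteq_infinite measurable_nn_integral_words) auto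
qed


text \<open>A generation may be infinite; absolute convergence over it is what lets finite portions
  approximate the whole sum.\<close>

lemma AE_centred_finite:
  "AE p in \<P>. \<forall>n. (\<integral>\<^sup>+u. ennreal \<bar>centred p u\<bar> \<partial>count_space (words n)) \<noteq> \<infinity>"
  unfolding AE_all_countable
proof
  fix n
  have [measurable]: "(\<lambda>(v, x). trunc.\<eta> v x) \<in> borel_measurable (borel \<Otimes>\<^sub>M borel)" by (rule trunc.measurable_\<eta>)
  have "(\<integral>\<^sup>+p. \<integral>\<^sup>+u. ennreal \<bar>centred p u\<bar> \<partial>count_space (words n) \<partial>\<P>) =
    (\<integral>\<^sup>+p. \<integral>\<^sup>+u. (if live p u then ennreal (exp (- V p u) * \<bar>trunc.\<eta> (V p u) (\<xi> (p u))\<bar>) else 0)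
      \<partial>count_space (words n) \<partial>\<P>)"
    by (intro nn_integral_cong) (simp add: centred_def abs_mult)
  also have "\<dots> = (\<integral>\<^sup>+v. ennreal (exp (t * v)) * (\<integral>\<^sup>+x. ennreal (exp (- v) * \<bar>trunc.\<eta> v x\<bar>) \<partial>\<Lambda>) \<partial>conv_power (step_law t a) n)"
    by (rule many_to_one_marked[where G="\<lambda>v x. ennreal (exp (- v) * \<bar>trunc.\<eta> v x\<bar>)"]) measurable
  also have "\<dots> \<le> (\<integral>\<^sup>+v. ennreal (exp ((t - 1) * v)) * (2 * ennreal (\<integral>x. \<bar>x\<bar> \<partial>\<Lambda>)) \<partial>conv_power (step_law t a) n)"
  proof (rule nn_integral_mono)
    fix v
    have "ennreal (exp (t * v)) * (\<integral>\<^sup>+x. ennreal (exp (- v) * \<bar>trunc.\<eta> v x\<bar>) \<partial>\<Lambda>) =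
      ennreal (exp (t * v)) * (ennreal (exp (- v)) * (\<integral>\<^sup>+x. ennreal \<bar>trunc.\<eta> v x\<bar> \<partial>\<Lambda>))"
      by (subst nn_integral_cmult[symmetric]) (auto simp: ennreal_mult)
    also have "\<dots> = ennreal (exp ((t - 1) * v)) * (\<integral>\<^sup>+x. ennreal \<bar>trunc.\<eta> v x\<bar> \<partial>\<Lambda>)"
      by (simp add: mult.assoc[symmetric] ennreal_mult[symmetric] exp_add[symmetric] algebra_simps)
    also have "\<dots> \<le> ennreal (exp ((t - 1) * v)) * (2 * ennreal (\<integral>x. \<bar>x\<bar> \<partial>\<Lambda>))"
      by (intro mult_left_mono trunc.nn_integral_\<eta>_le) simp
    finally show "ennreal (exp (t * v)) * (\<integral>\<^sup>+x. ennreal (exp (- v) * \<bar>trunc.\<eta> v x\<bar>) \<partial>\<Lambda>) \<le>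
      ennreal (exp ((t - 1) * v)) * (2 * ennreal (\<integral>x. \<bar>x\<bar> \<partial>\<Lambda>))" .
  qed
  also have "\<dots> = (\<integral>\<^sup>+v. ennreal (exp ((t - 1) * v)) \<partial>conv_power (step_law t a) n) * (2 * ennreal (\<integral>x. \<bar>x\<bar> \<partial>\<Lambda>))"
  proof -
    have [measurable_cong]: "sets (conv_power (step_law t a) n) = sets borel"
      by (rule conv_power_prob_space(2)[OF step_prob sets_step_law])
    show ?thesis by (rule nn_integral_multc) measurable
  qed
  also have "\<dots> < \<infinity>" using exp_moment_finite by (simp add: ennreal_mult_less_top)
  finally show "AE p in \<P>. (\<integral>\<^sup>+u. ennreal \<bar>centred p u\<bar> \<partial>count_space (words n)) \<noteq> \<infinity>"
    by (intro nn_integral_noteq_infinite measurable_nn_integral_words) auto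
qed

lemma AE_remainder_summable:
  "AE p in \<P>. (\<Sum>n. \<integral>\<^sup>+u. ennreal \<bar>remainder p u\<bar> \<partial>count_space (words n)) \<noteq> \<infinity>"
proof -
  have [measurable]: "(\<lambda>(v, x). trunc.\<zeta> v x) \<in> borel_measurable (borel \<Otimes>\<^sub>M borel)" by (rule trunc.measurable_\<eta>)
  have m: "(\<lambda>p. \<integral>\<^sup>+u. ennreal \<bar>remainder p u\<bar> \<partial>count_space (words n)) \<in> borel_measurable \<P>" for n
    by (rule measurable_nn_integral_words) simp
  have "(\<integral>\<^sup>+p. \<integral>\<^sup>+u. ennreal \<bar>remainder p u\<bar> \<partial>count_space (words n) \<partial>\<P>) =
    (\<integral>\<^sup>+v. ennreal (exp (t * v)) * (\<integral>\<^sup>+x. ennreal (exp (- v) * \<bar>trunc.\<zeta> v x\<bar>) \<partial>\<Lambda>) \<partial>conv_power (step_law t a) n)" for n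
  proof -
    have "(\<integral>\<^sup>+p. \<integral>\<^sup>+u. ennreal \<bar>remainder p u\<bar> \<partial>count_space (words n) \<partial>\<P>) =
      (\<integral>\<^sup>+p. \<integral>\<^sup>+u. (if live p u then ennreal (exp (- V p u) * \<bar>trunc.\<zeta> (V p u) (\<xi> (p u))\<bar>) else 0)
        \<partial>count_space (words n) \<partial>\<P>)"
      by (intro nn_integral_cong) (simp add: remainder_def abs_mult)
    also have "\<dots> = (\<integral>\<^sup>+v. ennreal (exp (t * v)) * (\<integral>\<^sup>+x. ennreal (exp (- v) * \<bar>trunc.\<zeta> v x\<bar>) \<partial>\<Lambda>) \<partial>conv_power (step_law t a) n)"
      by (rule many_to_one_marked[where G="\<lambda>v x. ennreal (exp (- v) * \<bar>trunc.\<zeta> v x\<bar>)"]) measurable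
    finally show ?thesis .
  qed
  then have "(\<integral>\<^sup>+p. (\<Sum>n. \<integral>\<^sup>+u. ennreal \<bar>remainder p u\<bar> \<partial>count_space (words n)) \<partial>\<P>) < \<infinity>"
    using trunc.renewal_truncated_moments(1)[OF step_prob sets_step_law step_int step_mean moment_\<Lambda> t]
    by (subst nn_integral_suminf[OF m]) simp
  then show ?thesis
    by (intro nn_integral_noteq_infinite borel_measurable_suminf_order m) auto
qed

section \<open>Second moments and orthogonality of the centred sums\<close>

definition variance_bound :: "nat \<Rightarrow> ennreal" where
  "variance_bound n = (\<integral>\<^sup>+u. \<integral>\<^sup>+p. ennreal ((centred p u)\<^sup>2) \<partial>\<P> \<partial>count_space (words n))"

lemma suminf_variance_bound: "(\<Sum>n. variance_bound n) < \<infinity>"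
proof -
  have [measurable]: "(\<lambda>(v, x). trunc.\<eta> v x) \<in> borel_measurable (borel \<Otimes>\<^sub>M borel)" by (rule trunc.measurable_\<eta>)
  have "variance_bound n =
    (\<integral>\<^sup>+v. ennreal (exp (t * v)) * (\<integral>\<^sup>+x. ennreal ((exp (- v) * trunc.\<eta> v x)\<^sup>2) \<partial>\<Lambda>) \<partial>conv_power (step_law t a) n)" for n
  proof -
    have "variance_bound n = (\<integral>\<^sup>+p. \<integral>\<^sup>+u. ennreal ((centred p u)\<^sup>2) \<partial>count_space (words n) \<partial>\<P>)"
      unfolding variance_bound_def by (rule nn_integral_words_swap[symmetric]) measurable
    also have "\<dots> = (\<integral>\<^sup>+p. \<integral>\<^sup>+u. (if live p u then ennreal ((exp (- V p u) * trunc.\<eta> (V p u) (\<xi> (p u)))\<^sup>2) else 0)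
        \<partial>count_space (words n) \<partial>\<P>)"
      by (intro nn_integral_cong) (simp add: centred_def)
    also have "\<dots> = (\<integral>\<^sup>+v. ennreal (exp (t * v)) * (\<integral>\<^sup>+x. ennreal ((exp (- v) * trunc.\<eta> v x)\<^sup>2) \<partial>\<Lambda>) \<partial>conv_power (step_law t a) n)"
      by (rule many_to_one_marked[where G="\<lambda>v x. ennreal ((exp (- v) * trunc.\<eta> v x)\<^sup>2)"]) measurable
    finally show ?thesis .
  qed
  then show ?thesis
    using trunc.renewal_truncated_moments(2)[OF step_prob sets_step_law step_int step_mean moment_\<Lambda> t] by simp
qed

text \<open>
  The sums over a generation are infinite, so that the orthogonality argument is applied to the
  finitely many individuals with code below \<open>L\<close>.
\<close>

definition early_words :: "nat \<Rightarrow> nat \<Rightarrow> nat list set" where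
  "early_words L n = {u \<in> words n. to_nat u < L}"

lemma finite_early_words [simp]: "finite (early_words L n)"
proof (rule finite_subset)
  show "early_words L n \<subseteq> to_nat -` {..<L}" by (auto simp: early_words_def)
  show "finite (to_nat -` {..<L} :: nat list set)" by (rule finite_vimageI) simp_all
qed

lemma length_early_words: "u \<in> early_words L n \<Longrightarrow> length u = n" by (simp add: early_words_def)

definition partial_sum :: "nat \<Rightarrow> nat \<Rightarrow> (nat list \<Rightarrow> enat \<times> (nat \<Rightarrow> real)) \<Rightarrow> real" where
  "partial_sum L n p = (\<Sum>u\<in>early_words L n. centred p u)"

text \<open>Redrawing the family of \<open>u\<close> alone leaves \<open>Z\<close> and the existence
  and position of \<open>u\<close> unchanged, while \<eta> has mean 0 under the law of
  \<xi>.\<close>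

lemma integral_centred_mult:
  assumes Z [measurable]: "Z \<in> borel_measurable \<P>" and b: "\<And>p. \<bar>Z p\<bar> \<le> B"
    and indep: "\<And>p e. Z (p(u := e)) = Z p"
  shows "integrable \<P> (\<lambda>p. centred p u * Z p)" "(\<integral>p. centred p u * Z p \<partial>\<P>) = 0"
proof -
  show i: "integrable \<P> (\<lambda>p. centred p u * Z p)"
  proof (rule \<P>.integrable_const_bound[where B="2 * B"])
    show "AE p in \<P>. norm (centred p u * Z p) \<le> 2 * B"
      using mult_mono[OF abs_centred_le b] by (auto simp: abs_mult)
  qed measurable
  show "(\<integral>p. centred p u * Z p \<partial>\<P>) = 0"
  proof (rule integral_resample_zero[OF i, of u])
    fix p
    have m: "trunc.\<eta> (V p u) \<in> borel_measurable borel"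
      unfolding trunc.\<eta>_def[abs_def] trunc.small_def[abs_def] by measurable
    have "(\<integral>e. trunc.\<eta> (V p u) (\<xi> e) \<partial>\<nu> u) = 0"
      using integral_distr[OF measurable_\<xi>_\<nu> m, of u] by (simp add: distr_\<xi> trunc.integral_\<eta>)
    then show "(\<integral>e. centred (p(u := e)) u * Z (p(u := e)) \<partial>\<nu> u) = 0"
      by (cases "live p u") (simp_all add: centred_def indep)
  qed
qed

text \<open>A function of the sums over earlier generations does not see the family of an individual
  \<open>u\<close> of generation \<open>j\<close>, so \<open>integral_centred_mult\<close> applies
  to each term of the sum.\<close>

lemma orthogonal_partial_sum: "orthogonal_increments \<P> (partial_sum L)"
  unfolding orthogonal_increments_def
proof (intro conjI allI impI)
  show "partial_sum L i \<in> borel_measurable \<P>" for i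
    unfolding partial_sum_def[abs_def] by measurable
  show "\<exists>B. \<forall>p. \<bar>partial_sum L i p\<bar> \<le> B" for i
  proof (intro exI allI)
    fix p
    show "\<bar>partial_sum L i p\<bar> \<le> (\<Sum>u\<in>early_words L i. 2)"
      unfolding partial_sum_def by (intro order_trans[OF sum_abs] sum_mono abs_centred_le)
  qed
  fix j and Z :: "_ \<Rightarrow> real"
  assume Z: "Z \<in> borel_measurable \<P>" "\<exists>B. \<forall>p. \<bar>Z p\<bar> \<le> B"
    and dep: "\<forall>p p'. (\<forall>i<j. partial_sum L i p = partial_sum L i p') \<longrightarrow> Z p = Z p'"
  obtain B where B: "\<And>p. \<bar>Z p\<bar> \<le> B" using Z(2) by blast
  have indep: "Z (p(u := e)) = Z p" if u: "u \<in> early_words L j" for p u e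
  proof -
    have "partial_sum L i (p(u := e)) = partial_sum L i p" if "i < j" for i
      unfolding partial_sum_def
    proof (rule sum.cong[OF refl])
      fix v assume "v \<in> early_words L i"
      then show "centred (p(u := e)) v = centred p v"
        using length_early_words[of v L i] length_early_words[OF u] that by (intro centred_upd) auto
    qed
    then show ?thesis using dep by blast
  qed
  have "(\<integral>p. partial_sum L j p * Z p \<partial>\<P>) = (\<integral>p. (\<Sum>u\<in>early_words L j. centred p u * Z p) \<partial>\<P>)"
    by (simp add: partial_sum_def sum_distrib_right)
  also have "\<dots> = (\<Sum>u\<in>early_words L j. (\<integral>p. centred p u * Z p \<partial>\<P>))"
    by (intro Bochner_Integration.integral_sum integral_centred_mult(1)[OF Z(1) B indep])
  also have "\<dots> = 0"
    by (intro sum.neutral ballI integral_centred_mult(2)[OF Z(1) B indep])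
  finally show "(\<integral>p. partial_sum L j p * Z p \<partial>\<P>) = 0" .
qed

text \<open>Two different words of one generation carry different coordinates, so mixed products
  have mean 0 and the diagonal remains. Extending it to all words of length \<open>n\<close> removes
  the dependence on \<open>L\<close>.\<close>

lemma integral_partial_sum_sq: "(\<integral>p. (partial_sum L n p)\<^sup>2 \<partial>\<P>) \<le> enn2real (variance_bound n)"
proof -
  have i: "integrable \<P> (\<lambda>p. centred p u * centred p v)" for u v
  proof (rule \<P>.integrable_const_bound[where B="2 * 2"])
    show "AE p in \<P>. norm (centred p u * centred p v) \<le> 2 * 2"
      using mult_mono[OF abs_centred_le abs_centred_le] by (auto simp: abs_mult)
  qed measurable
  have orth: "(\<integral>p. centred p u * centred p v \<partial>\<P>) = 0" if "length u = length v" "u \<noteq> v" for u v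
    by (rule integral_centred_mult(2)[OF _ abs_centred_le]) (use that in \<open>auto intro: centred_upd\<close>)
  have "(\<integral>p. (partial_sum L n p)\<^sup>2 \<partial>\<P>) =
    (\<integral>p. (\<Sum>u\<in>early_words L n. \<Sum>v\<in>early_words L n. centred p u * centred p v) \<partial>\<P>)"
    by (simp add: partial_sum_def power2_eq_square sum_product)
  also have "\<dots> = (\<Sum>u\<in>early_words L n. \<Sum>v\<in>early_words L n. \<integral>p. centred p u * centred p v \<partial>\<P>)"
    by (simp add: Bochner_Integration.integral_sum i)
  also have "\<dots> = (\<Sum>u\<in>early_words L n. \<Sum>v\<in>early_words L n. if v = u then \<integral>p. (centred p u)\<^sup>2 \<partial>\<P> else 0)"
    using orth by (intro sum.cong refl) (auto simp: power2_eq_square length_early_words)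
  also have "\<dots> = (\<Sum>u\<in>early_words L n. \<integral>p. (centred p u)\<^sup>2 \<partial>\<P>)"
    by (simp add: sum.delta)
  finally have "ennreal (\<integral>p. (partial_sum L n p)\<^sup>2 \<partial>\<P>) = (\<Sum>u\<in>early_words L n. \<integral>\<^sup>+p. ennreal ((centred p u)\<^sup>2) \<partial>\<P>)"
    using i by (simp add: nn_integral_eq_integral power2_eq_square flip: sum_ennreal)
  also have "\<dots> = (\<integral>\<^sup>+u. (\<integral>\<^sup>+p. ennreal ((centred p u)\<^sup>2) \<partial>\<P>) * indicator (early_words L n) u \<partial>count_space (words n))"
    by (subst nn_integral_count_space'[of "early_words L n"]) (auto simp: length_early_words)
  also have "\<dots> \<le> variance_bound n"
    unfolding variance_bound_def by (intro nn_integral_mono) (auto split: split_indicator)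
  finally have *: "ennreal (\<integral>p. (partial_sum L n p)\<^sup>2 \<partial>\<P>) \<le> variance_bound n" .
  have "variance_bound n \<le> (\<Sum>n. variance_bound n)"
    using sum_le_suminf[of variance_bound "{n}"] by simp
  then have "variance_bound n < \<infinity>" using suminf_variance_bound by (rule le_less_trans)
  then show ?thesis using enn2real_mono[OF *] by simp
qed

lemma partial_sum_tendsto:
  assumes "(\<integral>\<^sup>+u. ennreal \<bar>centred p u\<bar> \<partial>count_space (words n)) \<noteq> \<infinity>"
  shows "(\<lambda>L. partial_sum L n p) \<longlonglongrightarrow> (\<integral>u. centred p u \<partial>count_space (words n))"
proof -
  have "(\<lambda>L. \<integral>u. centred p u * indicator (early_words L n) u \<partial>count_space (words n)) \<longlonglongrightarrow>
    (\<integral>u. centred p u \<partial>count_space (words n))"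
  proof (rule integral_dominated_convergence[where w="\<lambda>u. \<bar>centred p u\<bar>"])
    show "integrable (count_space (words n)) (\<lambda>u. \<bar>centred p u\<bar>)"
      using assms by (simp add: integrable_iff_bounded less_top)
    show "AE u in count_space (words n). (\<lambda>L. centred p u * indicator (early_words L n) u) \<longlonglongrightarrow> centred p u"
    proof (rule AE_I2)
      fix u assume u: "u \<in> space (count_space (words n))"
      have "eventually (\<lambda>L. centred p u * indicator (early_words L n) u = centred p u) sequentially"
        using eventually_gt_at_top[of "to_nat u"] by eventually_elim (use u in \<open>auto simp: early_words_def\<close>)
      then show "(\<lambda>L. centred p u * indicator (early_words L n) u) \<longlonglongrightarrow> centred p u"
        by (rule tendsto_eventually)
    qed
    show "AE u in count_space (words n). norm (centred p u * indicator (early_words L n) u) \<le> \<bar>centred p u\<bar>" for L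
      by (auto split: split_indicator)
  qed simp_all
  moreover have "(\<integral>u. centred p u * indicator (early_words L n) u \<partial>count_space (words n)) = partial_sum L n p" for L
  proof -
    have "(\<integral>u. centred p u * indicator (early_words L n) u \<partial>count_space (words n)) =
      (\<Sum>u | u \<in> words n \<and> centred p u * indicator (early_words L n) u \<noteq> 0. centred p u * indicator (early_words L n) u)"
      by (rule lebesgue_integral_count_space_finite_support)
        (rule finite_subset[OF _ finite_early_words[of L n]], auto split: split_indicator_asm)
    also have "\<dots> = (\<Sum>u\<in>early_words L n. centred p u * indicator (early_words L n) u)"
      by (rule sum.mono_neutral_left[OF finite_early_words]) (auto simp: early_words_def split: split_indicator)
    finally show ?thesis by (simp add: partial_sum_def)
  qed
  ultimately show ?thesis by simp
qed

lemma AE_summable_centred: "AE p in \<P>. summable (\<lambda>n. \<integral>u. centred p u \<partial>count_space (words n))"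
proof -
  have [measurable]: "partial_sum L n \<in> borel_measurable \<P>" for L n
    unfolding partial_sum_def[abs_def] by measurable
  have lim: "AE p in \<P>. \<forall>n. (\<lambda>L. partial_sum L n p) \<longlonglongrightarrow> (\<integral>u. centred p u \<partial>count_space (words n))"
    using AE_centred_finite by eventually_elim (auto intro: partial_sum_tendsto)
  \<comment> \<open>The limit along \<open>L\<close> stands in for the sum over the whole generation
    because its measurability is immediate; almost surely the two agree.\<close>
  have "AE p in \<P>. summable (\<lambda>n. lim (\<lambda>L. partial_sum L n p))"
  proof (rule \<P>.summable_of_orthogonal_approximations[OF orthogonal_partial_sum])
    show "(\<lambda>p. lim (\<lambda>L. partial_sum L n p)) \<in> borel_measurable \<P>" for n
      by (rule borel_measurable_lim_metric) measurable
    show "AE p in \<P>. \<forall>n. (\<lambda>L. partial_sum L n p) \<longlonglongrightarrow> lim (\<lambda>L. partial_sum L n p)"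
      using lim
    proof eventually_elim
      case (elim p)
      then have "lim (\<lambda>L. partial_sum L n p) = (\<integral>u. centred p u \<partial>count_space (words n))" for n
        by (auto intro: limI)
      with elim show ?case by simp
    qed
    show "(\<integral>p. (partial_sum L n p)\<^sup>2 \<partial>\<P>) \<le> enn2real (variance_bound n)" for L n
      by (rule integral_partial_sum_sq)
    have fin: "variance_bound n < \<infinity>" for n
      using sum_le_suminf[of variance_bound "{n}"] suminf_variance_bound by (auto intro: le_less_trans)
    then have "(\<lambda>n. ennreal (enn2real (variance_bound n))) = variance_bound" by (auto simp: fun_eq_iff)
    then show "summable (\<lambda>n. enn2real (variance_bound n))"
      using suminf_variance_bound by (intro summable_suminf_not_top) auto
  qed
  with lim show ?thesis
  proof eventually_elim
    case (elim p)
    have "lim (\<lambda>L. partial_sum L n p) = (\<integral>u. centred p u \<partial>count_space (words n))" for n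
      using elim(1) by (auto intro: limI)
    then show ?case using elim(2) by simp
  qed
qed

end

section \<open>Increments and weighted tails of the intrinsic martingale\<close>

context tilted_offspring
begin

text \<open>The martingale as a function of the configuration: adding a n to the shifted position
  restores the position.\<close>

definition total :: "nat \<Rightarrow> (nat list \<Rightarrow> enat \<times> (nat \<Rightarrow> real)) \<Rightarrow> ennreal" where
  "total n p = (\<integral>\<^sup>+u. (if live p u then ennreal (exp (- (V p u + a * real n))) else 0) \<partial>count_space (words n))"

lemma total_Suc:
  "total (Suc n) p =
    (\<integral>\<^sup>+u. (if live p u then ennreal (exp (- (V p u + a * real n))) * mass (p u) else 0) \<partial>count_space (words n))"
proof -
  have "(\<integral>\<^sup>+i. (if live p (u @ [i]) then ennreal (exp (- (V p (u @ [i]) + a * real (Suc n)))) else 0) \<partial>count_space UNIV) =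
    (if live p u then ennreal (exp (- (V p u + a * real n))) * mass (p u) else 0)" for u
  proof (cases "live p u")
    case True
    have "exp (- (V p (u @ [i]) + a * real (Suc n))) = exp (- (V p u + a * real n)) * exp (- snd (p u) i)" for i
      by (simp flip: exp_add) (simp add: algebra_simps)
    then have "(if live p (u @ [i]) then ennreal (exp (- (V p (u @ [i]) + a * real (Suc n)))) else 0) =
      ennreal (exp (- (V p u + a * real n))) * (if enat i < fst (p u) then ennreal (exp (- snd (p u) i)) else 0)" for i
      using True by (simp add: ennreal_mult)
    then show ?thesis
      unfolding nn_integral_count_space_nat mass_def child_sum_def using True
      by (simp only: ennreal_suminf_cmult if_True)
  qed simp
  then show ?thesis unfolding total_def nn_integral_words_Suc by simp
qed

text \<open>Almost surely all sums over generations converge absolutely, so the weighted increment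
  splits into the sums of \<open>centred\<close> and \<open>remainder\<close>. The first series
  converges by the maximal inequality, the second absolutely.\<close>

lemma AE_summable_increments:
  "AE p in \<P>. summable (\<lambda>n. exp (a * real n) * (enn2real (total (Suc n) p) - enn2real (total n p)))"
proof -
  have mass: "AE p in \<P>. \<forall>u. mass (p u) \<noteq> \<infinity>"
    unfolding AE_all_countable using AE_mass_finite by (intro allI AE_PiM_component prob_\<nu>) auto
  show ?thesis
    using mass AE_weights_finite AE_centred_finite AE_remainder_summable AE_summable_centred
  proof eventually_elim
    case (elim p)
    define f where "f u = (if live p u then exp (- V p u) else 0)" for u
    have f0: "0 \<le> f u" for u by (simp add: f_def)
    \<comment> \<open>\<eta> + \<zeta> = \<xi> is the mass minus 1, so adding \<open>f u\<close>
      restores the mass: the right side is what the children of \<open>u\<close> contribute to the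
      next generation, up to the factor depending on \<open>n\<close>.\<close>
    have split: "f u + (centred p u + remainder p u) = f u * enn2real (mass (p u))" for u
    proof -
      have "centred p u + remainder p u =
          f u * (trunc.\<eta> (V p u) (\<xi> (p u)) + trunc.\<zeta> (V p u) (\<xi> (p u)))"
        by (simp add: centred_def remainder_def f_def distrib_left)
      then show ?thesis unfolding trunc.\<eta>_add_\<zeta> by (simp add: \<xi>_def algebra_simps)
    qed
    have f1: "0 \<le> f u + (centred p u + remainder p u)" for u by (simp add: split f0)
    have int: "integrable (count_space (words n)) f" "integrable (count_space (words n)) (centred p)"
      "integrable (count_space (words n)) (remainder p)" for n
    proof -
      have "(\<integral>\<^sup>+u. ennreal \<bar>f u\<bar> \<partial>count_space (words n)) =
        (\<integral>\<^sup>+u. (if live p u then ennreal (exp (- V p u)) else 0) \<partial>count_space (words n))"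
        by (intro nn_integral_cong) (simp add: f_def)
      then show "integrable (count_space (words n)) f"
        using elim(2) by (simp add: integrable_iff_bounded less_top)
      show "integrable (count_space (words n)) (centred p)"
        using elim(3) by (simp add: integrable_iff_bounded less_top)
      have "(\<integral>\<^sup>+u. ennreal \<bar>remainder p u\<bar> \<partial>count_space (words n)) \<le>
          (\<Sum>n. \<integral>\<^sup>+u. ennreal \<bar>remainder p u\<bar> \<partial>count_space (words n))"
        using sum_le_suminf[of "\<lambda>n. \<integral>\<^sup>+u. ennreal \<bar>remainder p u\<bar> \<partial>count_space (words n)" "{n}"] by simp
      then show "integrable (count_space (words n)) (remainder p)"
        using elim(4) by (simp add: integrable_iff_bounded less_top[symmetric] le_less_trans) (metis le_less_trans less_top)
    qed
    have weight: "(if live p u then ennreal (exp (- (V p u + a * real n))) else 0) = ennreal (exp (- (a * real n)) * f u)" for u n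
      by (simp add: f_def exp_add[symmetric])
    have W: "total n p = ennreal (exp (- (a * real n)) * (\<integral>u. f u \<partial>count_space (words n)))" for n
    proof -
      have "total n p = (\<integral>\<^sup>+u. ennreal (exp (- (a * real n)) * f u) \<partial>count_space (words n))"
        unfolding total_def weight ..
      also have "\<dots> = ennreal (\<integral>u. exp (- (a * real n)) * f u \<partial>count_space (words n))"
        using int(1)[of n] by (intro nn_integral_eq_integral) (auto simp: f0)
      finally show ?thesis by simp
    qed
    have W_Suc: "total (Suc n) p = ennreal (exp (- (a * real n)) *
      (\<integral>u. f u + (centred p u + remainder p u) \<partial>count_space (words n)))" for n
    proof -
      have "total (Suc n) p = (\<integral>\<^sup>+u. ennreal (exp (- (a * real n)) * (f u + (centred p u + remainder p u))) \<partial>count_space (words n))"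
        unfolding total_Suc
      proof (rule nn_integral_cong)
        fix u
        have "ennreal (exp (- (a * real n)) * (f u + (centred p u + remainder p u))) =
          ennreal (exp (- (a * real n)) * f u) * ennreal (enn2real (mass (p u)))"
          unfolding split by (simp add: ennreal_mult[symmetric] f0 mult.assoc)
        also have "ennreal (enn2real (mass (p u))) = mass (p u)"
          using elim(1) by (simp add: less_top)
        finally show "(if live p u then ennreal (exp (- (V p u + a * real n))) * mass (p u) else 0) =
          ennreal (exp (- (a * real n)) * (f u + (centred p u + remainder p u)))"
          unfolding weight[symmetric] by simp
      qed
      also have "\<dots> = ennreal (\<integral>u. exp (- (a * real n)) * (f u + (centred p u + remainder p u)) \<partial>count_space (words n))"
        using int[of n] f1 by (intro nn_integral_eq_integral) auto
      finally show ?thesis by simp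
    qed
    have nonneg: "0 \<le> (\<integral>u. f u \<partial>count_space (words n))" for n
      by (rule integral_nonneg_AE) (simp add: f_def)
    have eq: "exp (a * real n) * (enn2real (total (Suc n) p) - enn2real (total n p)) =
      (\<integral>u. centred p u \<partial>count_space (words n)) + (\<integral>u. remainder p u \<partial>count_space (words n))" for n
    proof -
      have "enn2real (total (Suc n) p) = exp (- (a * real n)) *
        (\<integral>u. f u + (centred p u + remainder p u) \<partial>count_space (words n))"
        unfolding W_Suc using f0
        by (intro enn2real_ennreal mult_nonneg_nonneg integral_nonneg_AE) (auto simp: split)
      moreover have "enn2real (total n p) = exp (- (a * real n)) * (\<integral>u. f u \<partial>count_space (words n))"
        unfolding W using nonneg by simp
      moreover have "(\<integral>u. f u + (centred p u + remainder p u) \<partial>count_space (words n)) =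
        (\<integral>u. f u \<partial>count_space (words n)) + ((\<integral>u. centred p u \<partial>count_space (words n)) + (\<integral>u. remainder p u \<partial>count_space (words n)))"
        using int[of n] by simp
      ultimately have "exp (a * real n) * (enn2real (total (Suc n) p) - enn2real (total n p)) =
        (exp (a * real n) * exp (- (a * real n))) *
        ((\<integral>u. centred p u \<partial>count_space (words n)) + (\<integral>u. remainder p u \<partial>count_space (words n)))"
        by (simp only: algebra_simps)
      then show ?thesis by (simp flip: exp_add)
    qed
    have "summable (\<lambda>n. \<integral>u. remainder p u \<partial>count_space (words n))"
    proof (rule summable_rabs_cancel)
      have fin: "(\<Sum>n. ennreal \<bar>\<integral>u. remainder p u \<partial>count_space (words n)\<bar>) \<le>
          (\<Sum>n. \<integral>\<^sup>+u. ennreal \<bar>remainder p u\<bar> \<partial>count_space (words n))"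
      proof (rule suminf_le)
        fix n
        have "ennreal \<bar>\<integral>u. remainder p u \<partial>count_space (words n)\<bar> \<le> ennreal (\<integral>u. \<bar>remainder p u\<bar> \<partial>count_space (words n))"
          by (intro ennreal_leI integral_abs_bound)
        also have "\<dots> = (\<integral>\<^sup>+u. ennreal \<bar>remainder p u\<bar> \<partial>count_space (words n))"
          using int(3)[of n] by (intro nn_integral_eq_integral[symmetric]) auto
        finally show "ennreal \<bar>\<integral>u. remainder p u \<partial>count_space (words n)\<bar> \<le>
          (\<integral>\<^sup>+u. ennreal \<bar>remainder p u\<bar> \<partial>count_space (words n))" .
      qed auto
      show "summable (\<lambda>n. \<bar>\<integral>u. remainder p u \<partial>count_space (words n)\<bar>)"
      proof (rule summable_suminf_not_top)
        show "(\<Sum>n. ennreal \<bar>\<integral>u. remainder p u \<partial>count_space (words n)\<bar>) \<noteq> top"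
          using fin elim(4) unfolding infinity_ennreal_def by (metis top_unique)
      qed simp
    qed
    with elim(5) show ?case unfolding eq by (intro summable_add)
  qed
qed

lemma AE_summable_tail:
  "AE p in \<P>. summable (\<lambda>n. exp (a * real n) * (lim (\<lambda>n. enn2real (total n p)) - enn2real (total n p)))"
  using AE_summable_increments
proof eventually_elim
  case (elim p)
  then show ?case by (rule summable_weighted_tail[OF a, of "\<lambda>n. enn2real (total n p)"])
qed

end

section \<open>The sign of the drift\<close>

lemma le_exp: "x \<le> exp x" for x :: real
  using exp_ge_add_one_self[of x] by linarith

definition laplace :: "real measure \<Rightarrow> real \<Rightarrow> ennreal" where
  "laplace \<rho> \<theta> = (\<integral>\<^sup>+y. ennreal (exp (- \<theta> * y)) \<partial>\<rho>)"

lemma laplace_finiteD: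
  assumes [measurable_cong]: "sets \<rho> = sets borel" and fin: "laplace \<rho> \<theta> < \<infinity>"
  shows "integrable \<rho> (\<lambda>y. exp (- \<theta> * y))" "laplace \<rho> \<theta> = ennreal (\<integral>y. exp (- \<theta> * y) \<partial>\<rho>)"
proof -
  show "integrable \<rho> (\<lambda>y. exp (- \<theta> * y))"
    using fin by (intro integrableI_nonneg) (auto simp: laplace_def)
  then show "laplace \<rho> \<theta> = ennreal (\<integral>y. exp (- \<theta> * y) \<partial>\<rho>)"
    unfolding laplace_def by (intro nn_integral_eq_integral) auto
qed

text \<open>The sign of \<open>y\<close> decides which end point dominates. The bound serves both
  for finiteness between two exponents and as a majorant for continuity.\<close>

lemma exp_le_endpoints:
  fixes s \<theta> r y :: real
  assumes "s \<le> \<theta>" "\<theta> \<le> r"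
  shows "exp (- \<theta> * y) \<le> exp (- s * y) + exp (- r * y)"
proof (cases "y \<ge> 0")
  case True
  then have "exp (- \<theta> * y) \<le> exp (- s * y)" using assms by (simp add: mult_right_mono)
  then show ?thesis using exp_ge_zero[of "- r * y"] by linarith
next
  case False
  then have "exp (- \<theta> * y) \<le> exp (- r * y)" using assms by (simp add: mult_right_mono_neg)
  then show ?thesis using exp_ge_zero[of "- s * y"] by linarith
qed

lemma laplace_finite_between:
  assumes [measurable_cong]: "sets \<rho> = sets borel"
    and fin: "laplace \<rho> s < \<infinity>" "laplace \<rho> r < \<infinity>" and \<theta>: "s \<le> \<theta>" "\<theta> \<le> r"
  shows "laplace \<rho> \<theta> < \<infinity>"
proof -
  have "laplace \<rho> \<theta> \<le> (\<integral>\<^sup>+y. ennreal (exp (- s * y)) + ennreal (exp (- r * y)) \<partial>\<rho>)"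
    unfolding laplace_def using exp_le_endpoints[OF \<theta>]
    by (intro nn_integral_mono) (simp flip: ennreal_plus)
  also have "\<dots> = laplace \<rho> s + laplace \<rho> r" unfolding laplace_def by (rule nn_integral_add) measurable
  finally show ?thesis using fin by (simp add: le_less_trans)
qed

lemma laplace_continuous_on:
  assumes m [measurable_cong]: "sets \<rho> = sets borel"
    and fin: "laplace \<rho> s < \<infinity>" "laplace \<rho> r < \<infinity>"
  shows "continuous_on {s..r} (\<lambda>\<theta>. \<integral>y. exp (- \<theta> * y) \<partial>\<rho>)"
  unfolding continuous_on_sequentially
proof (intro allI ballI impI, elim conjE)
  fix x \<theta> assume x: "\<forall>n. x n \<in> {s..r}" and lim: "x \<longlonglongrightarrow> \<theta>"
  show "((\<lambda>\<theta>. \<integral>y. exp (- \<theta> * y) \<partial>\<rho>) \<circ> x) \<longlonglongrightarrow> (\<integral>y. exp (- \<theta> * y) \<partial>\<rho>)"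
    unfolding comp_def
  proof (rule integral_dominated_convergence[where w="\<lambda>y. exp (- s * y) + exp (- r * y)"])
    show "integrable \<rho> (\<lambda>y. exp (- s * y) + exp (- r * y))"
      using laplace_finiteD(1)[OF m] fin by (intro Bochner_Integration.integrable_add) auto
    show "AE y in \<rho>. (\<lambda>n. exp (- x n * y)) \<longlonglongrightarrow> exp (- \<theta> * y)"
      using lim by (intro AE_I2 tendsto_intros)
    show "AE y in \<rho>. norm (exp (- x n * y)) \<le> exp (- s * y) + exp (- r * y)" for n
      using exp_le_endpoints x by (intro AE_I2) auto
  qed measurable
qed

text \<open>The intermediate value theorem gives a root up to \<open>r\<close>, and the roots in
  [1, r] form a compact set, so a least one is attained; it is not 1, where the value exceeds 1.
  Attainment is what gives the \<open>LEAST\<close> in \<open>vartheta\<close> its meaning.\<close>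

lemma laplace_root:
  assumes m: "sets \<rho> = sets borel"
    and 1: "1 < laplace \<rho> 1" "laplace \<rho> 1 < \<infinity>" and r: "1 \<le> r" "laplace \<rho> r \<le> 1"
  shows "\<exists>x. 1 < x \<and> x \<le> r \<and> laplace \<rho> x = 1 \<and> (\<forall>y. 1 < y \<longrightarrow> laplace \<rho> y = 1 \<longrightarrow> x \<le> y)"
proof -
  define \<phi> where "\<phi> \<theta> = (\<integral>y. exp (- \<theta> * y) \<partial>\<rho>)" for \<theta>
  have rfin: "laplace \<rho> r < \<infinity>" using r(2) by (rule le_less_trans) simp
  have eq: "laplace \<rho> \<theta> = ennreal (\<phi> \<theta>)" if "\<theta> \<in> {1..r}" for \<theta>
    unfolding \<phi>_def using that laplace_finite_between[OF m 1(2) rfin] by (intro laplace_finiteD(2)[OF m]) auto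
  have cont: "continuous_on {1..r} \<phi>"
    unfolding \<phi>_def[abs_def] by (rule laplace_continuous_on[OF m 1(2) rfin])
  have \<phi>1: "\<phi> 1 > 1"
  proof (rule ccontr)
    assume "\<not> \<phi> 1 > 1"
    then have "ennreal (\<phi> 1) \<le> ennreal 1" by (intro ennreal_leI) simp
    with 1(1) eq[of 1] r(1) show False by simp
  qed
  have \<phi>r: "\<phi> r \<le> 1" using r eq[of r] by simp
  define S where "S = {\<theta> \<in> {1..r}. \<phi> \<theta> = 1}"
  have "\<exists>x\<ge>1. x \<le> r \<and> \<phi> x = 1" using IVT2'[OF \<phi>r _ r(1) cont] \<phi>1 by auto
  then have "S \<noteq> {}" by (auto simp: S_def)
  moreover have "compact S"
  proof -
    have "closed S" unfolding S_def
      using continuous_closed_preimage[OF cont closed_atLeastAtMost closed_singleton[of 1]]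
      by (simp add: vimage_def Int_def)
    moreover have "bounded S" by (rule bounded_subset[of "{1..r}"]) (auto simp: S_def)
    ultimately show ?thesis by (simp add: compact_eq_bounded_closed)
  qed
  ultimately obtain x where x: "x \<in> S" "\<And>y. y \<in> S \<Longrightarrow> x \<le> y"
    using compact_attains_inf by metis
  have x1: "1 < x" using x(1) \<phi>1 by (cases "x = 1") (auto simp: S_def)
  have "x \<le> y" if y: "1 < y" "laplace \<rho> y = 1" for y
  proof (cases "y \<le> r")
    case True
    then have "ennreal (\<phi> y) = ennreal 1" using y eq[of y] by simp
    moreover have "0 \<le> \<phi> y" unfolding \<phi>_def by (rule integral_nonneg_AE) simp
    ultimately have "y \<in> S" using y True by (simp add: S_def)
    then show ?thesis by (rule x(2))
  next
    case False
    then show ?thesis using x(1) by (auto simp: S_def)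
  qed
  then show ?thesis using x(1) x1 eq[of x] by (intro exI[of _ x]) (auto simp: S_def)
qed

text \<open>Integrating 1 - e y <= exp(- e y) bounds 1 minus e times the mean by
  \<open>laplace Q e\<close>, which is below 1. The exponential moments on the two sides dominate
  |y|.\<close>

lemma mean_pos_of_laplace_less_one:
  assumes "prob_space Q" and m [measurable_cong]: "sets Q = sets borel"
    and d: "d > 0" "laplace Q (- d) < \<infinity>" and e: "e > 0" "laplace Q e < 1"
  shows "integrable Q (\<lambda>y. y) \<and> (\<integral>y. y \<partial>Q) > 0"
proof -
  interpret prob_space Q by fact
  have efin: "laplace Q e < \<infinity>" using e(2) by (rule less_trans) simp
  note i1 = laplace_finiteD(1)[OF m d(2)] and i2 = laplace_finiteD[OF m efin]
  have int: "integrable Q (\<lambda>y. y)"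
  proof (rule Bochner_Integration.integrable_bound)
    show "integrable Q (\<lambda>y. exp (- (- d) * y) / d + exp (- e * y) / e)"
      using i1 i2(1) by (intro Bochner_Integration.integrable_add integrable_divide_zero) auto
    show "AE y in Q. norm y \<le> norm (exp (- (- d) * y) / d + exp (- e * y) / e)"
    proof (rule AE_I2)
      fix y
      have "d * y \<le> exp (- (- d) * y)" "- e * y \<le> exp (- e * y)"
        using le_exp[of "d * y"] le_exp[of "- e * y"] by simp_all
      then have "y \<le> exp (- (- d) * y) / d" "- y \<le> exp (- e * y) / e"
        using d e by (simp_all add: field_simps)
      moreover have "0 \<le> exp (- (- d) * y) / d" "0 \<le> exp (- e * y) / e" using d e by simp_all
      ultimately show "norm y \<le> norm (exp (- (- d) * y) / d + exp (- e * y) / e)"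
        unfolding real_norm_def by linarith
    qed
  qed measurable
  have "(\<integral>y. 1 - e * y \<partial>Q) \<le> (\<integral>y. exp (- e * y) \<partial>Q)"
  proof (intro integral_mono)
    show "1 - e * y \<le> exp (- e * y)" for y
      using exp_ge_add_one_self[of "- e * y"] by linarith
  qed (use int i2(1) in simp_all)
  moreover have "(\<integral>y. exp (- e * y) \<partial>Q) < 1"
    using e(2) unfolding i2(2) by simp
  ultimately have "1 - e * (\<integral>y. y \<partial>Q) < 1" using int by (simp add: prob_space)
  then show ?thesis using int e(1) by (simp add: zero_less_mult_iff)
qed

lemma abs_exp_minus_one_le:
  fixes x :: real
  shows "\<bar>exp x - 1\<bar> \<le> \<bar>x\<bar> * exp (max x 0)"
proof (cases "x \<ge> 0")
  case True
  have "(1 + - x) * exp x \<le> exp (- x) * exp x"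
    by (intro mult_right_mono exp_ge_add_one_self) simp
  then have "exp x - 1 \<le> x * exp x" by (simp add: algebra_simps flip: exp_add)
  then show ?thesis using True by simp
next
  case False
  have "1 - exp x \<le> - x" using exp_ge_add_one_self[of x] by linarith
  with False show ?thesis by simp
qed

text \<open>Majorants uniform in \<delta>. Keeping \<delta> at most d / 2 leaves half of the
  exponent to absorb the linear factor, by \<open>y \<le> 2 / d * exp (d / 2 * y)\<close>.\<close>

lemma difference_quotient_bound:
  fixes d \<delta> y :: real
  assumes "0 < \<delta>" "\<delta> \<le> d / 2"
  shows "\<bar>(exp (\<delta> * y) - 1) / \<delta>\<bar> \<le> \<bar>min y 0\<bar> + 2 / d * exp (d * y)"
    and "y \<ge> 0 \<Longrightarrow> (exp (\<delta> * y) - 1) / \<delta> \<le> 2 / d * exp (d * y)"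
proof -
  have d: "d > 0" using assms by simp
  have "\<bar>(exp (\<delta> * y) - 1) / \<delta>\<bar> = \<bar>exp (\<delta> * y) - 1\<bar> / \<delta>" using assms by simp
  also have "\<dots> \<le> (\<bar>\<delta> * y\<bar> * exp (max (\<delta> * y) 0)) / \<delta>"
    using assms by (intro divide_right_mono abs_exp_minus_one_le) simp
  also have "\<dots> = \<bar>y\<bar> * exp (max (\<delta> * y) 0)" using assms by (simp add: abs_mult)
  finally have 1: "\<bar>(exp (\<delta> * y) - 1) / \<delta>\<bar> \<le> \<bar>y\<bar> * exp (max (\<delta> * y) 0)" .
  have pos: "\<bar>(exp (\<delta> * y) - 1) / \<delta>\<bar> \<le> 2 / d * exp (d * y)" if y: "y \<ge> 0"
  proof -
    have "d / 2 * y \<le> exp (d / 2 * y)" by (rule le_exp)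
    then have "y \<le> 2 / d * exp (d / 2 * y)" using d by (simp add: field_simps)
    then have "y * exp (\<delta> * y) \<le> (2 / d * exp (d / 2 * y)) * exp (d / 2 * y)"
    proof (intro mult_mono)
      show "exp (\<delta> * y) \<le> exp (d / 2 * y)" using mult_right_mono[OF assms(2) y] by simp
    qed (use d in simp_all)
    also have "\<dots> = 2 / d * exp (d * y)" by (simp add: mult.assoc flip: exp_add)
    finally show ?thesis using 1 y assms by simp
  qed
  show "y \<ge> 0 \<Longrightarrow> (exp (\<delta> * y) - 1) / \<delta> \<le> 2 / d * exp (d * y)" using pos by linarith
  show "\<bar>(exp (\<delta> * y) - 1) / \<delta>\<bar> \<le> \<bar>min y 0\<bar> + 2 / d * exp (d * y)"
  proof (cases "y \<ge> 0")
    case True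
    then show ?thesis using pos by simp
  next
    case False
    then have "max (\<delta> * y) 0 = 0" using assms by (simp add: mult_le_0_iff max_def)
    then have "\<bar>(exp (\<delta> * y) - 1) / \<delta>\<bar> \<le> \<bar>min y 0\<bar>" using 1 False by simp
    also have "\<dots> \<le> \<bar>min y 0\<bar> + 2 / d * exp (d * y)" using d by simp
    finally show ?thesis .
  qed
qed

lemma difference_quotient_tendsto:
  fixes y :: real
  assumes "\<delta> \<longlonglongrightarrow> 0" "\<And>n. \<delta> n \<noteq> (0 :: real)"
  shows "(\<lambda>n. (exp (\<delta> n * y) - 1) / \<delta> n) \<longlonglongrightarrow> y"
proof -
  have "((\<lambda>x. exp (x * y)) has_real_derivative y) (at 0)"
    by (auto intro!: derivative_eq_intros)
  then have "((\<lambda>x. (exp (x * y) - 1) / x) \<longlongrightarrow> y) (at 0)"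
    by (simp add: has_field_derivative_iff)
  moreover have "filterlim \<delta> (at 0) sequentially"
    using assms by (auto simp: filterlim_at)
  ultimately show ?thesis by (rule filterlim_compose)
qed

text \<open>The negative part is controlled by Fatou's lemma, since the full difference quotients have
  nonnegative integral and their positive parts are bounded.\<close>

lemma laplace_left_derivative:
  assumes "prob_space Q" and m [measurable_cong]: "sets Q = sets borel"
    and d: "d > 0" "laplace Q (- d) < \<infinity>"
    and ge: "\<And>\<delta>. 0 < \<delta> \<Longrightarrow> \<delta> \<le> d \<Longrightarrow> 1 \<le> laplace Q (- \<delta>)"
  shows "integrable Q (\<lambda>y. y)"
    and "((\<lambda>\<theta>. enn2real (laplace Q \<theta>)) has_real_derivative - (\<integral>y. y \<partial>Q)) (at_left 0)"
proof -
  interpret prob_space Q by fact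
  have i1: "integrable Q (\<lambda>y. exp (d * y))" using laplace_finiteD(1)[OF m d(2)] by simp
  have L0: "laplace Q 0 = 1" by (simp add: laplace_def emeasure_space_1)
  have fin: "laplace Q (- \<delta>) < \<infinity>" if "0 \<le> \<delta>" "\<delta> \<le> d" for \<delta>
    by (rule laplace_finite_between[OF m d(2), of 0]) (use that L0 in auto)
  have i\<delta>: "integrable Q (\<lambda>y. exp (\<delta> * y))" if "0 \<le> \<delta>" "\<delta> \<le> d" for \<delta>
    using laplace_finiteD(1)[OF m fin[OF that]] by simp
  have L\<delta>: "laplace Q (- \<delta>) = ennreal (\<integral>y. exp (\<delta> * y) \<partial>Q)" if "0 \<le> \<delta>" "\<delta> \<le> d" for \<delta>
    using laplace_finiteD(2)[OF m fin[OF that]] by simp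
  have neg: "(\<integral>\<^sup>+y. ennreal (max 0 ((1 - exp (\<delta> * y)) / \<delta>)) \<partial>Q) \<le> ennreal (\<integral>y. 2 / d * exp (d * y) \<partial>Q)"
    if \<delta>: "0 < \<delta>" "\<delta> \<le> d / 2" for \<delta>
  proof -
    have \<delta>': "0 \<le> \<delta>" "\<delta> \<le> d" using \<delta> d by auto
    have "1 \<le> (\<integral>y. exp (\<delta> * y) \<partial>Q)"
      using ge[of \<delta>] \<delta> \<delta>' L\<delta>[OF \<delta>'] by simp
    then have a: "(\<integral>y. (1 - exp (\<delta> * y)) / \<delta> \<partial>Q) \<le> 0"
      using i\<delta>[OF \<delta>'] \<delta> by (simp add: prob_space divide_le_0_iff)
    have i: "integrable Q (\<lambda>y. (1 - exp (\<delta> * y)) / \<delta>)" using i\<delta>[OF \<delta>'] by auto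
    have imax: "integrable Q (\<lambda>y. max 0 ((1 - exp (\<delta> * y)) / \<delta>))"
      using i by (intro integrable_max) auto
    have pw: "max 0 ((1 - exp (\<delta> * y)) / \<delta>) \<le> (1 - exp (\<delta> * y)) / \<delta> + 2 / d * exp (d * y)" for y
    proof (cases "y \<ge> 0")
      case True
      then have "(1 - exp (\<delta> * y)) / \<delta> \<le> 0" using \<delta> by (simp add: divide_le_0_iff)
      moreover have "(1 - exp (\<delta> * y)) / \<delta> = - ((exp (\<delta> * y) - 1) / \<delta>)" by (simp add: minus_divide_left)
      ultimately show ?thesis using difference_quotient_bound(2)[OF \<delta> True] by linarith
    next
      case False
      then have "0 \<le> (1 - exp (\<delta> * y)) / \<delta>" using \<delta> by (simp add: mult_le_0_iff)
      moreover have "0 \<le> 2 / d * exp (d * y)" using d by simp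
      ultimately show ?thesis by linarith
    qed
    have "(\<integral>\<^sup>+y. ennreal (max 0 ((1 - exp (\<delta> * y)) / \<delta>)) \<partial>Q) = ennreal (\<integral>y. max 0 ((1 - exp (\<delta> * y)) / \<delta>) \<partial>Q)"
      using imax by (intro nn_integral_eq_integral) auto
    also have "\<dots> \<le> ennreal (\<integral>y. (1 - exp (\<delta> * y)) / \<delta> + 2 / d * exp (d * y) \<partial>Q)"
      using imax i i1 pw by (intro ennreal_leI integral_mono) auto
    also have "\<dots> \<le> ennreal (\<integral>y. 2 / d * exp (d * y) \<partial>Q)"
      using a i i1 by (intro ennreal_leI) simp
    finally show ?thesis .
  qed
  define \<delta> where "\<delta> n = d / 2 * inverse (real (Suc n))" for n
  have \<delta>: "0 < \<delta> n" "\<delta> n \<le> d / 2" for n using d by (auto simp: \<delta>_def field_simps)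
  have \<delta>0: "\<delta> \<longlonglongrightarrow> 0" unfolding \<delta>_def
    using tendsto_mult[OF tendsto_const[of "d / 2"] LIMSEQ_inverse_real_of_nat] by simp
  have "(\<integral>\<^sup>+y. ennreal (max 0 (- y)) \<partial>Q) = (\<integral>\<^sup>+y. liminf (\<lambda>n. ennreal (max 0 ((1 - exp (\<delta> n * y)) / \<delta> n))) \<partial>Q)"
  proof (rule nn_integral_cong)
    fix y
    have "(\<lambda>n. - ((exp (\<delta> n * y) - 1) / \<delta> n)) \<longlonglongrightarrow> - y"
      by (intro tendsto_minus difference_quotient_tendsto \<delta>0) (use \<delta> in \<open>auto simp: less_imp_neq[symmetric]\<close>)
    then have "(\<lambda>n. ennreal (max 0 ((1 - exp (\<delta> n * y)) / \<delta> n))) \<longlonglongrightarrow> ennreal (max 0 (- y))"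
      by (intro tendsto_ennrealI tendsto_max tendsto_const) (simp add: minus_divide_left)
    then show "ennreal (max 0 (- y)) = liminf (\<lambda>n. ennreal (max 0 ((1 - exp (\<delta> n * y)) / \<delta> n)))"
      by (intro lim_imp_Liminf[symmetric]) auto
  qed
  also have "\<dots> \<le> liminf (\<lambda>n. \<integral>\<^sup>+y. ennreal (max 0 ((1 - exp (\<delta> n * y)) / \<delta> n)) \<partial>Q)"
    by (rule nn_integral_liminf) measurable
  also have "\<dots> \<le> ennreal (\<integral>y. 2 / d * exp (d * y) \<partial>Q)"
    using neg[OF \<delta>] by (intro Liminf_le) auto
  finally have "(\<integral>\<^sup>+y. ennreal (max 0 (- y)) \<partial>Q) < \<infinity>" by (rule le_less_trans) simp
  then have ineg: "integrable Q (\<lambda>y. max 0 (- y))" by (intro integrableI_nonneg) auto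
  have absle: "\<bar>y\<bar> \<le> max 0 (- y) + 2 / d * exp (d * y)" for y
  proof (cases "y \<ge> 0")
    case True
    have "d * y \<le> exp (d * y)" by (rule le_exp)
    then have "y \<le> exp (d * y) / d" using d by (simp add: field_simps)
    also have "\<dots> \<le> 2 / d * exp (d * y)" using d by (simp add: field_simps)
    finally show ?thesis using True by simp
  qed (use d in simp)
  show int: "integrable Q (\<lambda>y. y)"
  proof (rule Bochner_Integration.integrable_bound)
    show "integrable Q (\<lambda>y. max 0 (- y) + 2 / d * exp (d * y))" using ineg i1 by auto
    show "AE y in Q. norm y \<le> norm (max 0 (- y) + 2 / d * exp (d * y))"
      using absle by (intro AE_I2) (simp add: order_trans[OF _ abs_ge_self])
  qed measurable
  show "((\<lambda>\<theta>. enn2real (laplace Q \<theta>)) has_real_derivative - (\<integral>y. y \<partial>Q)) (at_left 0)"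
    unfolding has_field_derivative_iff
  proof (rule tendsto_at_left_sequentially[of "- d / 2"])
    show "- d / 2 < 0" using d by simp
    fix S assume S: "\<And>n. S n < 0" "\<And>n. - d / 2 < S n" "S \<longlonglongrightarrow> (0 :: real)"
    define e where "e n = - S n" for n
    have e: "0 < e n" "e n \<le> d / 2" "e n \<le> d" for n using S(1,2)[of n] d by (auto simp: e_def)
    have e0: "e \<longlonglongrightarrow> 0" unfolding e_def[abs_def] using tendsto_minus[OF S(3)] by simp
    \<comment> \<open>Now that the mean is known to be finite,
      \<open>difference_quotient_bound\<close> gives an integrable majorant for the full
      quotients.\<close>
    have "(\<lambda>n. \<integral>y. (exp (e n * y) - 1) / e n \<partial>Q) \<longlonglongrightarrow> (\<integral>y. y \<partial>Q)"
    proof (rule integral_dominated_convergence[where w="\<lambda>y. \<bar>min y 0\<bar> + 2 / d * exp (d * y)"])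
      show "integrable Q (\<lambda>y. \<bar>min y 0\<bar> + 2 / d * exp (d * y))"
        using i1 int by (intro Bochner_Integration.integrable_add integrable_abs integrable_min) auto
      show "AE y in Q. (\<lambda>n. (exp (e n * y) - 1) / e n) \<longlonglongrightarrow> y"
        by (intro AE_I2 difference_quotient_tendsto e0) (use e in \<open>auto simp: less_imp_neq[symmetric]\<close>)
      show "AE y in Q. norm ((exp (e n * y) - 1) / e n) \<le> \<bar>min y 0\<bar> + 2 / d * exp (d * y)" for n
        using difference_quotient_bound(1)[OF e(1,2)] by (intro AE_I2) simp
    qed measurable
    then have "(\<lambda>n. - (\<integral>y. (exp (e n * y) - 1) / e n \<partial>Q)) \<longlonglongrightarrow> - (\<integral>y. y \<partial>Q)" by (rule tendsto_minus)
    moreover have "- (\<integral>y. (exp (e n * y) - 1) / e n \<partial>Q) =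
      (enn2real (laplace Q (S n)) - enn2real (laplace Q 0)) / (S n - 0)" for n
    proof -
      have "0 \<le> (\<integral>y. exp (e n * y) \<partial>Q)" by (rule integral_nonneg_AE) simp
      then have "enn2real (laplace Q (S n)) = (\<integral>y. exp (e n * y) \<partial>Q)"
        using L\<delta>[of "e n"] e[of n] by (simp add: e_def)
      then show ?thesis
        using i\<delta>[of "e n"] e[of n] S(1)[of n] by (simp add: L0 prob_space e_def)
    qed
    ultimately show "(\<lambda>n. (enn2real (laplace Q (S n)) - enn2real (laplace Q 0)) / (S n - 0)) \<longlonglongrightarrow> - (\<integral>y. y \<partial>Q)"
      by simp
  qed
qed

text \<open>Strict convexity through a perfect square: the integral of \<open>h\<close> is 1 + 1
  minus twice the value at the midpoint, hence at most 0. If s and r differ, all mass then sits at 0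
  and the transform is constant, contrary to the value at \<open>q\<close>. In the boundary case
  this makes the minimiser \<open>vartheta0\<close> unique.\<close>

lemma laplace_eq_one_unique:
  assumes m [measurable_cong]: "sets \<rho> = sets borel"
    and s: "laplace \<rho> s = 1" and r: "laplace \<rho> r = 1"
    and mid: "1 \<le> laplace \<rho> ((s + r) / 2)" and q: "laplace \<rho> q \<noteq> 1"
  shows "s = r"
proof (rule ccontr)
  assume ne: "s \<noteq> r"
  have fin: "laplace \<rho> s < \<infinity>" "laplace \<rho> r < \<infinity>" using s r by auto
  have midfin: "laplace \<rho> ((s + r) / 2) < \<infinity>"
  proof (cases "s \<le> r")
    case True
    then show ?thesis by (intro laplace_finite_between[OF m fin]) auto
  next
    case False
    then show ?thesis by (intro laplace_finite_between[OF m fin(2) fin(1)]) auto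
  qed
  note S = laplace_finiteD[OF m fin(1)] and R = laplace_finiteD[OF m fin(2)] and C = laplace_finiteD[OF m midfin]
  have int1: "(\<integral>y. exp (- s * y) \<partial>\<rho>) = 1" "(\<integral>y. exp (- r * y) \<partial>\<rho>) = 1"
    using s r unfolding S(2) R(2) by simp_all
  have int2: "1 \<le> (\<integral>y. exp (- ((s + r) / 2) * y) \<partial>\<rho>)"
    using mid unfolding C(2) by simp
  define h where "h y = (exp (- s * y / 2) - exp (- r * y / 2))\<^sup>2" for y
  have h: "h y = exp (- s * y) + exp (- r * y) - 2 * exp (- ((s + r) / 2) * y)" for y
  proof -
    have *: "exp (- s * y / 2) * exp (- s * y / 2) = exp (- s * y)"
      "exp (- r * y / 2) * exp (- r * y / 2) = exp (- r * y)"
      "exp (- s * y / 2) * exp (- r * y / 2) = exp (- ((s + r) / 2) * y)"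
      by (simp_all add: field_simps flip: exp_add)
    show ?thesis unfolding h_def power2_diff by (simp only: power2_eq_square mult.assoc *)
  qed
  have inth: "integrable \<rho> h" unfolding h[abs_def] using S(1) R(1) C(1) by auto
  have "(\<integral>y. h y \<partial>\<rho>) \<le> 0"
    unfolding h using S(1) R(1) C(1) int1 int2 by simp
  moreover have "0 \<le> (\<integral>y. h y \<partial>\<rho>)" by (rule integral_nonneg_AE) (simp add: h_def)
  ultimately have "(\<integral>y. h y \<partial>\<rho>) = 0" by simp
  then have "AE y in \<rho>. h y = 0"
    using inth by (subst (asm) integral_nonneg_eq_0_iff_AE) (auto simp: h_def)
  then have y0: "AE y in \<rho>. y = 0"
    by eventually_elim (use ne in \<open>auto simp: h_def\<close>)
  have "laplace \<rho> q = laplace \<rho> s"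
    unfolding laplace_def by (rule nn_integral_cong_AE) (use y0 in \<open>eventually_elim, simp\<close>)
  with q s show False by simp
qed

lemma ennpowr_top [simp]: "ennpowr \<top> p = \<top>"
  and ennpowr_ennreal: "0 \<le> c \<Longrightarrow> ennpowr (ennreal c) p = ennreal (c powr p)"
  by (simp_all add: ennpowr_def)

lemma ennpowr_compare_one:
  assumes "p > 0"
  shows "ennpowr x p \<le> 1 \<longleftrightarrow> x \<le> 1" "1 \<le> ennpowr x p \<longleftrightarrow> 1 \<le> x"
proof -
  have "c powr p \<le> 1 \<longleftrightarrow> c \<le> 1" "1 \<le> c powr p \<longleftrightarrow> 1 \<le> c" if "0 \<le> c" for c :: real
  proof -
    have "c \<le> 1 \<Longrightarrow> c powr p \<le> 1" "1 \<le> c \<Longrightarrow> 1 \<le> c powr p"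
      using powr_mono2[of p c 1] powr_mono2[of p 1 c] assms that by simp_all
    moreover have "c < 1 \<Longrightarrow> c powr p < 1" "1 < c \<Longrightarrow> 1 < c powr p"
      using powr_less_mono2[of p c 1] powr_less_mono2[of p 1 c] assms that by simp_all
    ultimately show "c powr p \<le> 1 \<longleftrightarrow> c \<le> 1" "1 \<le> c powr p \<longleftrightarrow> 1 \<le> c"
      by (meson not_le)+
  qed
  then show "ennpowr x p \<le> 1 \<longleftrightarrow> x \<le> 1" "1 \<le> ennpowr x p \<longleftrightarrow> 1 \<le> x"
    by (cases x rule: ennreal_cases; simp add: ennpowr_ennreal top_unique)+
qed

text \<open>Comparisons of m(\<theta>)^(1/\<theta>) with exp(- a) become comparisons of exp(a
  \<theta>) m(\<theta>) with 1.\<close>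

lemma ennpowr_tilt:
  assumes "\<theta> > 0"
  shows "ennpowr x (1 / \<theta>) = ennreal (exp (- a)) * ennpowr (ennreal (exp (a * \<theta>)) * x) (1 / \<theta>)"
proof (cases x rule: ennreal_cases)
  case (real c)
  have "exp (- a) * (exp (a * \<theta>) * c) powr (1 / \<theta>) = exp (- a) * (exp a * c powr (1 / \<theta>))"
    using assms real by (simp add: powr_mult exp_powr_real)
  also have "\<dots> = c powr (1 / \<theta>)" by (simp add: mult.assoc[symmetric] flip: exp_add)
  finally show ?thesis using real
    by (simp add: ennpowr_ennreal ennreal_mult[symmetric])
qed (simp add: ennreal_mult_top)

section \<open>The drift of the tilted step law\<close>

context offspring_laws
begin

definition intensity_laplace :: "real \<Rightarrow> ennreal" where
  "intensity_laplace \<theta> = (\<integral>\<^sup>+e. child_sum (\<lambda>x. ennreal (exp (- \<theta> * x))) e \<partial>\<nu> [])"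

text \<open>All tilted laws have translates of one function as transforms: the value at s = 0 is the
  total mass, and negative s undoes part of the tilt.\<close>

lemma laplace_step_law:
  "laplace (step_law t a) s = ennreal (exp (a * (t + s))) * intensity_laplace (t + s)"
proof -
  have "laplace (step_law t a) s =
    (\<integral>\<^sup>+e. child_sum (\<lambda>x. ennreal (exp (- t * (x - a))) * ennreal (exp (- s * (x - a)))) e \<partial>\<nu> [])"
    unfolding laplace_def by (rule nn_integral_step_law) simp
  also have "(\<lambda>x. ennreal (exp (- t * (x - a))) * ennreal (exp (- s * (x - a)))) =
      (\<lambda>x. ennreal (exp (a * (t + s))) * ennreal (exp (- (t + s) * x)))"
    by (simp add: fun_eq_iff ennreal_mult[symmetric] exp_add[symmetric] algebra_simps)
  also have "child_sum (\<lambda>x. ennreal (exp (a * (t + s))) * ennreal (exp (- (t + s) * x))) =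
      (\<lambda>e. ennreal (exp (a * (t + s))) * child_sum (\<lambda>x. ennreal (exp (- (t + s) * x))) e)"
    unfolding child_sum_def ennreal_suminf_cmult[symmetric] by (intro ext suminf_cong) auto
  also have "(\<integral>\<^sup>+e. ennreal (exp (a * (t + s))) * child_sum (\<lambda>x. ennreal (exp (- (t + s) * x))) e \<partial>\<nu> []) =
    ennreal (exp (a * (t + s))) * intensity_laplace (t + s)"
    unfolding intensity_laplace_def by (intro nn_integral_cmult measurable_child_sum_\<nu>) simp
  finally show ?thesis .
qed

text \<open>If exp(a \<theta>) m(\<theta>) falls below 1 at some r >= 1, minimality gives t < r and
  \<open>mean_pos_of_laplace_less_one\<close> applies. Otherwise it is at least 1 on [1, oo) and
  equal to 1 at t, so a is the boundary value and t is the minimiser. Then m(\<theta>) = exp(- a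
  \<theta>) L(\<theta> - t) with L the transform of the step law; its left derivative at t is exp(-
  a t) (- a - mean), so the derivative condition reads a < a + mean.\<close>

lemma step_law_mean_pos:
  assumes a: "a > 0" and t: "1 < t" "ennreal (exp (a * t)) * intensity_laplace t = 1"
    and one: "intensity_laplace 1 = 1"
    and least: "\<And>y. 1 < y \<Longrightarrow> ennreal (exp (a * y)) * intensity_laplace y = 1 \<Longrightarrow> t \<le> y"
    and t2: "t \<le> 2"
    and deriv: "\<And>D t0. \<lbrakk>a = - ln (enn2real (INF r\<in>{1..}. ennpowr (intensity_laplace r) (1 / r)));
      t0 = (THE t. t \<in> {1<..2} \<and> ennpowr (intensity_laplace t) (1 / t) =
        (INF \<theta>\<in>{1..2}. ennpowr (intensity_laplace \<theta>) (1 / \<theta>)));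
      D = vector_derivative (\<lambda>\<theta>. enn2real (intensity_laplace \<theta>)) (at_left t0)\<rbrakk> \<Longrightarrow>
      - ln (enn2real (intensity_laplace t0)) / t0 < - D / enn2real (intensity_laplace t0)"
  shows "prob_space (step_law t a) \<and> integrable (step_law t a) (\<lambda>y. y) \<and> (\<integral>y. y \<partial>step_law t a) > 0"
proof -
  define F where "F \<theta> = ennreal (exp (a * \<theta>)) * intensity_laplace \<theta>" for \<theta>
  let ?Q = "step_law t a"
  have LQ: "laplace ?Q s = F (t + s)" for s by (simp add: laplace_step_law F_def)
  have L\<rho>: "laplace (step_law 0 a) \<theta> = F \<theta>" for \<theta> by (simp add: laplace_step_law F_def)
  have Ft: "F t = 1" and F1: "F 1 = ennreal (exp a)" using t one by (simp_all add: F_def)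
  have F1': "1 < F 1" "F 1 < \<infinity>" unfolding F1 using a by (simp_all add: one_less_ennreal)
  have prob: "prob_space ?Q"
  proof (rule prob_spaceI)
    have "laplace ?Q 0 = emeasure ?Q (space ?Q)" by (simp add: laplace_def)
    then show "emeasure ?Q (space ?Q) = 1" using Ft by (simp add: LQ)
  qed
  have d: "t - 1 > 0" "laplace ?Q (- (t - 1)) < \<infinity>" using t F1'(2) by (simp_all add: LQ)
  show ?thesis
  proof (cases "\<exists>r\<ge>1. F r < 1")
    case True
    then obtain r where r: "r \<ge> 1" "F r < 1" by blast
    have "t \<le> r"
    proof -
      obtain x where "1 < x" "x \<le> r" "F x = 1"
        using laplace_root[of "step_law 0 a" r] F1' r by (auto simp: L\<rho> less_imp_le)
      then show ?thesis using least[of x] by (simp add: F_def)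
    qed
    moreover have "t \<noteq> r" using r Ft by auto
    ultimately have "r - t > 0" "laplace ?Q (r - t) < 1" using r by (simp_all add: LQ)
    from mean_pos_of_laplace_less_one[OF prob sets_step_law d this] prob show ?thesis by simp
  next
    case False
    then have Fge: "1 \<le> F r" if "r \<ge> 1" for r using that by (auto simp: not_less)
    have tilt: "ennpowr (intensity_laplace r) (1 / r) = ennreal (exp (- a)) * ennpowr (F r) (1 / r)" if "r > 0" for r
      unfolding F_def by (rule ennpowr_tilt[OF that])
    have at_t: "ennpowr (intensity_laplace t) (1 / t) = ennreal (exp (- a))"
      by (subst tilt) (use t(1) in \<open>auto simp: Ft ennpowr_def\<close>)
    have ge: "ennreal (exp (- a)) \<le> ennpowr (intensity_laplace r) (1 / r)" if "r \<ge> 1" for r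
    proof -
      have "1 \<le> ennpowr (F r) (1 / r)" using that Fge[OF that] by (subst ennpowr_compare_one) auto
      from mult_left_mono[OF this, of "ennreal (exp (- a))"] show ?thesis using that by (simp add: tilt)
    qed
    \<comment> \<open>The bound t <= 2 puts the minimiser into both ranges, so the two infima
      agree.\<close>
    have INF: "(INF r\<in>{1..}. ennpowr (intensity_laplace r) (1 / r)) = ennreal (exp (- a))"
      "(INF r\<in>{1..2}. ennpowr (intensity_laplace r) (1 / r)) = ennreal (exp (- a))"
      using t(1) t2 ge by (auto intro!: antisym INF_greatest INF_lower2[of t] simp: at_t)
    have the: "(THE t. t \<in> {1<..2} \<and> ennpowr (intensity_laplace t) (1 / t) =
        (INF \<theta>\<in>{1..2}. ennpowr (intensity_laplace \<theta>) (1 / \<theta>))) = t"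
      unfolding INF
    proof (rule the_equality)
      show "t \<in> {1<..2} \<and> ennpowr (intensity_laplace t) (1 / t) = ennreal (exp (- a))"
        using t t2 at_t by simp
      fix s assume s: "s \<in> {1<..2} \<and> ennpowr (intensity_laplace s) (1 / s) = ennreal (exp (- a))"
      have "ennreal (exp a) * (ennreal (exp (- a)) * ennpowr (F s) (1 / s)) = ennreal (exp a) * ennreal (exp (- a))"
        using s by (subst tilt[symmetric]) auto
      then have "ennpowr (F s) (1 / s) = 1"
        by (simp add: mult.assoc[symmetric] ennreal_mult[symmetric] exp_add[symmetric])
      then have "F s = 1" using ennpowr_compare_one[of "1 / s" "F s"] s by (auto intro: antisym)
      then show "s = t"
        using laplace_eq_one_unique[of "step_law 0 a" s t 1] Ft F1'(1) Fge[of "(s + t) / 2"] s t(1)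
        by (simp add: L\<rho>)
    qed
    have left: "integrable ?Q (\<lambda>y. y)"
      "((\<lambda>\<theta>. enn2real (laplace ?Q \<theta>)) has_real_derivative - (\<integral>y. y \<partial>?Q)) (at_left 0)"
      using laplace_left_derivative[OF prob sets_step_law d] Fge by (simp_all add: LQ)
    have img: "(\<lambda>\<theta>. \<theta> - t) ` {..<t} = {..<0}"
      by (auto simp: image_iff intro!: bexI[of _ "_ + t"])
    have "((\<lambda>\<theta>. enn2real (laplace ?Q \<theta>)) \<circ> (\<lambda>\<theta>. \<theta> - t) has_real_derivative - (\<integral>y. y \<partial>?Q) * 1) (at_left t)"
      by (rule DERIV_image_chain) (use left(2) img in \<open>auto intro!: derivative_eq_intros\<close>)
    then have "((\<lambda>\<theta>. exp (- a * \<theta>) * enn2real (laplace ?Q (\<theta> - t))) has_real_derivative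
        - a * exp (- a * t) * enn2real (laplace ?Q (t - t)) + exp (- a * t) * (- (\<integral>y. y \<partial>?Q))) (at_left t)"
      unfolding comp_def by (auto intro!: derivative_eq_intros)
    moreover have "exp (- a * \<theta>) * enn2real (laplace ?Q (\<theta> - t)) = enn2real (intensity_laplace \<theta>)" for \<theta>
      unfolding LQ F_def by (simp add: enn2real_mult mult.assoc[symmetric] flip: exp_add)
    ultimately have "((\<lambda>\<theta>. enn2real (intensity_laplace \<theta>)) has_real_derivative
        exp (- a * t) * (- a - (\<integral>y. y \<partial>?Q))) (at_left t)"
      by (simp add: LQ Ft algebra_simps)
    then have vd: "vector_derivative (\<lambda>\<theta>. enn2real (intensity_laplace \<theta>)) (at_left t) = exp (- a * t) * (- a - (\<integral>y. y \<partial>?Q))"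
      unfolding has_real_derivative_iff_has_vector_derivative
      by (intro vector_derivative_within) (auto simp: trivial_limit_at_left_real)
    have mt: "enn2real (intensity_laplace t) = exp (- a * t)"
    proof -
      have "exp (- a * t) * enn2real (F t) = enn2real (intensity_laplace t)"
        unfolding F_def by (simp add: enn2real_mult mult.assoc[symmetric] flip: exp_add)
      then show ?thesis by (simp add: Ft)
    qed
    have "- ln (enn2real (intensity_laplace t)) / t <
        - vector_derivative (\<lambda>\<theta>. enn2real (intensity_laplace \<theta>)) (at_left t) / enn2real (intensity_laplace t)"
    proof (rule deriv)
      show "a = - ln (enn2real (INF r\<in>{1..}. ennpowr (intensity_laplace r) (1 / r)))"
        unfolding INF by simp
    qed (simp_all only: the)
    then have "0 < (\<integral>y. y \<partial>?Q)" using t(1) unfolding vd mt by (simp add: field_simps zero_less_mult_iff)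
    with prob left(1) show ?thesis by simp
  qed
qed

end

section \<open>The branching random walk\<close>

text \<open>This extends equality in law from the evaluations at Borel sets to integrals.\<close>

lemma nn_integral_measurable_in_evaluations:
  fixes f :: "real \<Rightarrow> ennreal"
  assumes "f \<in> borel_measurable borel"
  shows "\<exists>\<Psi>\<in>borel_measurable (\<Pi>\<^sub>M B\<in>sets borel. borel).
    \<forall>N. sets N = sets borel \<longrightarrow> (\<integral>\<^sup>+x. f x \<partial>N) = \<Psi> (\<lambda>B\<in>sets borel. emeasure N B)"
proof -
  obtain s :: "nat \<Rightarrow> real \<Rightarrow> ennreal" where s: "\<And>i. simple_function borel (s i)" "incseq s"
    "\<And>x. (SUP i. s i x) = f x"
    using borel_measurable_implies_simple_function_sequence'[OF assms] by metis
  \<comment> \<open>Integration of the simple approximations of \<open>f\<close>: only the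
    evaluations at their level sets are read, countably many in all, so \<open>\<Psi>\<close> is
    measurable on the uncountable product.\<close>
  define \<Psi> where "\<Psi> w = (SUP i. \<Sum>y\<in>range (s i). y * w (s i -` {y}))" for w :: "real set \<Rightarrow> ennreal"
  have B: "s i -` {y} \<in> sets borel" for i y
    using simple_functionD(2)[OF s(1)[of i], of "{y}"] by simp
  have "\<Psi> \<in> borel_measurable (\<Pi>\<^sub>M B\<in>sets borel. borel)"
  proof -
    have [measurable]: "(\<lambda>w. w (s i -` {y})) \<in> borel_measurable (\<Pi>\<^sub>M B\<in>sets borel. borel)" for i y
      using measurable_component_singleton[OF B] .
    show ?thesis unfolding \<Psi>_def[abs_def] by measurable
  qed
  moreover have "(\<integral>\<^sup>+x. f x \<partial>N) = \<Psi> (\<lambda>B\<in>sets borel. emeasure N B)" if N [measurable_cong]: "sets N = sets borel" for N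
  proof -
    have space: "space N = UNIV" using sets_eq_imp_space_eq[OF N] by simp
    have sN: "simple_function N (s i)" for i
      using s(1)[of i] B[of i] by (simp add: simple_function_def space N)
    have "(\<integral>\<^sup>+x. f x \<partial>N) = (\<integral>\<^sup>+x. (SUP i. s i x) \<partial>N)" by (simp add: s(3))
    also have "\<dots> = (SUP i. \<integral>\<^sup>+x. s i x \<partial>N)"
      using borel_measurable_simple_function[OF sN] by (intro nn_integral_monotone_convergence_SUP s(2)) auto
    also have "\<dots> = (SUP i. \<Sum>y\<in>range (s i). y * emeasure N (s i -` {y}))"
      by (simp add: nn_integral_eq_simple_integral[OF sN] simple_integral_def space)
    also have "\<dots> = \<Psi> (\<lambda>B\<in>sets borel. emeasure N B)"
      unfolding \<Psi>_def using B by simp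
    finally show ?thesis .
  qed
  ultimately show ?thesis by blast
qed

context branching_random_walk
begin

definition family :: "nat list \<Rightarrow> 'w \<Rightarrow> enat \<times> (nat \<Rightarrow> real)" where
  "family u \<omega> = (J u \<omega>, \<lambda>i. X u i \<omega>)"

definition \<nu> :: "nat list \<Rightarrow> (enat \<times> (nat \<Rightarrow> real)) measure" where
  "\<nu> u = distr M offspring_space (family u)"

lemma measurable_family [measurable]: "family u \<in> measurable M offspring_space"
  using independent unfolding indep_vars_def family_def[abs_def] offspring_space_def by simp

lemma distr_families: "distr M (PiM UNIV (\<lambda>_. offspring_space)) (\<lambda>\<omega> u. family u \<omega>) = PiM UNIV \<nu>"
proof -
  have "indep_vars (\<lambda>_. offspring_space) family UNIV"
    using independent by (simp add: family_def[abs_def] offspring_space_def)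
  then show ?thesis
    unfolding \<nu>_def[abs_def] by (subst (asm) indep_vars_iff_distr_eq_PiM) (auto simp: restrict_UNIV)
qed

lemma emeasure_point_process:
  assumes "B \<in> sets borel"
  shows "emeasure (point_process (J u \<omega>) (\<lambda>i. X u i \<omega>)) B = child_sum (indicator B) (family u \<omega>)"
proof -
  have "emeasure (point_process (J u \<omega>) (\<lambda>i. X u i \<omega>)) B = (\<integral>\<^sup>+x. indicator B x \<partial>point_process (J u \<omega>) (\<lambda>i. X u i \<omega>))"
    using assms by (subst nn_integral_indicator) (auto simp: point_process_def)
  also have "\<dots> = child_sum (indicator B) (family u \<omega>)"
    using assms by (subst child_sum_point_process) (auto simp: family_def)
  finally show ?thesis .
qed

text \<open>A child sum is an integral against the point process, hence a measurable function of the
  evaluations, whose joint law is the same for every \<open>u\<close>.\<close>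

lemma nn_integral_child_sum_cong:
  assumes f: "f \<in> borel_measurable borel" and g [measurable]: "g \<in> borel_measurable borel"
  shows "(\<integral>\<^sup>+\<omega>. g (child_sum f (family u \<omega>)) \<partial>M) = (\<integral>\<^sup>+\<omega>. g (child_sum f (family [] \<omega>)) \<partial>M)"
proof -
  let ?S = "\<Pi>\<^sub>M B\<in>sets (borel :: real measure). (borel :: ennreal measure)"
  define ev where "ev u \<omega> = (\<lambda>B\<in>sets borel. emeasure (point_process (J u \<omega>) (\<lambda>i. X u i \<omega>)) B)" for u \<omega>
  have ev [measurable]: "ev u \<in> measurable M ?S" for u
    unfolding ev_def[abs_def]
  proof (rule measurable_restrict)
    fix B :: "real set" assume B: "B \<in> sets borel"
    have "child_sum (indicator B) \<in> borel_measurable offspring_space"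
      using B by (intro measurable_child_sum_const) simp
    from measurable_compose[OF measurable_family this]
    show "(\<lambda>\<omega>. emeasure (point_process (J u \<omega>) (\<lambda>i. X u i \<omega>)) B) \<in> borel_measurable M"
      using B by (simp add: emeasure_point_process)
  qed
  obtain \<Psi> where \<Psi> [measurable]: "\<Psi> \<in> borel_measurable ?S"
    and eq: "\<And>N. sets N = sets borel \<Longrightarrow> (\<integral>\<^sup>+x. f x \<partial>N) = \<Psi> (\<lambda>B\<in>sets borel. emeasure N B)"
    using nn_integral_measurable_in_evaluations[OF f] by blast
  have cs: "child_sum f (family u \<omega>) = \<Psi> (ev u \<omega>)" for u \<omega>
  proof -
    have "child_sum f (family u \<omega>) = (\<integral>\<^sup>+x. f x \<partial>point_process (J u \<omega>) (\<lambda>i. X u i \<omega>))"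
      using f by (simp add: child_sum_point_process family_def)
    also have "\<dots> = \<Psi> (ev u \<omega>)" unfolding ev_def by (rule eq) (simp add: point_process_def)
    finally show ?thesis .
  qed
  have "(\<integral>\<^sup>+\<omega>. g (child_sum f (family u \<omega>)) \<partial>M) = (\<integral>\<^sup>+w. g (\<Psi> w) \<partial>distr M ?S (ev u))" for u
    unfolding cs by (subst nn_integral_distr) auto
  moreover have "distr M ?S (ev u) = distr M ?S (ev [])"
    using identically_distributed[of u] by (simp add: ev_def[abs_def])
  ultimately show ?thesis by simp
qed

lemma nn_integral_\<nu>: "h \<in> borel_measurable offspring_space \<Longrightarrow> (\<integral>\<^sup>+e. h e \<partial>\<nu> u) = (\<integral>\<^sup>+\<omega>. h (family u \<omega>) \<partial>M)"
  unfolding \<nu>_def by (rule nn_integral_distr) simp_all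

sublocale laws: offspring_laws \<nu>
proof (rule offspring_laws.intro)
  show "prob_space (\<nu> u)" for u unfolding \<nu>_def by (rule prob_space_distr) simp
  show "sets (\<nu> u) = sets offspring_space" for u by (simp add: \<nu>_def)
  fix f :: "real \<Rightarrow> ennreal" and g :: "ennreal \<Rightarrow> ennreal" and u
  assume f: "f \<in> borel_measurable borel" and g: "g \<in> borel_measurable borel"
  have h: "(\<lambda>e. g (child_sum f e)) \<in> borel_measurable offspring_space"
    by (rule measurable_compose[OF measurable_child_sum_const[OF f] g])
  show "(\<integral>\<^sup>+e. g (child_sum f e) \<partial>\<nu> u) = (\<integral>\<^sup>+e. g (child_sum f e) \<partial>\<nu> [])"
    unfolding nn_integral_\<nu>[OF h] by (rule nn_integral_child_sum_cong[OF f g])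
qed

lemma m_eq: "m M J X = laws.intensity_laplace"
proof
  fix \<theta>
  have "m M J X \<theta> = (\<integral>\<^sup>+\<omega>. child_sum (\<lambda>x. ennreal (exp (- \<theta> * x))) (family [] \<omega>) \<partial>M)"
    unfolding m_def by (intro nn_integral_cong) (simp add: child_sum_point_process family_def)
  also have "\<dots> = laws.intensity_laplace \<theta>"
    unfolding laws.intensity_laplace_def
    by (intro nn_integral_\<nu>[symmetric] measurable_child_sum_const) simp
  finally show "m M J X \<theta> = laws.intensity_laplace \<theta>" .
qed

lemma W_part_1_eq: "W_part J X 1 \<omega> = laws.mass (family [] \<omega>)"
  unfolding W_part_1 laws.mass_def by (simp add: child_sum_point_process family_def)

lemma W_part_eq:
  "W_part J X n \<omega> = (\<integral>\<^sup>+u. (if live (\<lambda>u. family u \<omega>) u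
      then ennreal (exp (- (shifted_position a (\<lambda>u. family u \<omega>) u + a * real n))) else 0) \<partial>count_space {u. length u = n})"
proof -
  have gen: "generation J n \<omega> = {u \<in> {u. length u = n}. live (\<lambda>u. family u \<omega>) u}"
    by (auto simp: generation_def live_def family_def)
  have pos: "shifted_position a (\<lambda>u. family u \<omega>) u + a * real (length u) = position X u \<omega>" for u
    by (simp add: shifted_position_def position_def family_def sum_subtractf)
  show ?thesis
    unfolding W_part_def gen
    by (subst (1 2) nn_integral_count_space_indicator) 
      (auto intro!: nn_integral_cong simp: pos[symmetric] split: split_indicator)
qed

end

theorem theorem1p1:
  fixes M :: "'w measure"
    and J :: "nat list \<Rightarrow> 'w \<Rightarrow> enat"
    and X :: "nat list \<Rightarrow> nat \<Rightarrow> 'w \<Rightarrow> real"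
    and a :: real
  assumes "branching_random_walk M J X"
    and "(\<integral>\<^sup>+ \<omega>. ennreal_of_enat (J [] \<omega>) \<partial>M) > 1"
    and "m M J X 1 = 1"
    and "a > 0"
    and "\<exists>r. 1 < r \<and> r < 2 \<and> ennreal (exp a) * ennpowr (m M J X r) (1 / r) \<le> 1"
    and "(\<integral>\<^sup>+ \<omega>. ennpowr (W_part J X 1 \<omega>) (vartheta M J X a) \<partial>M) < \<infinity>"
    and "a = - ln (enn2real (INF r\<in>{1..}. ennpowr (m M J X r) (1 / r))) \<Longrightarrow>
         - ln (enn2real (m M J X (vartheta0 M J X))) / vartheta0 M J X
           < - m_left_deriv M J X (vartheta0 M J X) / enn2real (m M J X (vartheta0 M J X))"
  shows "AE \<omega> in M. summable (\<lambda>n. exp (a * real n) * (W_lim J X \<omega> - enn2real (W_part J X n \<omega>)))"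
proof -
  interpret branching_random_walk M J X by fact
  note one = assms(3)[unfolded m_eq]
  have L: "laplace (laws.step_law 0 a) \<theta> = ennreal (exp (a * \<theta>)) * laws.intensity_laplace \<theta>" for \<theta>
    by (simp add: laws.laplace_step_law)
  obtain r where r: "1 < r" "r < 2" "ennreal (exp a) * ennpowr (laws.intensity_laplace r) (1 / r) \<le> 1"
    using assms(5) unfolding m_eq by blast
  have "ennpowr (laplace (laws.step_law 0 a) r) (1 / r) \<le> 1"
  proof -
    have "ennreal (exp a) * ennpowr (laws.intensity_laplace r) (1 / r) =
      ennreal (exp a) * (ennreal (exp (- a)) * ennpowr (laplace (laws.step_law 0 a) r) (1 / r))"
      using r(1) unfolding L by (subst ennpowr_tilt[of r _ a]) auto
    also have "\<dots> = ennpowr (laplace (laws.step_law 0 a) r) (1 / r)"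
      by (simp add: mult.assoc[symmetric] ennreal_mult[symmetric] exp_add[symmetric])
    finally show ?thesis using r(3) by simp
  qed
  then have r1: "laplace (laws.step_law 0 a) r \<le> 1" using r(1) by (simp add: ennpowr_compare_one)
  \<comment> \<open>At 1 the transform is exp a > 1 and at \<open>r\<close> it is at most 1, so the
    least root lies in (1, r], strictly below 2.\<close>
  have "1 < laplace (laws.step_law 0 a) 1" "laplace (laws.step_law 0 a) 1 < \<infinity>"
    using one \<open>a > 0\<close> by (simp_all add: L one_less_ennreal)
  from laplace_root[OF laws.sets_step_law this _ r1] r(1)
  obtain t where t: "1 < t" "t \<le> r" "ennreal (exp (a * t)) * laws.intensity_laplace t = 1"
    and least: "\<And>y. 1 < y \<Longrightarrow> ennreal (exp (a * y)) * laws.intensity_laplace y = 1 \<Longrightarrow> t \<le> y"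
    by (auto simp: L)
  have vt: "vartheta M J X a = t"
    unfolding vartheta_def m_eq using t least by (intro Least_equality) auto
  have step: "prob_space (laws.step_law t a) \<and> integrable (laws.step_law t a) (\<lambda>y. y) \<and> (\<integral>y. y \<partial>laws.step_law t a) > 0"
  proof (rule laws.step_law_mean_pos)
    fix D t0
    assume "a = - ln (enn2real (INF r\<in>{1..}. ennpowr (laws.intensity_laplace r) (1 / r)))"
      and "t0 = (THE t. t \<in> {1<..2} \<and> ennpowr (laws.intensity_laplace t) (1 / t) =
        (INF \<theta>\<in>{1..2}. ennpowr (laws.intensity_laplace \<theta>) (1 / \<theta>)))"
      and "D = vector_derivative (\<lambda>\<theta>. enn2real (laws.intensity_laplace \<theta>)) (at_left t0)"
    then show "- ln (enn2real (laws.intensity_laplace t0)) / t0 < - D / enn2real (laws.intensity_laplace t0)"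
      using assms(7) unfolding m_eq vartheta0_def m_left_deriv_def by simp
  qed (use t r \<open>a > 0\<close> one least in auto)
  interpret tilted_offspring \<nu> t a
  proof (intro tilted_offspring.intro tilted_offspring_axioms.intro laws.offspring_laws_axioms)
    show "1 < t" "t < 2" "a > 0" using t r \<open>a > 0\<close> by auto
    show "(\<integral>\<^sup>+e. laws.mass e \<partial>\<nu> []) = 1"
      using one by (simp add: laws.intensity_laplace_def laws.mass_def)
    have "(\<lambda>e. ennpowr (laws.mass e) t) \<in> borel_measurable offspring_space"
      unfolding ennpowr_def by measurable
    then have "(\<integral>\<^sup>+e. ennpowr (laws.mass e) t \<partial>\<nu> []) = (\<integral>\<^sup>+\<omega>. ennpowr (W_part J X 1 \<omega>) t \<partial>M)"
      by (simp only: nn_integral_\<nu> W_part_1_eq)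
    then show "(\<integral>\<^sup>+e. ennpowr (laws.mass e) t \<partial>\<nu> []) < \<infinity>" using assms(6) by (simp only: vt)
    show "prob_space (laws.step_law t a)" "integrable (laws.step_law t a) (\<lambda>y. y)"
      "0 < (\<integral>y. y \<partial>laws.step_law t a)" using step by (blast, blast, blast)
  qed
  have W: "W_part J X n \<omega> = total n (\<lambda>u. family u \<omega>)" for n \<omega>
    unfolding total_def by (rule W_part_eq)
  have fam: "(\<lambda>\<omega> u. family u \<omega>) \<in> measurable M (PiM UNIV (\<lambda>_. offspring_space))"
    by (rule measurable_PiM_single') (auto simp: space_PiM measurable_space[OF measurable_family])
  \<comment> \<open>By independence the joint law of the families is the product of the
    \<open>\<nu> u\<close>, so the almost sure statement on the product space transfers back to
    \<open>M\<close>.\<close>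
  have "AE \<omega> in M. summable (\<lambda>n. exp (a * real n) *
      (lim (\<lambda>n. enn2real (total n (\<lambda>u. family u \<omega>))) - enn2real (total n (\<lambda>u. family u \<omega>))))"
    by (rule AE_distrD[OF fam], unfold distr_families, rule AE_summable_tail)
  then show ?thesis unfolding W_lim_def W .
qed

end
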